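(* Let $D$ be a period domain parameterizing weight $n$ polarized Hodge structures, with bracket-generating infinitesimal period relation. Suppose there exists a limiting mixed Hodge structure $(V,W_\bullet(N),F^\bullet)$ for $D$ that maps to the closed $G_{\mathbb R}$-orbit in $\check D$ under the reduced limit period mapping, but is not of Hodge–Tate type. Then $n=2m$ is even and: (a) For $k\ne0$, $\mathrm{Gr}^{W_\bullet(N)}_{n+k,\mathrm{prim}}$ is of Hodge–Tate type. (Thus $k$ is even whenever it is nonzero.) (b) For $k\neq0$, $\mathrm{Gr}^{W_\bullet(N)}_{n+k,\mathrm{prim}}\ne0$ implies $k\equiv2\pmod 4$. (c) $\mathrm{Gr}^{W_\bullet(N)}_{n,\mathrm{prim}}\neq0$, and the only nonzero $I^{p,q}_{\mathrm{prim}}$ with $p+q=n$ are $I^{m+1,m-1}_{\mathrm{prim}}$ and $I^{m-1,m+1}_{\mathrm{prim}}$.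
   Context: A polarized Hodge structure of weight $n$ is $(V,Q,F^\bullet)$ with $V$ a real vector space, $Q$ a nondegenerate $(-1)^n$-symmetric bilinear form, and $F^n\subset\dots\subset F^0=V_{\mathbb C}$ with $F^p\oplus\overline{F^{n-p+1}}=V_{\mathbb C}$, $Q(F^p,F^{n-p+1})=0$, and $Q(Cv,\bar v)>0$ for $v\neq0$, where $C=i^{p-q}$ on $V^{p,q}=F^p\cap\overline{F^q}$. The period domain $D$ consists of all $Q$-polarized Hodge structures of weight $n$ on $V$ with fixed Hodge numbers; it is viewed as an open orbit $G_{\mathbb R}/R$ ($G_{\mathbb R}$ the connected group with Lie algebra $\mathfrak g_{\mathbb R}=\mathrm{End}(V_{\mathbb R},Q)$, assumed semisimple, i.e. we work on a connected component) in its compact dual $\check D=G_{\mathbb C}/P$, the variety of $Q$-isotropic filtrations with the same dimensions. $\check D$ contains a unique closed $G_{\mathbb R}$-orbit. At $F^\bullet\in D$, let $\mathfrak g^{p,-p}=\{\xi\in\mathfrak g_{\mathbb C}:\xi(V^{r,s})\subset V^{r+p,s-p}\ \forall r,s\}$. The infinitesimal period relation is the homogeneous subbundle of $T\check D$ given by $\mathfrak g^{-1,1}$; it is bracket-generating if $\mathfrak g^{-1,1}$ generates the Lie algebra $\bigoplus_{p>0}\mathfrak g^{-p,p}$. A nilpotent orbit is a pair $(F^\bullet,N)$ with $F^\bullet\in\check D$, $N\in\mathfrak g_{\mathbb R}$ nilpotent, $e^{zN}F^\bullet\in D$ for $\mathrm{Im}(z)\gg0$, and $N(F^p)\subset F^{p-1}$.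 The associated limiting mixed Hodge structure is $(V,W_\bullet(N),F^\bullet)$, where $W_\bullet(N)$ is the monodromy weight filtration of $N$ on $V$ centered at $n$ ($NW_k\subset W_{k-2}$ and $N^k:\mathrm{Gr}^W_{n+k}\to\mathrm{Gr}^W_{n-k}$ an isomorphism). All limiting mixed Hodge structures are of this form. It maps to an orbit $\mathcal O$ under the reduced limit period mapping if $\lim_{\mathrm{Im}(z)\to\infty}e^{zN}F^\bullet\in\mathcal O$. The Deligne splitting $V_{\mathbb C}=\bigoplus I^{p,q}$ is the unique bigrading with $W_k=\bigoplus_{p+q\le k}I^{p,q}$, $F^p=\bigoplus_{r\ge p}I^{r,\bullet}$ and $\overline{I^{p,q}}\equiv I^{q,p}$ modulo $\bigoplus_{r<q,\,s<p}I^{r,s}$. A mixed Hodge structure is of Hodge–Tate type if $I^{p,q}=0$ for all $p\neq q$. For $k\ge0$ the primitive space is $\mathrm{Gr}^{W_\bullet(N)}_{n+k,\mathrm{prim}}=\ker\{N^{k+1}:\mathrm{Gr}^{W_\bullet(N)}_{n+k}\to\mathrm{Gr}^{W_\bullet(N)}_{n-k-2}\}$, a Hodge structure of weight $n+k$; it is of Hodge–Tate type if its only nonzero Hodge components have type $(p,p)$. $I^{p,q}_{\mathrm{prim}}$ denotes the $(p,q)$-component of $\mathrm{Gr}^{W_\bullet(N)}_{p+q,\mathrm{prim}}$, viewed in $I^{p,q}$. *)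

theory Defs
  imports "HOL-Analysis.Analysis"
begin

text \<open>
  The real vector space \<open>V\<close> is \<open>real^'n\<close>, its complexification is \<open>complex^'n\<close>, and endomorphisms
  are square matrices. A filtration of the complexification is indexed by all integers.
\<close>

type_synonym 'n filtration = "int \<Rightarrow> (complex^'n) set"

section \<open>Complexification\<close>

definition vec_Re :: "complex^'n \<Rightarrow> real^'n" where
  "vec_Re v = (\<chi> i. Re (v $ i))"

definition vec_Im :: "complex^'n \<Rightarrow> real^'n" where
  "vec_Im v = (\<chi> i. Im (v $ i))"

definition vec_cnj :: "complex^'n \<Rightarrow> complex^'n" where
  "vec_cnj v = (\<chi> i. cnj (v $ i))"

definition complexify :: "(real^'n) set \<Rightarrow> (complex^'n) set" where
  "complexify S = {v. vec_Re v \<in> S \<and> vec_Im v \<in> S}"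

abbreviation complex_matrix :: "real^'n^'n \<Rightarrow> complex^'n^'n" where
  "complex_matrix \<equiv> map_matrix complex_of_real"

text \<open>The complex bilinear (not sesquilinear) extension of a real bilinear form.\<close>

definition complex_form ::
    "(real^'n \<Rightarrow> real^'n \<Rightarrow> real) \<Rightarrow> complex^'n \<Rightarrow> complex^'n \<Rightarrow> complex" where
  "complex_form Q u v =
     Complex (Q (vec_Re u) (vec_Re v) - Q (vec_Im u) (vec_Im v))
             (Q (vec_Re u) (vec_Im v) + Q (vec_Im u) (vec_Re v))"

section \<open>Matrix powers and exponential\<close>

text \<open>
  The ring operations that the type class instances provide on nested vectors are componentwise,
  so the library's power and exponential are not those of matrices.
\<close>

definition matrix_power :: "'a::semiring_1^'n^'n \<Rightarrow> nat \<Rightarrow> 'a^'n^'n" where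
  "matrix_power A k = (((**) A) ^^ k) (mat 1)"

definition matrix_exp :: "complex^'n^'n \<Rightarrow> complex^'n^'n" where
  "matrix_exp A = (\<Sum>k. (1 / fact k) *\<^sub>R matrix_power A k)"

definition bracket :: "'a::ring_1^'n^'n \<Rightarrow> 'a^'n^'n \<Rightarrow> 'a^'n^'n" where
  "bracket X Y = X ** Y - Y ** X"

section \<open>Polarized Hodge structures\<close>

definition polarization_form :: "(real^'n \<Rightarrow> real^'n \<Rightarrow> real) \<Rightarrow> nat \<Rightarrow> bool" where
  "polarization_form Q n \<longleftrightarrow>
     bilinear Q \<and> (\<forall>u v. Q v u = (-1) ^ n * Q u v) \<and> (\<forall>u. (\<forall>v. Q u v = 0) \<longrightarrow> u = 0)"

text \<open>\<open>V\<^sup>p\<^sup>,\<^sup>q\<close>, to be used for \<open>p + q = n\<close>.\<close>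

definition hodge_component :: "'n filtration \<Rightarrow> int \<Rightarrow> int \<Rightarrow> (complex^'n) set" where
  "hodge_component F p q = F p \<inter> vec_cnj ` F q"

definition polarized_hodge_structure ::
    "(real^'n \<Rightarrow> real^'n \<Rightarrow> real) \<Rightarrow> nat \<Rightarrow> 'n filtration \<Rightarrow> bool" where
  "polarized_hodge_structure Q n F \<longleftrightarrow>
     (\<forall>p. vec.subspace (F p)) \<and> antimono F \<and>
     (\<forall>p\<le>0. F p = UNIV) \<and> (\<forall>p>int n. F p = {0}) \<and>
     (\<forall>p. F p \<inter> vec_cnj ` F (int n - p + 1) = {0} \<and>
          vec.span (F p \<union> vec_cnj ` F (int n - p + 1)) = UNIV) \<and>
     (\<forall>p. \<forall>u\<in>F p. \<forall>v\<in>F (int n - p + 1). complex_form Q u v = 0) \<and>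
     (\<exists>C. (\<forall>p q. p + q = int n \<longrightarrow>
             (\<forall>v\<in>hodge_component F p q. C *v v = (\<i> powi (p - q)) *s v)) \<and>
          (\<forall>v. v \<noteq> 0 \<longrightarrow> complex_form Q (C *v v) (vec_cnj v) \<in> \<real> \<and>
                         0 < Re (complex_form Q (C *v v) (vec_cnj v))))"

text \<open>
  All \<open>Q\<close>-polarized Hodge structures with Hodge numbers \<open>h p\<close> = dimension of \<open>V\<^sup>p\<^sup>,\<^sup>n\<^sup>-\<^sup>p\<close>. This set need
  not be connected; its connected components are the orbits \<open>period_domain Q F\<^sub>o\<close> below.
\<close>

definition polarized_hodge_structures ::
    "(real^'n \<Rightarrow> real^'n \<Rightarrow> real) \<Rightarrow> nat \<Rightarrow> (int \<Rightarrow> nat) \<Rightarrow> 'n filtration set" where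
  "polarized_hodge_structures Q n h =
     {F. polarized_hodge_structure Q n F \<and>
         (\<forall>p. vec.dim (hodge_component F p (int n - p)) = h p)}"

section \<open>Groups and Lie algebras\<close>

text \<open>Elements of the isometry groups are automatically invertible, \<open>Q\<close> being nondegenerate.\<close>

definition real_group :: "(real^'n \<Rightarrow> real^'n \<Rightarrow> real) \<Rightarrow> (real^'n^'n) set" where
  "real_group Q =
     connected_component_set {g. \<forall>u v. Q (g *v u) (g *v v) = Q u v} (mat 1)"

definition complex_group :: "(real^'n \<Rightarrow> real^'n \<Rightarrow> real) \<Rightarrow> (complex^'n^'n) set" where
  "complex_group Q =
     connected_component_set
       {g. \<forall>u v. complex_form Q (g *v u) (g *v v) = complex_form Q u v} (mat 1)"

definition real_lie_algebra :: "(real^'n \<Rightarrow> real^'n \<Rightarrow> real) \<Rightarrow> (real^'n^'n) set" where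
  "real_lie_algebra Q = {X. \<forall>u v. Q (X *v u) v + Q u (X *v v) = 0}"

definition complex_lie_algebra :: "(real^'n \<Rightarrow> real^'n \<Rightarrow> real) \<Rightarrow> (complex^'n^'n) set" where
  "complex_lie_algebra Q =
     {X. \<forall>u v. complex_form Q (X *v u) v + complex_form Q u (X *v v) = 0}"

definition lie_ideal :: "(real^'n^'n) set \<Rightarrow> (real^'n^'n) set \<Rightarrow> bool" where
  "lie_ideal \<aa> \<gg> \<longleftrightarrow> subspace \<aa> \<and> \<aa> \<subseteq> \<gg> \<and> (\<forall>X\<in>\<gg>. \<forall>Y\<in>\<aa>. bracket X Y \<in> \<aa>)"

definition derived_algebra :: "(real^'n^'n) set \<Rightarrow> (real^'n^'n) set" where
  "derived_algebra \<aa> = span {bracket X Y |X Y. X \<in> \<aa> \<and> Y \<in> \<aa>}"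

definition solvable_lie :: "(real^'n^'n) set \<Rightarrow> bool" where
  "solvable_lie \<aa> \<longleftrightarrow> (\<exists>k. (derived_algebra ^^ k) \<aa> = {0})"

definition semisimple_lie :: "(real^'n^'n) set \<Rightarrow> bool" where
  "semisimple_lie \<gg> \<longleftrightarrow> (\<forall>\<aa>. lie_ideal \<aa> \<gg> \<and> solvable_lie \<aa> \<longrightarrow> \<aa> = {0})"

section \<open>Period domain and compact dual\<close>

definition act :: "complex^'n^'n \<Rightarrow> 'n filtration \<Rightarrow> 'n filtration" where
  "act g F = (\<lambda>p. (*v) g ` F p)"

definition real_orbit ::
    "(real^'n \<Rightarrow> real^'n \<Rightarrow> real) \<Rightarrow> 'n filtration \<Rightarrow> 'n filtration set" where
  "real_orbit Q F = (\<lambda>g. act (complex_matrix g) F) ` real_group Q"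

text \<open>
  The period domain (a connected component of the space of polarized Hodge structures) and its
  compact dual, as homogeneous spaces with base point \<open>F\<^sub>o\<close>.
\<close>

definition period_domain ::
    "(real^'n \<Rightarrow> real^'n \<Rightarrow> real) \<Rightarrow> 'n filtration \<Rightarrow> 'n filtration set" where
  "period_domain Q F\<^sub>o = real_orbit Q F\<^sub>o"

definition compact_dual ::
    "(real^'n \<Rightarrow> real^'n \<Rightarrow> real) \<Rightarrow> 'n filtration \<Rightarrow> 'n filtration set" where
  "compact_dual Q F\<^sub>o = (\<lambda>g. act g F\<^sub>o) ` complex_group Q"

text \<open>The quotient topology for the orbit map of \<open>complex_group Q\<close> at \<open>F\<^sub>o\<close>.\<close>

definition compact_dual_topology ::
    "(real^'n \<Rightarrow> real^'n \<Rightarrow> real) \<Rightarrow> 'n filtration \<Rightarrow> 'n filtration topology" where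
  "compact_dual_topology Q F\<^sub>o =
     topology (\<lambda>U. U \<subseteq> compact_dual Q F\<^sub>o \<and>
       openin (top_of_set (complex_group Q)) {g \<in> complex_group Q. act g F\<^sub>o \<in> U})"

lemma openin_compact_dual_topology:
  "openin (compact_dual_topology Q F\<^sub>o) U \<longleftrightarrow>
     U \<subseteq> compact_dual Q F\<^sub>o \<and>
     openin (top_of_set (complex_group Q)) {g \<in> complex_group Q. act g F\<^sub>o \<in> U}"
proof -
  let ?G = "complex_group Q"
  let ?T = "top_of_set ?G"
  have 1: "{g \<in> ?G. act g F\<^sub>o \<in> S \<inter> T} =
      {g \<in> ?G. act g F\<^sub>o \<in> S} \<inter> {g \<in> ?G. act g F\<^sub>o \<in> T}" for S T by blast
  have 2: "{g \<in> ?G. act g F\<^sub>o \<in> \<Union>K} = (\<Union>S\<in>K. {g \<in> ?G. act g F\<^sub>o \<in> S})" for K by blast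
  have "istopology (\<lambda>U. U \<subseteq> compact_dual Q F\<^sub>o \<and> openin ?T {g \<in> ?G. act g F\<^sub>o \<in> U})"
    unfolding istopology_def 1 2 by (intro conjI allI impI; blast intro: openin_Int openin_Union)
  then show ?thesis
    by (simp add: compact_dual_topology_def topology_inverse')
qed

definition closed_orbit ::
    "(real^'n \<Rightarrow> real^'n \<Rightarrow> real) \<Rightarrow> 'n filtration \<Rightarrow> 'n filtration set \<Rightarrow> bool" where
  "closed_orbit Q F\<^sub>o Z \<longleftrightarrow>
     Z \<in> real_orbit Q ` compact_dual Q F\<^sub>o \<and> closedin (compact_dual_topology Q F\<^sub>o) Z"

section \<open>Infinitesimal period relation\<close>

text \<open>\<open>\<gg>\<^sup>p\<^sup>,\<^sup>-\<^sup>p\<close> at \<open>F\<close>.\<close>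

definition lie_component ::
    "(real^'n \<Rightarrow> real^'n \<Rightarrow> real) \<Rightarrow> nat \<Rightarrow> 'n filtration \<Rightarrow> int \<Rightarrow> (complex^'n^'n) set" where
  "lie_component Q n F p =
     {X \<in> complex_lie_algebra Q. \<forall>r s. r + s = int n \<longrightarrow>
        (*v) X ` hodge_component F r s \<subseteq> hodge_component F (r + p) (s - p)}"

definition complex_lie_subalgebra :: "(complex^'n^'n) set \<Rightarrow> bool" where
  "complex_lie_subalgebra S \<longleftrightarrow>
     0 \<in> S \<and> (\<forall>X\<in>S. \<forall>Y\<in>S. X + Y \<in> S) \<and> (\<forall>c. \<forall>X\<in>S. map_matrix ((*) c) X \<in> S) \<and>
     (\<forall>X\<in>S. \<forall>Y\<in>S. bracket X Y \<in> S)"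

text \<open>The components \<open>\<gg>\<^sup>-\<^sup>p\<^sup>,\<^sup>p\<close> vanish for \<open>p > n\<close>.\<close>

definition bracket_generating ::
    "(real^'n \<Rightarrow> real^'n \<Rightarrow> real) \<Rightarrow> nat \<Rightarrow> 'n filtration \<Rightarrow> bool" where
  "bracket_generating Q n F \<longleftrightarrow>
     complex_lie_subalgebra hull lie_component Q n F (-1) =
     {\<Sum>p=1..int n. X p |X. \<forall>p\<in>{1..int n}. X p \<in> lie_component Q n F (- p)}"

section \<open>Nilpotent orbits and limiting mixed Hodge structures\<close>

definition nilpotent_orbit ::
    "(real^'n \<Rightarrow> real^'n \<Rightarrow> real) \<Rightarrow> 'n filtration \<Rightarrow> 'n filtration \<Rightarrow> real^'n^'n \<Rightarrow> bool" where
  "nilpotent_orbit Q F\<^sub>o F N \<longleftrightarrow>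
     F \<in> compact_dual Q F\<^sub>o \<and>
     N \<in> real_lie_algebra Q \<and> (\<exists>k. matrix_power N k = 0) \<and>
     (\<exists>c. \<forall>z. Im z > c \<longrightarrow>
        act (matrix_exp (map_matrix (\<lambda>x. z * complex_of_real x) N)) F \<in> period_domain Q F\<^sub>o) \<and>
     (\<forall>p. (*v) (complex_matrix N) ` F p \<subseteq> F (p - 1))"

definition maps_to_orbit ::
    "(real^'n \<Rightarrow> real^'n \<Rightarrow> real) \<Rightarrow> 'n filtration \<Rightarrow> 'n filtration \<Rightarrow> real^'n^'n \<Rightarrow>
     'n filtration set \<Rightarrow> bool" where
  "maps_to_orbit Q F\<^sub>o F N Z \<longleftrightarrow>
     (\<exists>L\<in>Z. limitin (compact_dual_topology Q F\<^sub>o)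
        (\<lambda>z. act (matrix_exp (map_matrix (\<lambda>x. z * complex_of_real x) N)) F) L
        (filtercomap Im at_top))"

text \<open>
  The last two conditions say that \<open>N\<^sup>k\<close> induces an injective, respectively surjective, map
  \<open>W\<^bsub>n+k\<^esub> / W\<^bsub>n+k-1\<^esub> \<rightarrow> W\<^bsub>n-k\<^esub> / W\<^bsub>n-k-1\<^esub>\<close>.
\<close>

definition monodromy_weight_filtration ::
    "real^'n^'n \<Rightarrow> nat \<Rightarrow> (int \<Rightarrow> (real^'n) set) \<Rightarrow> bool" where
  "monodromy_weight_filtration N n W \<longleftrightarrow>
     (\<forall>k. subspace (W k)) \<and> mono W \<and> (\<exists>k. W k = {0}) \<and> (\<exists>k. W k = UNIV) \<and>
     (\<forall>k. (*v) N ` W k \<subseteq> W (k - 2)) \<and>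
     (\<forall>k::nat. \<forall>v \<in> W (int n + k).
        matrix_power N k *v v \<in> W (int n - k - 1) \<longrightarrow> v \<in> W (int n + k - 1)) \<and>
     (\<forall>k::nat. \<forall>w \<in> W (int n - k). \<exists>v \<in> W (int n + k).
        w - matrix_power N k *v v \<in> W (int n - k - 1))"

text \<open>Subspaces of \<open>V\<^sub>\<complex>\<close> indexed by pairs of integers whose internal direct sum is \<open>V\<^sub>\<complex>\<close>.\<close>

definition bigrading :: "(int \<Rightarrow> int \<Rightarrow> (complex^'n) set) \<Rightarrow> bool" where
  "bigrading I \<longleftrightarrow>
     (\<forall>p q. vec.subspace (I p q)) \<and>
     vec.span (\<Union>p q. I p q) = UNIV \<and>
     (\<forall>A v. finite A \<and> (\<forall>(p, q)\<in>A. v (p, q) \<in> I p q) \<and> (\<Sum>a\<in>A. v a) = 0 \<longrightarrow>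
        (\<forall>a\<in>A. v a = 0))"

definition graded_sum ::
    "(int \<Rightarrow> int \<Rightarrow> (complex^'n) set) \<Rightarrow> (int \<Rightarrow> int \<Rightarrow> bool) \<Rightarrow> (complex^'n) set" where
  "graded_sum I P = vec.span (\<Union>{I p q |p q. P p q})"

definition deligne_splitting ::
    "(int \<Rightarrow> (real^'n) set) \<Rightarrow> 'n filtration \<Rightarrow> (int \<Rightarrow> int \<Rightarrow> (complex^'n) set) \<Rightarrow> bool" where
  "deligne_splitting W F I \<longleftrightarrow>
     bigrading I \<and>
     (\<forall>k. complexify (W k) = graded_sum I (\<lambda>p q. p + q \<le> k)) \<and>
     (\<forall>p. F p = graded_sum I (\<lambda>r s. r \<ge> p)) \<and>
     (\<forall>p q. let U = graded_sum I (\<lambda>r s. r < q \<and> s < p) in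
        vec.span (vec_cnj ` I p q \<union> U) = vec.span (I q p \<union> U))"

definition hodge_tate :: "(int \<Rightarrow> int \<Rightarrow> (complex^'n) set) \<Rightarrow> bool" where
  "hodge_tate I \<longleftrightarrow> (\<forall>p q. p \<noteq> q \<longrightarrow> I p q = {0})"

section \<open>Primitive subspaces\<close>

text \<open>
  A subspace of a graded quotient \<open>W\<^sub>l / W\<^bsub>l-1\<^esub>\<close> is represented by its preimage in \<open>W\<^sub>l\<close>, i.e. by a
  subspace between \<open>W\<^bsub>l-1\<^esub>\<close> and \<open>W\<^sub>l\<close>. In particular the zero subspace is represented by \<open>W\<^bsub>l-1\<^esub>\<close>.
\<close>

text \<open>The kernel of \<open>N\<^bsup>k+1\<^esup> : W\<^bsub>n+k\<^esub> / W\<^bsub>n+k-1\<^esub> \<rightarrow> W\<^bsub>n-k-2\<^esub> / W\<^bsub>n-k-3\<^esub>\<close>.\<close>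

definition gr_prim ::
    "real^'n^'n \<Rightarrow> nat \<Rightarrow> (int \<Rightarrow> (real^'n) set) \<Rightarrow> nat \<Rightarrow> (real^'n) set" where
  "gr_prim N n W k =
     {v \<in> W (int n + k). matrix_power N (k + 1) *v v \<in> W (int n - k - 3)}"

definition gr_prim_nonzero ::
    "real^'n^'n \<Rightarrow> nat \<Rightarrow> (int \<Rightarrow> (real^'n) set) \<Rightarrow> nat \<Rightarrow> bool" where
  "gr_prim_nonzero N n W k \<longleftrightarrow> gr_prim N n W k \<noteq> W (int n + k - 1)"

text \<open>The Hodge filtration that \<open>F\<close> induces on the complexification of \<open>W\<^sub>l / W\<^bsub>l-1\<^esub>\<close>.\<close>

definition gr_filtration ::
    "(int \<Rightarrow> (real^'n) set) \<Rightarrow> 'n filtration \<Rightarrow> int \<Rightarrow> 'n filtration" where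
  "gr_filtration W F l p =
     vec.span (F p \<inter> complexify (W l) \<union> complexify (W (l - 1)))"

text \<open>The \<open>(p,q)\<close>-component of the \<open>k\<close>-th primitive space, for \<open>p + q = n + k\<close>.\<close>

definition gr_prim_component ::
    "real^'n^'n \<Rightarrow> nat \<Rightarrow> (int \<Rightarrow> (real^'n) set) \<Rightarrow> 'n filtration \<Rightarrow> nat \<Rightarrow> int \<Rightarrow> int \<Rightarrow>
     (complex^'n) set" where
  "gr_prim_component N n W F k p q =
     complexify (gr_prim N n W k) \<inter> hodge_component (gr_filtration W F (int n + k)) p q"

definition gr_prim_hodge_tate ::
    "real^'n^'n \<Rightarrow> nat \<Rightarrow> (int \<Rightarrow> (real^'n) set) \<Rightarrow> 'n filtration \<Rightarrow> nat \<Rightarrow> bool" where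
  "gr_prim_hodge_tate N n W F k \<longleftrightarrow>
     (\<forall>p q. p + q = int n + k \<and> p \<noteq> q \<longrightarrow>
        gr_prim_component N n W F k p q = complexify (W (int n + k - 1)))"

text \<open>
  \<open>I\<^sup>p\<^sup>,\<^sup>q\<close> projects isomorphically onto the \<open>(p,q)\<close>-component of \<open>W\<^bsub>p+q\<^esub> / W\<^bsub>p+q-1\<^esub>\<close>; the subspace
  below corresponds to the \<open>(p,q)\<close>-component of the primitive space, for \<open>p + q \<ge> n\<close>.
\<close>

definition deligne_prim ::
    "real^'n^'n \<Rightarrow> nat \<Rightarrow> (int \<Rightarrow> (real^'n) set) \<Rightarrow> 'n filtration \<Rightarrow>
     (int \<Rightarrow> int \<Rightarrow> (complex^'n) set) \<Rightarrow> int \<Rightarrow> int \<Rightarrow> (complex^'n) set" where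
  "deligne_prim N n W F I p q =
     I p q \<inter> gr_prim_component N n W F (nat (p + q - int n)) p q"

end

theory Submission
  imports Defs "HOL-Computational_Algebra.Polynomial"
begin

text \<open>
  The limit of \<open>e\<^sup>z\<^sup>N F\<close> is the filtration \<open>L\<^sup>p = \<Oplus> I\<^sup>r\<^sup>,\<^sup>s\<close> over \<open>s \<le> n - p\<close>, so that
  \<open>L\<^sup>p \<inter> cnj L\<^sup>p\<close> is the sum of the \<open>I\<^sup>r\<^sup>,\<^sup>s\<close> with \<open>r, s \<le> n - p\<close>. Let \<open>b\<close> be the least
  index occurring in an off-diagonal type, \<open>p = n - b\<close> and \<open>R = L\<^sup>p \<inter> cnj L\<^sup>p\<close>, a real isotropic subspace.
  A real isotropic vector of \<open>R\<^sup>\<bottom>\<close> that is not orthogonal to \<open>L\<^sup>p\<close> would allow one to degenerate \<open>L\<close>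
  further, inside the closure of its orbit, to a point where \<open>L\<^sup>p \<inter> cnj L\<^sup>p\<close> is larger. As the orbit is
  closed there is none; hence \<open>n\<close> is even, \<open>Q\<close> is definite on \<open>R\<^sup>\<bottom> / R\<close>, and therefore
  \<open>W\<^bsub>n-1\<^esub> = R\<close>, which makes all types of weight other than \<open>n\<close> diagonal.

  Since \<open>Q\<close> is definite on \<open>W\<^sub>n / W\<^bsub>n-1\<^esub>\<close>, its signature, computed from the Hodge numbers, bounds
  the dimensions of the primitive spaces and leaves only those in the asserted degrees. Bracket generation
  and semisimplicity enter only to exclude the pure case \<open>W\<^bsub>n-1\<^esub> = 0\<close>, in which only Hodge numbers of
  one parity would be nonzero.
\<close>

section \<open>Complexified vectors and forms\<close>

text \<open>The mixed Hodge structure need not split over the reals, so \<open>I p q\<close> and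
  \<open>I q p\<close> are conjugate only up to types that are smaller in both indices. Such
  corrections never raise an index, so conjugation exchanges the conditions s \<le> b and r \<le> b
  exactly; hence the description of the limit by second indices. Definiteness modulo R comes from a
  single x in L^p outside R. As L^p is isotropic, the real and imaginary parts of x are orthogonal
  and have the same square c. A real vector orthogonal to R, outside R, with square zero or of the
  sign opposite to c, would help to build an isotropic vector pairing nontrivially with x. The
  forbidden degeneration joins a complex unipotent path to a real dilation that shrinks its
  parameter to 0. Since \<open>F\<close> has the flag dimensions of \<open>F\<^sub>o\<close>, the
  signature of Q, given by the parity of p at \<open>F\<^sub>o\<close>, is a count of the I^{r,s}.
  The diagonal dimensions c_0 \<ge> c_1 \<ge> ... satisfy the resulting inequality only if c_{2i+1}
  = c_{2i}, so degree 4i carries no primitive class.\<close>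

definition cvec :: "real^'n \<Rightarrow> complex^'n" where
  "cvec v = (\<chi> i. complex_of_real (v $ i))"

lemma vec_cnj_add [simp]: "vec_cnj (u + v) = vec_cnj u + vec_cnj v"
  and vec_cnj_diff [simp]: "vec_cnj (u - v) = vec_cnj u - vec_cnj v"
  and vec_cnj_minus [simp]: "vec_cnj (- u) = - vec_cnj u"
  and vec_cnj_scale [simp]: "vec_cnj (c *s u) = cnj c *s vec_cnj u"
  and vec_cnj_zero [simp]: "vec_cnj 0 = 0"
  and vec_cnj_cnj [simp]: "vec_cnj (vec_cnj u) = u"
  and vec_cnj_cvec [simp]: "vec_cnj (cvec r) = cvec r"
  by (simp_all add: vec_cnj_def cvec_def vec_eq_iff)

lemma vec_cnj_eq_0_iff [simp]: "vec_cnj u = 0 \<longleftrightarrow> u = 0"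
  by (metis vec_cnj_cnj vec_cnj_zero)

lemma vec_cnj_sum [simp]: "vec_cnj (\<Sum>a\<in>A. f a) = (\<Sum>a\<in>A. vec_cnj (f a))"
  by (induction A rule: infinite_finite_induct) simp_all

lemma vec_cnj_image_iff: "v \<in> vec_cnj ` S \<longleftrightarrow> vec_cnj v \<in> S"
  by (metis (no_types, lifting) image_iff vec_cnj_cnj)

lemma subspace_vec_cnj:
  assumes "vec.subspace S"
  shows "vec.subspace (vec_cnj ` S)"
  using assms unfolding vec.subspace_def vec_cnj_image_iff by simp

lemma vec_Re_cvec [simp]: "vec_Re (cvec v) = v"
  and vec_Im_cvec [simp]: "vec_Im (cvec v) = 0"
  and vec_Re_add [simp]: "vec_Re (x + y) = vec_Re x + vec_Re y"
  and vec_Im_add [simp]: "vec_Im (x + y) = vec_Im x + vec_Im y"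
  and vec_Re_diff [simp]: "vec_Re (x - y) = vec_Re x - vec_Re y"
  and vec_Im_diff [simp]: "vec_Im (x - y) = vec_Im x - vec_Im y"
  and vec_Re_zero [simp]: "vec_Re 0 = 0"
  and vec_Im_zero [simp]: "vec_Im 0 = 0"
  and vec_Re_scale: "vec_Re (c *s x) = Re c *\<^sub>R vec_Re x - Im c *\<^sub>R vec_Im x"
  and vec_Im_scale: "vec_Im (c *s x) = Re c *\<^sub>R vec_Im x + Im c *\<^sub>R vec_Re x"
  and vec_Re_cnj [simp]: "vec_Re (vec_cnj x) = vec_Re x"
  and vec_Im_cnj [simp]: "vec_Im (vec_cnj x) = - vec_Im x"
  by (simp_all add: vec_Re_def vec_Im_def cvec_def vec_cnj_def vec_eq_iff)

lemma cvec_add [simp]: "cvec (x + y) = cvec x + cvec y"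
  and cvec_diff [simp]: "cvec (x - y) = cvec x - cvec y"
  and cvec_minus [simp]: "cvec (- x) = - cvec x"
  and cvec_zero [simp]: "cvec 0 = 0"
  and cvec_scale [simp]: "cvec (r *\<^sub>R x) = complex_of_real r *s cvec x"
  by (simp_all add: cvec_def vec_eq_iff)

lemma vec_Re_Im: "x = cvec (vec_Re x) + \<i> *s cvec (vec_Im x)"
  by (simp add: cvec_def vec_Re_def vec_Im_def vec_eq_iff complex_eq_iff)

lemma vec_eq_iff_Re_Im: "x = y \<longleftrightarrow> vec_Re x = vec_Re y \<and> vec_Im x = vec_Im y"
  by (auto simp: vec_Re_def vec_Im_def vec_eq_iff complex_eq_iff)

lemma cvec_vec_Re: "cvec (vec_Re x) = (1/2) *s (x + vec_cnj x)"
  and cvec_vec_Im: "cvec (vec_Im x) = (- \<i> / 2) *s (x - vec_cnj x)"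
  by (simp_all add: cvec_def vec_Re_def vec_Im_def vec_cnj_def vec_eq_iff complex_eq_iff)

lemma cvec_inject [simp]: "cvec x = cvec y \<longleftrightarrow> x = y"
  by (metis vec_Re_cvec)

lemma cvec_in_complexify [simp]: "subspace S \<Longrightarrow> cvec v \<in> complexify S \<longleftrightarrow> v \<in> S"
  by (simp add: complexify_def subspace_0)

lemma subspace_complexify: "subspace S \<Longrightarrow> vec.subspace (complexify S)"
  unfolding vec.subspace_def complexify_def
  by (auto simp: vec_Re_scale vec_Im_scale
      intro: subspace_0 subspace_add subspace_diff subspace_scale)

lemma complexify_conj: "subspace S \<Longrightarrow> v \<in> complexify S \<Longrightarrow> vec_cnj v \<in> complexify S"
  by (simp add: complexify_def subspace_neg)

lemma complexify_mono: "S \<subseteq> T \<Longrightarrow> complexify S \<subseteq> complexify T"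
  by (auto simp: complexify_def)

lemma complexify_inject:
  assumes "subspace S" "subspace T"
  shows "complexify S = complexify T \<longleftrightarrow> S = T"
  using assms by (metis (no_types, lifting) Set.set_eqI cvec_in_complexify)

section \<open>Real matrices acting on complexified vectors\<close>

lemma complex_matrix_mult_cvec: "complex_matrix A *v cvec x = cvec (A *v x)"
  by (simp add: matrix_vector_mult_def cvec_def map_matrix_def vec_eq_iff)

lemma complex_matrix_mult:
  "complex_matrix A *v x = cvec (A *v vec_Re x) + \<i> *s cvec (A *v vec_Im x)"
  by (subst vec_Re_Im[of x]) (simp only: vec.add vec.scale complex_matrix_mult_cvec)

lemma complex_matrix_mult_Re [simp]: "vec_Re (complex_matrix A *v x) = A *v vec_Re x"
  and complex_matrix_mult_Im [simp]: "vec_Im (complex_matrix A *v x) = A *v vec_Im x"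
  by (simp_all add: complex_matrix_mult vec_Re_scale vec_Im_scale)

lemma complex_matrix_mult_cnj: "complex_matrix A *v vec_cnj x = vec_cnj (complex_matrix A *v x)"
  by (simp add: vec_eq_iff_Re_Im vec.neg)

lemma complex_matrix_matrix_mult: "complex_matrix (A ** B) = complex_matrix A ** complex_matrix B"
  by (simp add: matrix_matrix_mult_def map_matrix_def vec_eq_iff)

lemma complex_matrix_mat_1: "complex_matrix (mat 1) = mat 1"
  by (simp add: mat_def map_matrix_def vec_eq_iff)

lemma matrix_power_mult_vec:
  fixes A :: "'a::comm_semiring_1^'n^'n"
  shows "matrix_power A k *v x = ((*v) A ^^ k) x"
  by (induction k) (simp_all add: matrix_power_def flip: matrix_vector_mul_assoc)

lemma Re_complex_matrix_power [simp]:
    "vec_Re (((*v) (complex_matrix A) ^^ k) x) = matrix_power A k *v vec_Re x"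
  and Im_complex_matrix_power [simp]:
    "vec_Im (((*v) (complex_matrix A) ^^ k) x) = matrix_power A k *v vec_Im x"
  by (induction k) (simp_all add: matrix_power_mult_vec)

lemma matrix_complex_linear:
  fixes f :: "complex^'n \<Rightarrow> complex^'n"
  assumes "\<And>x y. f (x + y) = f x + f y" "\<And>c x. f (c *s x) = c *s f x"
  shows "matrix f *v x = f x"
  by (rule matrix_works) (unfold_locales, use assms in auto)

lemma scaleR_matrix_mult_vec:
  fixes A :: "complex^'n^'m"
  shows "(r *\<^sub>R A) *v x = complex_of_real r *s (A *v x)"
proof -
  have "(r *\<^sub>R A) $ a $ b = complex_of_real r * A $ a $ b" for a b
    unfolding vector_scaleR_component by (rule scaleR_conv_of_real)
  then show ?thesis by (simp add: vec_eq_iff matrix_vector_mult_def sum_distrib_left mult.assoc)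
qed

section \<open>The complex bilinear extension of the polarization\<close>

locale polarization =
  fixes Q :: "real^'n \<Rightarrow> real^'n \<Rightarrow> real" and n :: nat
  assumes pol: "polarization_form Q n"
begin

abbreviation B :: "complex^'n \<Rightarrow> complex^'n \<Rightarrow> complex" where "B \<equiv> complex_form Q"

lemma bilinear_Q: "bilinear Q"
  using pol unfolding polarization_form_def by blast

lemma Q_sym: "Q v u = (-1) ^ n * Q u v"
  using pol unfolding polarization_form_def by blast

lemma Q_nondeg: "(\<And>v. Q u v = 0) \<Longrightarrow> u = 0"
  using pol unfolding polarization_form_def by blast

lemmas Q_simps = bilinear_ladd[OF bilinear_Q] bilinear_radd[OF bilinear_Q]
  bilinear_lmul[OF bilinear_Q] bilinear_rmul[OF bilinear_Q]
  bilinear_lzero[OF bilinear_Q] bilinear_rzero[OF bilinear_Q]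
  bilinear_lneg[OF bilinear_Q] bilinear_rneg[OF bilinear_Q]
  bilinear_lsub[OF bilinear_Q] bilinear_rsub[OF bilinear_Q]

lemma B_add_left [simp]: "B (x + y) z = B x z + B y z"
  and B_add_right [simp]: "B z (x + y) = B z x + B z y"
  and B_scale_left [simp]: "B (c *s x) z = c * B x z"
  and B_scale_right [simp]: "B z (c *s x) = c * B z x"
  and B_zero_left [simp]: "B 0 z = 0"
  and B_zero_right [simp]: "B z 0 = 0"
  by (auto simp: complex_form_def complex_eq_iff Q_simps vec_Re_scale vec_Im_scale algebra_simps)

lemma B_minus_left [simp]: "B (- x) z = - B x z"
  using B_scale_left[of "-1" x z] by (simp add: vec.scale_minus_left)

lemma B_minus_right [simp]: "B z (- x) = - B z x"
  using B_scale_right[of z "-1" x] by (simp add: vec.scale_minus_left)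

lemma B_diff_left [simp]: "B (x - y) z = B x z - B y z"
  and B_diff_right [simp]: "B z (x - y) = B z x - B z y"
  using B_add_left[of x "- y" z] B_add_right[of z x "- y"] by simp_all

lemma B_sum_left: "B (\<Sum>a\<in>A. f a) z = (\<Sum>a\<in>A. B (f a) z)"
  and B_sum_right: "B z (\<Sum>a\<in>A. f a) = (\<Sum>a\<in>A. B z (f a))"
  by (induction A rule: infinite_finite_induct) simp_all

lemma B_sym: "B y x = (-1) ^ n * B x y"
proof -
  define s where "s = (-1::real) ^ n"
  have "Q (f y) (g x) = s * Q (g x) (f y)" for f g :: "complex^'n \<Rightarrow> real^'n"
    unfolding s_def by (rule Q_sym)
  then have "B y x = complex_of_real s * B x y"
    by (simp add: complex_form_def complex_eq_iff algebra_simps)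
  then show ?thesis by (simp add: s_def)
qed

lemma B_sym_0: "B x y = 0 \<longleftrightarrow> B y x = 0"
  by (simp add: B_sym[of y x])

lemma B_cvec [simp]: "B (cvec x) (cvec y) = complex_of_real (Q x y)"
  by (simp add: complex_form_def Q_simps complex_eq_iff)

lemma B_cnj: "B (vec_cnj x) (vec_cnj y) = cnj (B x y)"
  by (simp add: complex_form_def Q_simps complex_eq_iff)

lemma B_nondeg:
  assumes "\<And>y. B x y = 0"
  shows "x = 0"
proof -
  have 0: "Q (vec_Re x) y = 0 \<and> Q (vec_Im x) y = 0" for y
    using assms[of "cvec y"] by (simp add: complex_form_def Q_simps complex_eq_iff)
  have "vec_Re x = 0" by (rule Q_nondeg) (simp add: 0)
  moreover have "vec_Im x = 0" by (rule Q_nondeg) (simp add: 0)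
  ultimately show ?thesis by (simp add: vec_eq_iff_Re_Im)
qed

lemma continuous_on_B [continuous_intros]:
  assumes "continuous_on S f" "continuous_on S g"
  shows "continuous_on S (\<lambda>x. B (f x) (g x))"
proof -
  have bb: "bounded_bilinear Q"
    using bilinear_Q bilinear_conv_bounded_bilinear by blast
  have R: "continuous_on S (\<lambda>x. vec_Re (h x))" "continuous_on S (\<lambda>x. vec_Im (h x))"
    if "continuous_on S h" for h
    using that unfolding vec_Re_def vec_Im_def by (auto intro!: continuous_intros)
  show ?thesis unfolding complex_form_def Complex_eq
    by (intro continuous_intros bounded_bilinear.continuous_on[OF bb] R assms)
qed

lemma tendsto_B:
  assumes "(f \<longlongrightarrow> a) F" "(g \<longlongrightarrow> b) F"
  shows "((\<lambda>x. B (f x) (g x)) \<longlongrightarrow> B a b) F"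
proof -
  have "continuous_on UNIV (\<lambda>p. B (fst p) (snd p))"
    by (intro continuous_intros)
  then have "isCont (\<lambda>p. B (fst p) (snd p)) (a, b)"
    by (simp add: continuous_on_eq_continuous_at)
  from isCont_tendsto_compose[OF this tendsto_Pair[OF assms]] show ?thesis by simp
qed

end

section \<open>Bigradings\<close>

locale bigraded =
  fixes I :: "int \<Rightarrow> int \<Rightarrow> (complex^'n) set"
  assumes bigr: "bigrading I"
begin

abbreviation gs :: "(int \<Rightarrow> int \<Rightarrow> bool) \<Rightarrow> (complex^'n) set" where "gs \<equiv> graded_sum I"

definition types :: "(int \<times> int) set" where
  "types = {a. I (fst a) (snd a) \<noteq> {0}}"

lemma subspace_I: "vec.subspace (I p q)"
  using bigr unfolding bigrading_def by blast

lemma zero_in_I [simp]: "0 \<in> I p q"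
  using subspace_I vec.subspace_0 by blast

lemma independent_I:
  assumes "finite A" "\<And>a. a \<in> A \<Longrightarrow> v a \<in> I (fst a) (snd a)" "(\<Sum>a\<in>A. v a) = 0" "a \<in> A"
  shows "v a = 0"
proof -
  have "\<forall>A v. finite A \<and> (\<forall>(p, q)\<in>A. v (p, q) \<in> I p q) \<and> (\<Sum>a\<in>A. v a) = 0 \<longrightarrow>
      (\<forall>a\<in>A. v a = 0)"
    using bigr unfolding bigrading_def by blast
  moreover have "\<forall>(p, q)\<in>A. v (p, q) \<in> I p q" using assms(2) by force
  ultimately show ?thesis using assms by blast
qed

lemma subspace_gs: "vec.subspace (gs P)"
  unfolding graded_sum_def by simp

text \<open>One nonzero vector from each nonzero piece gives an independent family, and the space is
  finite-dimensional. All later sums over types rely on this.\<close>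

lemma finite_types: "finite types"
proof -
  have "\<forall>a. \<exists>x. a \<in> types \<longrightarrow> x \<in> I (fst a) (snd a) \<and> x \<noteq> 0"
    unfolding types_def using zero_in_I by fastforce
  then obtain f where f: "\<And>a. a \<in> types \<Longrightarrow> f a \<in> I (fst a) (snd a) \<and> f a \<noteq> 0"
    by metis
  have inj: "inj_on f types"
  proof (rule inj_onI, rule ccontr)
    fix a b assume ab: "a \<in> types" "b \<in> types" "f a = f b" "a \<noteq> b"
    define g where "g = (\<lambda>c. if c = a then f a else - f b)"
    have "g a = 0"
    proof (rule independent_I[of "{a, b}"])
      show "g c \<in> I (fst c) (snd c)" if "c \<in> {a, b}" for c
        using that f[OF ab(1)] f[OF ab(2)] vec.subspace_neg[OF subspace_I]
        by (cases "c = a") (auto simp: g_def ab(3))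
      show "(\<Sum>c\<in>{a, b}. g c) = 0" using ab by (simp add: g_def)
    qed auto
    then show False using f ab by (simp add: g_def)
  qed
  have "vec.independent (f ` types)"
  proof (rule ccontr)
    assume "\<not> ?thesis"
    then obtain t u x where t: "finite t" "t \<subseteq> f ` types" "(\<Sum>v\<in>t. u v *s v) = 0" "x \<in> t" "u x \<noteq> 0"
      unfolding vec.dependent_explicit by blast
    obtain A where A: "A \<subseteq> types" "t = f ` A" using t(2) subset_imageE by metis
    have injA: "inj_on f A" using inj A(1) inj_on_subset by blast
    have finA: "finite A" using t(1) A(2) injA finite_imageD by blast
    have s0: "(\<Sum>a\<in>A. u (f a) *s f a) = 0"
      using t(3) unfolding A(2) sum.reindex[OF injA] by simp
    obtain a where a: "a \<in> A" "x = f a" using t(4) A(2) by blast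
    have "u (f a) *s f a = 0"
      by (rule independent_I[OF finA _ s0 a(1)])
        (use f A in \<open>auto intro!: vec.subspace_scale[OF subspace_I]\<close>)
    moreover have "f a \<noteq> 0" using f a(1) A(1) by blast
    ultimately show False using t(5) a(2) by simp
  qed
  then have "finite (f ` types)" by (rule vec.finiteI_independent)
  then show ?thesis using inj finite_imageD by blast
qed

lemma sum_delta_types:
  assumes "(p, q) \<notin> types \<Longrightarrow> u = 0"
  shows "(\<Sum>a\<in>types. if fst a = p \<and> snd a = q then u else 0) = u"
proof -
  have "(\<Sum>a\<in>types. if fst a = p \<and> snd a = q then u else 0) =
      (\<Sum>a\<in>types. if a = (p, q) then u else 0)"
    by (rule sum.cong) (auto simp: prod_eq_iff)
  also have "\<dots> = u" using assms by (simp add: finite_types)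
  finally show ?thesis .
qed

lemma ex_decomposition:
  "\<exists>f. (\<forall>p q. f p q \<in> I p q) \<and> v = (\<Sum>a\<in>types. f (fst a) (snd a))"
proof -
  have "v \<in> vec.span (\<Union>p q. I p q)" using bigr unfolding bigrading_def by blast
  then show ?thesis
  proof (induction rule: vec.span_induct_alt)
    case base
    show ?case by (rule exI[of _ "\<lambda>p q. 0"]) simp
  next
    case (step c x y)
    then obtain p q f where pq: "x \<in> I p q"
      and f: "\<forall>p q. f p q \<in> I p q" "y = (\<Sum>a\<in>types. f (fst a) (snd a))" by blast
    define g where "g = (\<lambda>r s. (if (r, s) = (p, q) then c *s x else 0) + f r s)"
    have "\<forall>p q. g p q \<in> I p q"
      using pq f(1) by (auto simp: g_def intro!: vec.subspace_add vec.subspace_scale subspace_I)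
    moreover have "c *s x + y = (\<Sum>a\<in>types. g (fst a) (snd a))"
    proof -
      have "(p, q) \<notin> types \<Longrightarrow> c *s x = 0" using pq unfolding types_def by simp
      then show ?thesis
        by (simp add: g_def sum.distrib f(2) sum_delta_types)
    qed
    ultimately show ?case by blast
  qed
qed

definition decomp :: "complex^'n \<Rightarrow> int \<Rightarrow> int \<Rightarrow> complex^'n" where
  "decomp v = (SOME f. (\<forall>p q. f p q \<in> I p q) \<and> v = (\<Sum>a\<in>types. f (fst a) (snd a)))"

text \<open>The projection onto \<open>I p q\<close> along all other pieces, curried in the type so
  that statements about a fixed (p, q) need no pairs.\<close>

definition cp :: "int \<Rightarrow> int \<Rightarrow> complex^'n \<Rightarrow> complex^'n" where
  "cp p q v = decomp v p q"

lemma cp_in: "cp p q v \<in> I p q"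
  and cp_sum_types: "(\<Sum>a\<in>types. cp (fst a) (snd a) v) = v"
  using someI_ex[OF ex_decomposition, of v] unfolding cp_def decomp_def[symmetric] by simp_all

lemma cp_unique:
  assumes f: "\<And>p q. f p q \<in> I p q" "v = (\<Sum>a\<in>types. f (fst a) (snd a))"
  shows "cp p q v = f p q"
proof (cases "(p, q) \<in> types")
  case True
  have "cp (fst (p, q)) (snd (p, q)) v - f (fst (p, q)) (snd (p, q)) = 0"
  proof (rule independent_I[OF finite_types _ _ True])
    show "(\<Sum>a\<in>types. cp (fst a) (snd a) v - f (fst a) (snd a)) = 0"
      unfolding sum_subtractf cp_sum_types by (simp add: f(2))
  qed (auto intro!: vec.subspace_diff subspace_I cp_in f)
  then show ?thesis by simp
next
  case False
  then show ?thesis using f(1)[of p q] cp_in[of p q v] unfolding types_def by simp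
qed

lemma cp_add [simp]: "cp p q (u + v) = cp p q u + cp p q v"
  by (rule cp_unique) (auto intro!: vec.subspace_add subspace_I cp_in simp: sum.distrib cp_sum_types)

lemma cp_scale [simp]: "cp p q (c *s v) = c *s cp p q v"
  by (rule cp_unique)
    (auto intro!: vec.subspace_scale subspace_I cp_in simp: cp_sum_types simp flip: vec.scale_sum_right)

lemma cp_zero [simp]: "cp p q 0 = 0"
  using cp_scale[of p q 0 0] by simp

lemma cp_minus [simp]: "cp p q (- v) = - cp p q v"
  using cp_scale[of p q "-1" v] by (simp add: vec.scale_minus_left)

lemma cp_diff [simp]: "cp p q (u - v) = cp p q u - cp p q v"
  using cp_add[of p q u "- v"] by simp

lemma cp_sum [simp]: "cp p q (\<Sum>a\<in>A. f a) = (\<Sum>a\<in>A. cp p q (f a))"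
  by (induction A rule: infinite_finite_induct) simp_all

lemma cp_of_I:
  assumes "u \<in> I p q"
  shows "cp r s u = (if (r, s) = (p, q) then u else 0)"
proof (rule cp_unique)
  have "(p, q) \<notin> types \<Longrightarrow> u = 0" using assms unfolding types_def by simp
  then show "u = (\<Sum>a\<in>types. if (fst a, snd a) = (p, q) then u else 0)"
    unfolding prod.inject by (rule sum_delta_types[symmetric])
qed (use assms in auto)

lemma cp_cp [simp]: "cp r s (cp p q v) = (if (r, s) = (p, q) then cp p q v else 0)"
  by (rule cp_of_I[OF cp_in])

lemma cp_eqI: "(\<And>p q. cp p q u = cp p q v) \<Longrightarrow> u = v"
  by (subst (1 2) cp_sum_types[symmetric]) (simp only:)

lemma cp_eq_0I: "(\<And>p q. cp p q u = 0) \<Longrightarrow> u = 0"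
  by (rule cp_eqI) simp

lemma I_eq_0_iff: "I p q = {0} \<longleftrightarrow> (\<forall>u\<in>I p q. u = 0)"
  using zero_in_I by blast

lemma mem_types: "(p, q) \<in> types \<longleftrightarrow> (\<exists>u\<in>I p q. u \<noteq> 0)"
  unfolding types_def using I_eq_0_iff by auto

lemma cp_types: "cp p q v \<noteq> 0 \<Longrightarrow> (p, q) \<in> types"
  using mem_types cp_in by blast

text \<open>Turns membership in a graded sum into a condition on the support of a vector, so that
  intersections and inclusions of such sums become logic on the index predicates.\<close>

lemma mem_gs: "v \<in> gs P \<longleftrightarrow> (\<forall>p q. cp p q v \<noteq> 0 \<longrightarrow> P p q)"
proof
  assume "v \<in> gs P"
  then show "\<forall>p q. cp p q v \<noteq> 0 \<longrightarrow> P p q"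
    unfolding graded_sum_def
  proof (induction rule: vec.span_induct_alt)
    case (step c x y)
    then obtain r s where rs: "x \<in> I r s" "P r s" by blast
    show ?case using step(2) rs(2) by (auto simp: cp_of_I[OF rs(1)] split: if_splits)
  qed simp
next
  assume *: "\<forall>p q. cp p q v \<noteq> 0 \<longrightarrow> P p q"
  have "(\<Sum>a\<in>types. cp (fst a) (snd a) v) \<in> vec.span (\<Union>{I p q |p q. P p q})"
  proof (rule vec.span_sum)
    fix a
    show "cp (fst a) (snd a) v \<in> vec.span (\<Union>{I p q |p q. P p q})"
    proof (cases "cp (fst a) (snd a) v = 0")
      case False
      then have "P (fst a) (snd a)" using * by blast
      then show ?thesis using cp_in by (intro vec.span_base) blast
    qed (simp add: vec.span_zero)
  qed
  then show "v \<in> gs P" by (simp add: cp_sum_types graded_sum_def)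
qed

lemma I_subset_gs: "P p q \<Longrightarrow> I p q \<subseteq> gs P"
  by (auto simp: mem_gs cp_of_I split: if_splits)

lemma gs_mono: "(\<And>p q. (p, q) \<in> types \<Longrightarrow> P p q \<Longrightarrow> P' p q) \<Longrightarrow> gs P \<subseteq> gs P'"
  using cp_types by (auto simp: mem_gs)

lemma gs_cong: "(\<And>p q. (p, q) \<in> types \<Longrightarrow> P p q \<longleftrightarrow> P' p q) \<Longrightarrow> gs P = gs P'"
  using cp_types unfolding set_eq_iff mem_gs by blast

lemma gs_Int: "gs P \<inter> gs P' = gs (\<lambda>p q. P p q \<and> P' p q)"
  by (auto simp: mem_gs)

lemma gs_UNIV: "gs (\<lambda>p q. True) = UNIV"
  by (auto simp: mem_gs)

section \<open>Dimensions of graded sums\<close>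

lemma dim_gs_finite:
  assumes "finite A"
  shows "vec.dim (gs (\<lambda>p q. (p, q) \<in> A)) = (\<Sum>a\<in>A. vec.dim (I (fst a) (snd a)))"
  using assms
proof (induction A)
  case empty
  have "gs (\<lambda>p q. (p, q) \<in> {}) = {0}" by (auto simp: mem_gs intro: cp_eq_0I)
  then show ?case by simp
next
  case (insert a A)
  let ?S = "I (fst a) (snd a)" and ?T = "gs (\<lambda>p q. (p, q) \<in> A)"
  have "?S \<inter> ?T = {0}"
  proof -
    have "x = 0" if x: "x \<in> ?S" "x \<in> ?T" for x
    proof (rule cp_eq_0I, rule ccontr)
      fix p q assume "cp p q x \<noteq> 0"
      moreover from this have "(p, q) = a" using x(1) cp_of_I[OF x(1), of p q]
        by (simp split: if_splits)
      moreover have "(p, q) \<in> A" using x(2) calculation(1) by (simp add: mem_gs)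
      ultimately show False using insert by simp
    qed
    then show ?thesis using vec.subspace_0[OF subspace_gs] by auto
  qed
  moreover have "{x + y |x y. x \<in> ?S \<and> y \<in> ?T} = gs (\<lambda>p q. (p, q) \<in> insert a A)" (is "?L = ?R")
  proof
    show "?L \<subseteq> ?R"
      by (auto simp: mem_gs cp_of_I split: if_splits)
    show "?R \<subseteq> ?L"
    proof
      fix x assume x: "x \<in> ?R"
      define y where "y = cp (fst a) (snd a) x"
      have "x - y \<in> ?T" using x by (auto simp: mem_gs y_def split: if_splits)
      moreover have "y \<in> ?S" by (simp add: y_def cp_in)
      moreover have "x = y + (x - y)" by simp
      ultimately show "x \<in> ?L" by blast
    qed
  qed
  ultimately show ?case
    using vec.dim_sums_Int[OF subspace_I subspace_gs, of "fst a" "snd a" "\<lambda>p q. (p, q) \<in> A"] insert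
    by simp
qed

lemma dim_gs:
  "vec.dim (gs P) = (\<Sum>a\<in>{a \<in> types. P (fst a) (snd a)}. vec.dim (I (fst a) (snd a)))"
proof -
  have "gs P = gs (\<lambda>p q. (p, q) \<in> {a \<in> types. P (fst a) (snd a)})"
    by (rule gs_cong) simp
  also have "vec.dim \<dots> = (\<Sum>a\<in>{a \<in> types. P (fst a) (snd a)}. vec.dim (I (fst a) (snd a)))"
    by (rule dim_gs_finite) (simp add: finite_types)
  finally show ?thesis .
qed

lemma dim_gs_disj:
  assumes "\<And>p q. \<not> (P p q \<and> P' p q)"
  shows "vec.dim (gs (\<lambda>p q. P p q \<or> P' p q)) = vec.dim (gs P) + vec.dim (gs P')"
proof -
  have "{a \<in> types. P (fst a) (snd a) \<or> P' (fst a) (snd a)} =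
      {a \<in> types. P (fst a) (snd a)} \<union> {a \<in> types. P' (fst a) (snd a)}" by blast
  then show ?thesis unfolding dim_gs
    by (simp, subst sum.union_disjoint) (use assms finite_types in auto)
qed

end

section \<open>The Deligne splitting of a limiting mixed Hodge structure\<close>

locale limiting_mhs =
  fixes N :: "real^'n^'n" and n :: nat and W :: "int \<Rightarrow> (real^'n) set"
    and F :: "'n filtration" and I :: "int \<Rightarrow> int \<Rightarrow> (complex^'n) set"
  assumes mono_W: "monodromy_weight_filtration N n W"
    and deligne: "deligne_splitting W F I"
    and N_F: "\<And>p. (*v) (complex_matrix N) ` F p \<subseteq> F (p - 1)"
begin

sublocale bigraded I
  using deligne unfolding deligne_splitting_def by unfold_locales blast

abbreviation T :: "complex^'n \<Rightarrow> complex^'n" where "T \<equiv> (*v) (complex_matrix N)"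

lemma T_pow_add [simp]: "(T ^^ k) (x + y) = (T ^^ k) x + (T ^^ k) y"
  and T_pow_diff [simp]: "(T ^^ k) (x - y) = (T ^^ k) x - (T ^^ k) y"
  and T_pow_scale [simp]: "(T ^^ k) (c *s x) = c *s (T ^^ k) x"
  and T_pow_zero [simp]: "(T ^^ k) 0 = 0"
  by (induction k) (simp_all add: vec.add vec.diff vec.scale)

lemma T_pow_sum: "(T ^^ k) (\<Sum>a\<in>A. f a) = (\<Sum>a\<in>A. (T ^^ k) (f a))"
  by (induction A rule: infinite_finite_induct) simp_all

lemma T_pow_T_pow: "(T ^^ j) ((T ^^ k) x) = (T ^^ (j + k)) x"
  by (simp add: funpow_add)

lemma T_pow_vanish: "(T ^^ k) x = 0 \<Longrightarrow> k \<le> l \<Longrightarrow> (T ^^ l) x = 0"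
  by (metis T_pow_T_pow T_pow_zero le_add_diff_inverse2)

lemma subspace_W: "subspace (W k)" and W_mono: "k \<le> l \<Longrightarrow> W k \<subseteq> W l"
  using mono_W unfolding monodromy_weight_filtration_def by (auto dest: monoD)

lemma Wc_eq: "complexify (W k) = gs (\<lambda>p q. p + q \<le> k)"
  and F_eq: "F p = gs (\<lambda>r s. r \<ge> p)"
  using deligne unfolding deligne_splitting_def by auto

lemma T_W:
  assumes "v \<in> complexify (W k)"
  shows "T v \<in> complexify (W (k - 2))"
proof -
  have "N *v x \<in> W (k - 2)" if "x \<in> W k" for x
    using that mono_W unfolding monodromy_weight_filtration_def by blast
  then show ?thesis using assms by (simp add: complexify_def)
qed

lemma T_pow_W: "v \<in> complexify (W k) \<Longrightarrow> (T ^^ j) v \<in> complexify (W (k - 2 * int j))"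
proof (induction j)
  case (Suc j)
  then show ?case using T_W[of "(T ^^ j) v" "k - 2 * int j"] by (simp add: algebra_simps)
qed simp

lemma T_F: "v \<in> F p \<Longrightarrow> T v \<in> F (p - 1)"
  using N_F by blast

lemma W_inj:
  assumes "v \<in> complexify (W (int n + int k))" "(T ^^ k) v \<in> complexify (W (int n - int k - 1))"
  shows "v \<in> complexify (W (int n + int k - 1))"
  using assms mono_W unfolding monodromy_weight_filtration_def complexify_def by auto

lemma W_surj:
  assumes "w \<in> complexify (W (int n - int k))"
  shows "\<exists>v\<in>complexify (W (int n + int k)). w - (T ^^ k) v \<in> complexify (W (int n - int k - 1))"
proof -
  have "\<exists>v\<in>W (int n + int k). y - matrix_power N k *v v \<in> W (int n - int k - 1)"
    if "y \<in> W (int n - int k)" for y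
    using that mono_W unfolding monodromy_weight_filtration_def by blast
  from this[of "vec_Re w"] this[of "vec_Im w"] assms obtain a b where
    ab: "a \<in> W (int n + int k)" "b \<in> W (int n + int k)"
      "vec_Re w - matrix_power N k *v a \<in> W (int n - int k - 1)"
      "vec_Im w - matrix_power N k *v b \<in> W (int n - int k - 1)"
    unfolding complexify_def by auto
  show ?thesis
    by (rule bexI[of _ "cvec a + \<i> *s cvec b"])
      (use ab in \<open>simp_all add: complexify_def vec_Re_scale vec_Im_scale\<close>)
qed

lemma cnj_W: "v \<in> complexify (W k) \<longleftrightarrow> vec_cnj v \<in> complexify (W k)"
  by (metis complexify_conj subspace_W vec_cnj_cnj)

lemma cnj_I:
  assumes "u \<in> I p q" "cp r s (vec_cnj u) \<noteq> 0"
  shows "(r, s) = (q, p) \<or> r < q \<and> s < p"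
proof -
  let ?U = "gs (\<lambda>r s. r < q \<and> s < p)"
  have "vec.span (vec_cnj ` I p q \<union> ?U) = vec.span (I q p \<union> ?U)"
    using deligne unfolding deligne_splitting_def Let_def by blast
  moreover have "vec_cnj u \<in> vec.span (vec_cnj ` I p q \<union> ?U)"
    using assms(1) by (intro vec.span_base) blast
  ultimately have "vec_cnj u \<in> vec.span (I q p \<union> ?U)" by simp
  moreover have "I q p \<union> ?U \<subseteq> gs (\<lambda>r s. (r, s) = (q, p) \<or> r < q \<and> s < p)"
    by (auto simp: mem_gs cp_of_I split: if_splits)
  ultimately have "vec_cnj u \<in> gs (\<lambda>r s. (r, s) = (q, p) \<or> r < q \<and> s < p)"
    using vec.span_minimal[OF _ subspace_gs] by blast
  then show ?thesis using assms(2) by (simp add: mem_gs)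
qed

text \<open>Without its (q, p) component the conjugate of u has weight below p + q. The weight
  filtration is real, so u itself would have lower weight, which its pure type allows only for u =
  0.\<close>

lemma cnj_I_leading:
  assumes "u \<in> I p q" "cp q p (vec_cnj u) = 0"
  shows "u = 0"
proof -
  have "vec_cnj u \<in> complexify (W (p + q - 1))"
    unfolding Wc_eq mem_gs using cnj_I[OF assms(1)] assms(2) by force
  then have "u \<in> complexify (W (p + q - 1))" using cnj_W by blast
  then have "cp p q u = 0" unfolding Wc_eq mem_gs by force
  then show ?thesis by (simp add: cp_of_I[OF assms(1)])
qed

lemma types_cnj: "(p, q) \<in> types \<longleftrightarrow> (q, p) \<in> types"
proof -
  have "(q, p) \<in> types" if pq: "(p, q) \<in> types" for p q
  proof -
    obtain u where "u \<in> I p q" "u \<noteq> 0" using pq unfolding mem_types by blast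
    then have "cp q p (vec_cnj u) \<noteq> 0" using cnj_I_leading by blast
    then show ?thesis by (rule cp_types)
  qed
  then show ?thesis by blast
qed

lemma cp_cnj: "cp r s (vec_cnj v) = (\<Sum>a\<in>types. cp r s (vec_cnj (cp (fst a) (snd a) v)))"
  by (subst cp_sum_types[of v, symmetric]) simp

lemma cp_cnj_nonzero:
  assumes "cp r s (vec_cnj v) \<noteq> 0"
  obtains p q where "cp p q v \<noteq> 0" "(r, s) = (q, p) \<or> r < q \<and> s < p"
proof -
  have "\<exists>a. cp r s (vec_cnj (cp (fst a) (snd a) v)) \<noteq> 0"
  proof (rule ccontr)
    assume "\<not> ?thesis"
    then have "cp r s (vec_cnj v) = 0" unfolding cp_cnj[of r s v] by simp
    then show False using assms by simp
  qed
  then obtain a where a: "cp r s (vec_cnj (cp (fst a) (snd a) v)) \<noteq> 0" ..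
  then have "cp (fst a) (snd a) v \<noteq> 0" by auto
  then show ?thesis using that cnj_I[OF cp_in a] by blast
qed

text \<open>The second-index filtration is conjugate to the first-index one: this makes the limit
  filtration accessible although the splitting is in general not split over the reals.\<close>

lemma cnj_snd_le:
  assumes "v \<in> gs (\<lambda>r s. s \<le> b)"
  shows "vec_cnj v \<in> gs (\<lambda>r s. r \<le> b)"
  unfolding mem_gs
proof (intro allI impI)
  fix r s assume "cp r s (vec_cnj v) \<noteq> 0"
  then obtain p q where pq: "cp p q v \<noteq> 0" "(r, s) = (q, p) \<or> r < q \<and> s < p"
    by (rule cp_cnj_nonzero)
  then have "q \<le> b" using assms unfolding mem_gs by blast
  then show "r \<le> b" using pq(2) by auto
qed

lemma cnj_fst_le:
  assumes "v \<in> gs (\<lambda>r s. r \<le> b)"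
  shows "vec_cnj v \<in> gs (\<lambda>r s. s \<le> b)"
  unfolding mem_gs
proof (intro allI impI)
  fix r s assume "cp r s (vec_cnj v) \<noteq> 0"
  then obtain p q where pq: "cp p q v \<noteq> 0" "(r, s) = (q, p) \<or> r < q \<and> s < p"
    by (rule cp_cnj_nonzero)
  then have "p \<le> b" using assms unfolding mem_gs by blast
  then show "s \<le> b" using pq(2) by auto
qed

text \<open>N has bidegree (-1, -1) for the Deligne splitting. Compatibility with F and W only
  bounds the types of N u on one side; the other bound comes from applying the same to the conjugate
  of u, as N is real. Together they leave only (p - 1, q - 1).\<close>

lemma T_I:
  assumes u: "u \<in> I p q"
  shows "T u \<in> I (p - 1) (q - 1)"
proof -
  have T_type: "x \<in> I r s \<Longrightarrow> T x \<in> gs (\<lambda>r' s'. r' \<ge> r - 1 \<and> r' + s' \<le> r + s - 2)" for x r s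
  proof -
    assume x: "x \<in> I r s"
    then have "x \<in> F r" "x \<in> complexify (W (r + s))"
      unfolding F_eq Wc_eq using I_subset_gs[of "\<lambda>r' s'. r' \<ge> r" r s]
        I_subset_gs[of "\<lambda>r' s'. r' + s' \<le> r + s" r s] by auto
    then have "T x \<in> F (r - 1)" "T x \<in> complexify (W (r + s - 2))" using T_F T_W by auto
    then show ?thesis unfolding F_eq Wc_eq gs_Int[symmetric] by simp
  qed
  define y where "y = T u - cp (p - 1) (q - 1) (T u)"
  have y: "r \<ge> p - 1 \<and> r + s \<le> p + q - 2 \<and> (r, s) \<noteq> (p - 1, q - 1)" if "cp r s y \<noteq> 0" for r s
    using that T_type[OF u] unfolding y_def mem_gs by (auto split: if_splits)
  \<comment> \<open>The conjugate of u has type (q, p) or is smaller in both indices. The leading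
    part gives r \<ge> q - 1; for the smaller parts a bound on r from below and on r + s from above
    yields s \<le> p - 2.\<close>
  have cy: "r \<ge> q - 1 \<or> s \<le> p - 2" if rs: "cp r s (vec_cnj y) \<noteq> 0" for r s
  proof (rule ccontr)
    assume neg: "\<not> ?thesis"
    have "cp r s (vec_cnj (cp (p - 1) (q - 1) (T u))) = 0"
      using cnj_I[OF cp_in, of r s "p - 1" "q - 1" "T u"] neg by force
    moreover have "cp r s (vec_cnj (T u)) = 0"
    proof -
      have "vec_cnj (T u) = T (\<Sum>a\<in>types. cp (fst a) (snd a) (vec_cnj u))"
        by (simp add: cp_sum_types complex_matrix_mult_cnj)
      also have "\<dots> = (\<Sum>a\<in>types. T (cp (fst a) (snd a) (vec_cnj u)))"
        by (rule vec.sum)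
      finally have "cp r s (vec_cnj (T u)) = (\<Sum>a\<in>types. cp r s (T (cp (fst a) (snd a) (vec_cnj u))))"
        by simp
      moreover have "cp r s (T (cp a b (vec_cnj u))) = 0" for a b
      proof (rule ccontr)
        assume nz: "cp r s (T (cp a b (vec_cnj u))) \<noteq> 0"
        then have "cp a b (vec_cnj u) \<noteq> 0" by auto
        then have "(a, b) = (q, p) \<or> a < q \<and> b < p" using cnj_I[OF u] by blast
        moreover have "r \<ge> a - 1 \<and> r + s \<le> a + b - 2"
          using nz T_type[OF cp_in, of a b "vec_cnj u"] unfolding mem_gs by blast
        ultimately show False using neg by auto
      qed
      ultimately show ?thesis by simp
    qed
    ultimately show False using rs by (simp add: y_def vec.diff)
  qed
  have "y = 0"
  proof (rule ccontr)
    assume "y \<noteq> 0"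
    \<comment> \<open>A component of \<open>y\<close> of maximal weight is chosen: by
      \<open>cnj_I\<close> no other component can contribute to type (s, r) of the conjugate, so its
      leading part cannot cancel.\<close>
    define A where "A = {a \<in> types. cp (fst a) (snd a) y \<noteq> 0}"
    have "A \<noteq> {}"
    proof
      assume "A = {}"
      then have "cp p q y = 0" for p q using cp_types[of p q y] unfolding A_def by force
      then show False using \<open>y \<noteq> 0\<close> cp_eq_0I by blast
    qed
    moreover have finA: "finite A" unfolding A_def using finite_types by simp
    ultimately obtain a where a: "a \<in> A" "\<And>c. c \<in> A \<Longrightarrow> fst c + snd c \<le> fst a + snd a"
      using Max_in[of "(\<lambda>c. fst c + snd c) ` A"] Max_ge[of "(\<lambda>c. fst c + snd c) ` A"]
      by fastforce
    obtain r s where rs: "a = (r, s)" by force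
    have "cp s r (vec_cnj y) = (\<Sum>c\<in>types. if c = a then cp s r (vec_cnj (cp r s y)) else 0)"
      unfolding cp_cnj[of s r y]
    proof (rule sum.cong)
      fix c assume c: "c \<in> types"
      show "cp s r (vec_cnj (cp (fst c) (snd c) y)) = (if c = a then cp s r (vec_cnj (cp r s y)) else 0)"
      proof (cases "c = a")
        case False
        have "cp s r (vec_cnj (cp (fst c) (snd c) y)) = 0"
        proof (rule ccontr)
          assume nz: "cp s r (vec_cnj (cp (fst c) (snd c) y)) \<noteq> 0"
          then have "c \<in> A" using c unfolding A_def by auto
          then have "fst c + snd c \<le> r + s" using a rs by force
          then show False using cnj_I[OF cp_in nz] False rs by (auto simp: prod_eq_iff)
        qed
        then show ?thesis using False by simp
      qed (simp add: rs)
    qed simp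
    also have "\<dots> = cp s r (vec_cnj (cp r s y))"
      using a(1) finite_types unfolding A_def by simp
    finally have "cp s r (vec_cnj y) \<noteq> 0"
      using cnj_I_leading[OF cp_in, of s r y] a(1) rs unfolding A_def by auto
    then have "s \<ge> q - 1 \<or> r \<le> p - 2" by (rule cy)
    moreover have "cp r s y \<noteq> 0" using a(1) rs unfolding A_def by auto
    ultimately show False using y[of r s] by auto
  qed
  then show ?thesis unfolding y_def using cp_in[of "p - 1" "q - 1" "T u"] by simp
qed

lemma T_pow_I: "u \<in> I p q \<Longrightarrow> (T ^^ j) u \<in> I (p - int j) (q - int j)"
proof (induction j)
  case (Suc j)
  then show ?case using T_I[of "(T ^^ j) u" "p - int j" "q - int j"] by (simp add: algebra_simps)
qed simp

lemma cp_T_pow: "cp p q ((T ^^ j) v) = (T ^^ j) (cp (p + int j) (q + int j) v)"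
proof -
  have "cp p q ((T ^^ j) v) = (\<Sum>a\<in>types. cp p q ((T ^^ j) (cp (fst a) (snd a) v)))"
    by (subst cp_sum_types[of v, symmetric]) (simp only: T_pow_sum cp_sum)
  also have "\<dots> = (\<Sum>a\<in>types. if fst a = p + int j \<and> snd a = q + int j
      then (T ^^ j) (cp (p + int j) (q + int j) v) else 0)"
    by (rule sum.cong) (auto simp: cp_of_I[OF T_pow_I[OF cp_in]])
  also have "\<dots> = (T ^^ j) (cp (p + int j) (q + int j) v)"
    by (rule sum_delta_types) (metis T_pow_zero cp_types)
  finally show ?thesis .
qed

text \<open>A vector of pure type that falls into lower weight is zero, so injectivity on the graded
  quotient becomes injectivity on the piece itself.\<close>

lemma T_pow_inj:
  assumes "u \<in> I p q" "p + q = int n + int k" "(T ^^ k) u = 0"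
  shows "u = 0"
proof -
  have "u \<in> complexify (W (p + q))"
    unfolding Wc_eq using I_subset_gs[of "\<lambda>r' s'. r' + s' \<le> p + q" p q] assms(1) by auto
  then have "u \<in> complexify (W (int n + int k - 1))"
    using W_inj[of u k] assms vec.subspace_0[OF subspace_complexify[OF subspace_W]] by simp
  then have "cp p q u = 0" using assms(2) unfolding Wc_eq mem_gs by force
  then show ?thesis using cp_of_I[OF assms(1), of p q] by simp
qed

text \<open>A preimage modulo lower weight becomes an exact one after projection to type (p, q),
  because N is homogeneous for the bigrading.\<close>

lemma T_pow_surj:
  assumes "w \<in> I (p - int k) (q - int k)" "p + q = int n + int k"
  obtains u where "u \<in> I p q" "(T ^^ k) u = w"
proof -
  have "w \<in> complexify (W (int n - int k))"
    unfolding Wc_eq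
      using assms I_subset_gs[of "\<lambda>r' s'. r' + s' \<le> int n - int k" "p - int k" "q - int k"]
    by auto
  then obtain v where v: "w - (T ^^ k) v \<in> complexify (W (int n - int k - 1))"
    using W_surj by blast
  have "cp (p - int k) (q - int k) (w - (T ^^ k) v) = 0"
    using v assms(2) unfolding Wc_eq mem_gs by force
  then have "w = (T ^^ k) (cp p q v)"
    using cp_of_I[OF assms(1), of "p - int k" "q - int k"] by (simp add: cp_T_pow)
  then show ?thesis using that cp_in by blast
qed

lemma linear_T_pow: "Vector_Spaces.linear (*s) (*s) (T ^^ k)"
  by unfold_locales simp_all

lemma dim_I_T_pow:
  assumes "p + q = int n + int k"
  shows "vec.dim (I (p - int k) (q - int k)) = vec.dim (I p q)"
proof -
  have "(T ^^ k) ` I p q = I (p - int k) (q - int k)"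
  proof
    show "I (p - int k) (q - int k) \<subseteq> (T ^^ k) ` I p q"
    proof
      fix w assume "w \<in> I (p - int k) (q - int k)"
      then obtain u where "u \<in> I p q" "(T ^^ k) u = w" using assms by (rule T_pow_surj)
      then show "w \<in> (T ^^ k) ` I p q" by blast
    qed
  qed (use T_pow_I in blast)
  moreover have "inj_on (T ^^ k) (vec.span (I p q))"
  proof -
    have "vec.span (I p q) = I p q" using subspace_I by simp
    moreover have "inj_on (T ^^ k) (I p q)"
    proof (rule inj_onI)
      fix x y assume xy: "x \<in> I p q" "y \<in> I p q" "(T ^^ k) x = (T ^^ k) y"
      have "x - y = 0"
        by (rule T_pow_inj[of "x - y" p q k]) (use xy assms vec.subspace_diff[OF subspace_I] in auto)
      then show "x = y" by simp
    qed
    ultimately show ?thesis by metis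
  qed
  ultimately show ?thesis using vec.dim_image_eq[OF linear_T_pow] by metis
qed

text \<open>For p + q = n + k the isomorphism N^k ends in type (p - k, q - k) = (n - q, n -
  p).\<close>

lemma dim_I_reflect: "vec.dim (I (int n - q) (int n - p)) = vec.dim (I p q)"
proof (cases "p + q \<ge> int n")
  case True
  then obtain k where "p + q = int n + int k" by (metis add.commute zle_iff_zadd)
  moreover from this have "p - int k = int n - q" "q - int k = int n - p" by linarith+
  ultimately show ?thesis using dim_I_T_pow[of p q k] by metis
next
  case False
  then obtain k where "int n = p + q + int k" by (metis linear zle_iff_zadd)
  moreover from this have "int n - q - int k = p" "int n - p - int k = q"
    "int n - q + (int n - p) = int n + int k" by linarith+
  ultimately show ?thesis using dim_I_T_pow[of "int n - q" "int n - p" k] by metis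
qed

lemma dim_I_0: "vec.dim (I p q) = 0 \<longleftrightarrow> (p, q) \<notin> types"
  unfolding mem_types using zero_in_I[of p q] by (auto simp: vec.dim_eq_0)

lemma types_reflect: "(int n - q, int n - p) \<in> types \<longleftrightarrow> (p, q) \<in> types"
  using dim_I_reflect[of q p] dim_I_0 by metis

lemma dim_T_I:
  assumes "p + q > int n"
  shows "vec.dim (T ` I p q) = vec.dim (I p q)"
proof (rule vec.dim_image_eq[OF vec.linear_axioms])
  obtain k where k: "p + q = int n + int (Suc k)"
    using assms by (metis add.commute zless_iff_Suc_zadd)
  show "inj_on T (vec.span (I p q))"
  proof -
    have "vec.span (I p q) = I p q" using subspace_I by simp
    moreover have "inj_on T (I p q)"
    proof (rule inj_onI)
      fix x y assume xy: "x \<in> I p q" "y \<in> I p q" "T x = T y"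
      have "(T ^^ Suc k) (x - y) = (T ^^ k) (T (x - y))" by (simp only: funpow_Suc_right comp_def)
      also have "T (x - y) = 0" using xy(3) by (simp add: vec.diff)
      finally have "x - y = 0"
        using T_pow_inj[of "x - y" p q "Suc k"] k xy vec.subspace_diff[OF subspace_I] by auto
      then show "x = y" by simp
    qed
    ultimately show "inj_on T (vec.span (I p q))" by metis
  qed
qed

lemma dim_I_T_le:
  assumes "p + q > int n"
  shows "vec.dim (I p q) \<le> vec.dim (I (p - 1) (q - 1))"
proof -
  have "vec.dim (T ` I p q) = vec.dim (I p q)" using assms(1) by (rule dim_T_I)
  moreover have "T ` I p q \<subseteq> I (p - 1) (q - 1)" using T_I by blast
  ultimately show ?thesis using vec.dim_subset by metis
qed

lemma T_surj_dim:
  assumes "p + q > int n" "vec.dim (I p q) = vec.dim (I (p - 1) (q - 1))" "w \<in> I (p - 1) (q - 1)"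
  obtains u where "u \<in> I p q" "T u = w"
proof -
  have "vec.dim (T ` I p q) = vec.dim (I p q)" using assms(1) by (rule dim_T_I)
  moreover have "T ` I p q \<subseteq> I (p - 1) (q - 1)" using T_I by blast
  ultimately have "T ` I p q = I (p - 1) (q - 1)"
    using assms(2) vec.subspace_dim_equal[OF vec.subspace_image[OF subspace_I] subspace_I] by simp
  then obtain u where "u \<in> I p q" "T u = w" using assms(3) by (metis imageE)
  then show ?thesis by (rule that)
qed

text \<open>Below, \<open>v\<close> is primitive of weight \<open>n + k\<close>.\<close>

definition strings :: "int \<Rightarrow> int \<Rightarrow> (complex^'n) set" where
  "strings p q = {(T ^^ j) v |j k v. v \<in> I (p + int j) (q + int j) \<and>
     int k = p + q + 2 * int j - int n \<and> (T ^^ Suc k) v = 0}"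

lemma T_strings: "x \<in> strings p q \<Longrightarrow> (T ^^ i) x \<in> strings (p - int i) (q - int i)"
proof -
  assume "x \<in> strings p q"
  then obtain j k v where *: "x = (T ^^ j) v" "v \<in> I (p + int j) (q + int j)"
    "int k = p + q + 2 * int j - int n" "(T ^^ Suc k) v = 0"
    unfolding strings_def by blast
  then show ?thesis unfolding strings_def mem_Collect_eq
    by (intro exI[of _ "i + j"] exI[of _ k] exI[of _ v]) (simp add: T_pow_T_pow algebra_simps)
qed

lemma span_T_strings:
  assumes "x \<in> vec.span (strings (p + int i) (q + int i))"
  shows "(T ^^ i) x \<in> vec.span (strings p q)"
  using assms
proof (induction rule: vec.span_induct_alt)
  case (step c x y)
  then show ?case using T_strings[OF step(1), of i]
    by (simp add: vec.span_add vec.span_scale vec.span_base)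
qed (simp add: vec.span_zero)

text \<open>Descending induction on the weight. As N^{k+2} maps onto the piece containing N^{k+1} u,
  some u2 of type (p + 1, q + 1) satisfies N^{k+2} u2 = N^{k+1} u; then u - N u2 is primitive and u2
  is covered by induction.\<close>

lemma primitive_decomposition_ge:
  assumes "u \<in> I p q" "p + q \<ge> int n"
  shows "u \<in> vec.span (strings p q)"
proof -
  obtain K where K: "\<And>p q. (p, q) \<in> types \<Longrightarrow> p + q \<le> K"
  proof -
    have "finite ((\<lambda>c. fst c + snd c) ` types)" using finite_types by simp
    then obtain K where "\<And>c. c \<in> types \<Longrightarrow> fst c + snd c \<le> K"
      by (meson bdd_above.unfold bdd_above_finite image_eqI)
    then show ?thesis using that[of K] by fastforce
  qed
  show ?thesis using assms
  proof (induction "nat (K - (p + q) + 1)" arbitrary: p q u rule: less_induct)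
    case less
    show ?case
    proof (cases "(p, q) \<in> types")
      case False
      then have "u = 0" using less.prems(1) unfolding mem_types by blast
      then show ?thesis using vec.span_zero by simp
    next
      case True
      obtain k where k: "p + q = int n + int k" using less.prems(2)
        by (metis add.commute zle_iff_zadd)
      have "(T ^^ Suc k) u \<in> I (p + 1 - int (k + 2)) (q + 1 - int (k + 2))"
        using T_pow_I[OF less.prems(1), of "Suc k"] by (simp add: algebra_simps)
      then obtain u2 where u2: "u2 \<in> I (p + 1) (q + 1)" "(T ^^ (k + 2)) u2 = (T ^^ Suc k) u"
        by (rule T_pow_surj) (use k in auto)
      have "u2 \<in> vec.span (strings (p + 1) (q + 1))"
        by (rule less.hyps) (use u2 k K[OF True] in auto)
      then have s: "T u2 \<in> vec.span (strings p q)"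
        using span_T_strings[of u2 p 1 q] by simp
      have "u - T u2 \<in> strings p q" unfolding strings_def mem_Collect_eq
      proof (rule exI[of _ 0], rule exI[of _ k], rule exI[of _ "u - T u2"], intro conjI)
        have "(T ^^ Suc k) (T u2) = (T ^^ (k + 2)) u2"
          using T_pow_T_pow[of "Suc k" 1 u2] by simp
        then show "(T ^^ Suc k) (u - T u2) = 0" using u2(2) by (simp only: T_pow_diff) simp
        show "u - T u2 \<in> I (p + int 0) (q + int 0)"
          using less.prems(1) T_I[OF u2(1)] vec.subspace_diff[OF subspace_I] by simp
      qed (use k in auto)
      then have "u - T u2 + T u2 \<in> vec.span (strings p q)"
        using s vec.span_add vec.span_base by blast
      then show ?thesis by simp
    qed
  qed
qed

lemma primitive_decomposition:
  assumes "u \<in> I p q"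
  shows "u \<in> vec.span (strings p q)"
proof (cases "p + q \<ge> int n")
  case False
  then obtain k where k: "int n = p + q + int k" by (metis linear zle_iff_zadd)
  have "u \<in> I (p + int k - int k) (q + int k - int k)" using assms by simp
  then obtain v where v: "v \<in> I (p + int k) (q + int k)" "(T ^^ k) v = u"
    by (rule T_pow_surj) (use k in auto)
  then have "v \<in> vec.span (strings (p + int k) (q + int k))"
    by (intro primitive_decomposition_ge) (use k in auto)
  then show ?thesis using span_T_strings v(2) by blast
qed (use assms primitive_decomposition_ge in blast)

end

section \<open>Polarized Hodge structures\<close>

locale polarized_hodge = polarization Q n
  for Q :: "real^'n \<Rightarrow> real^'n \<Rightarrow> real" and n :: nat +
  fixes F\<^sub>o :: "'n filtration"
  assumes phs: "polarized_hodge_structure Q n F\<^sub>o"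
begin

lemma subspace_Fo: "vec.subspace (F\<^sub>o p)"
  and Fo_mono: "p \<le> q \<Longrightarrow> F\<^sub>o q \<subseteq> F\<^sub>o p"
  and Fo_UNIV: "p \<le> 0 \<Longrightarrow> F\<^sub>o p = UNIV"
  and Fo_0: "p > int n \<Longrightarrow> F\<^sub>o p = {0}"
  and Fo_Int: "F\<^sub>o p \<inter> vec_cnj ` F\<^sub>o (int n - p + 1) = {0}"
  and Fo_span: "vec.span (F\<^sub>o p \<union> vec_cnj ` F\<^sub>o (int n - p + 1)) = UNIV"
  and B_Fo: "u \<in> F\<^sub>o p \<Longrightarrow> v \<in> F\<^sub>o (int n - p + 1) \<Longrightarrow> B u v = 0"
  using phs unfolding polarized_hodge_structure_def by (auto dest: antimonoD)

lemma Fo_split: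
  obtains f g where "v = f + g" "f \<in> F\<^sub>o p" "vec_cnj g \<in> F\<^sub>o (int n - p + 1)"
proof -
  have "v \<in> vec.span (F\<^sub>o p \<union> vec_cnj ` F\<^sub>o (int n - p + 1))" using Fo_span by simp
  moreover have "vec.span (F\<^sub>o p) = F\<^sub>o p"
    "vec.span (vec_cnj ` F\<^sub>o (int n - p + 1)) = vec_cnj ` F\<^sub>o (int n - p + 1)"
    by (simp_all only: vec.span_eq_iff subspace_Fo subspace_vec_cnj)
  ultimately show ?thesis using that unfolding vec.span_Un by auto
qed

text \<open>The second Hodge-Riemann orthogonality gives one inclusion. For the other, the conjugate
  part g of x pairs to zero with both halves of the opposite splitting, so nondegeneracy kills
  it.\<close>

lemma Fo_perp: "x \<in> F\<^sub>o p \<longleftrightarrow> (\<forall>y\<in>F\<^sub>o (int n - p + 1). B x y = 0)"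
proof
  assume x: "\<forall>y\<in>F\<^sub>o (int n - p + 1). B x y = 0"
  obtain f g where fg: "x = f + g" "f \<in> F\<^sub>o p" "vec_cnj g \<in> F\<^sub>o (int n - p + 1)" by (rule Fo_split)
  have "B g z = 0" for z
  proof -
    obtain a b where ab: "z = a + b" "a \<in> F\<^sub>o (int n - p + 1)"
      "vec_cnj b \<in> F\<^sub>o (int n - (int n - p + 1) + 1)" by (rule Fo_split)
    have "vec_cnj b \<in> F\<^sub>o p" using ab(3) by simp
    then have "B (vec_cnj b) (vec_cnj g) = 0" using B_Fo fg(3) by blast
    then have "B g b = 0" using B_sym_0 B_cnj[of b g] by auto
    moreover have "B f a = 0" using B_Fo[OF fg(2) ab(2)] .
    moreover have "B x a = 0" using x ab(2) by blast
    ultimately show ?thesis using fg(1) ab(1) by simp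
  qed
  then have "g = 0" by (rule B_nondeg)
  then show "x \<in> F\<^sub>o p" using fg by simp
qed (use B_Fo in blast)

text \<open>The Hodge decomposition of \<open>F\<^sub>o\<close>, set to zero off the line p + q = n
  so that it fits the format of a bigrading over all pairs of integers.\<close>

definition J :: "int \<Rightarrow> int \<Rightarrow> (complex^'n) set" where
  "J p q = (if p + q = int n then hodge_component F\<^sub>o p q else {0})"

lemma mem_J: "v \<in> J p q \<longleftrightarrow>
    (if p + q = int n then v \<in> F\<^sub>o p \<and> vec_cnj v \<in> F\<^sub>o q else v = 0)"
  unfolding J_def hodge_component_def by (auto simp: vec_cnj_image_iff)

lemma subspace_J: "vec.subspace (J p q)"
  using subspace_Fo unfolding vec.subspace_def by (auto simp: mem_J)

lemma Fo_step:
  assumes "v \<in> F\<^sub>o p"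
  obtains f g where "v = f + g" "f \<in> F\<^sub>o (p + 1)" "g \<in> J p (int n - p)"
proof -
  obtain f g where fg: "v = f + g" "f \<in> F\<^sub>o (p + 1)" "vec_cnj g \<in> F\<^sub>o (int n - (p + 1) + 1)"
    by (rule Fo_split)
  have "f \<in> F\<^sub>o p" using Fo_mono[of p "p + 1"] fg(2) by auto
  then have "v - f \<in> F\<^sub>o p" using assms vec.subspace_diff[OF subspace_Fo] by blast
  then have "g \<in> J p (int n - p)" using fg by (simp add: mem_J)
  then show ?thesis using that fg by blast
qed

lemma bigrading_J: "bigrading J"
  unfolding bigrading_def
proof (intro conjI allI impI ballI)
  have "F\<^sub>o (int n + 1 - int k) \<subseteq> vec.span (\<Union>p q. J p q)" for k
  proof (induction k)
    case 0
    then show ?case by (simp add: Fo_0 vec.span_zero)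
  next
    case (Suc k)
    show ?case
    proof
      fix v assume "v \<in> F\<^sub>o (int n + 1 - int (Suc k))"
      then obtain f g where fg: "v = f + g" "f \<in> F\<^sub>o (int n + 1 - int (Suc k) + 1)"
        "g \<in> J (int n + 1 - int (Suc k)) (int n - (int n + 1 - int (Suc k)))" by (rule Fo_step)
      have "f \<in> vec.span (\<Union>p q. J p q)" using Suc fg(2) by (auto simp: algebra_simps)
      moreover have "g \<in> vec.span (\<Union>p q. J p q)" using fg(3) by (intro vec.span_base) blast
      ultimately show "v \<in> vec.span (\<Union>p q. J p q)" using fg(1) vec.span_add by blast
    qed
  qed
  from this[of "n + 1"] show "vec.span (\<Union>p q. J p q) = UNIV" using Fo_UNIV[of 0] by auto
next
  fix A v a
  assume *: "finite A \<and> (\<forall>(p, q)\<in>A. v (p, q) \<in> J p q) \<and> (\<Sum>a\<in>A. v a) = 0" "a \<in> A"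
  then have vJ: "\<And>c. c \<in> A \<Longrightarrow> v c \<in> J (fst c) (snd c)" by force
  define A' where "A' = {c \<in> A. v c \<noteq> 0}"
  have fin: "finite A'" using * unfolding A'_def by simp
  have sum0: "(\<Sum>a\<in>A'. v a) = 0"
    using * unfolding A'_def by (subst sum.mono_neutral_left[of A]) auto
  have "A' = {}"
  proof (rule ccontr)
    assume "A' \<noteq> {}"
    \<comment> \<open>With the smallest first index p, the term \<open>v c\<close> equals minus a
      sum in F^{p+1}, while its conjugate lies in F^{n-p}. These two conditions are complementary,
      so the term vanishes.\<close>
    then obtain c where c: "c \<in> A'" "\<And>d. d \<in> A' \<Longrightarrow> fst c \<le> fst d"
      using fin Min_in[of "fst ` A'"] Min_le[of "fst ` A'"] by fastforce
    have weight: "fst d + snd d = int n" if "d \<in> A'" for d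
      using vJ[of d] that unfolding A'_def by (auto simp: mem_J split: if_splits)
    have "v c = - (\<Sum>d\<in>A' - {c}. v d)"
      using sum0 c(1) fin by (simp add: sum.remove eq_neg_iff_add_eq_0)
    moreover have "(\<Sum>d\<in>A' - {c}. v d) \<in> F\<^sub>o (fst c + 1)"
    proof (rule vec.subspace_sum[OF subspace_Fo])
      fix d assume d: "d \<in> A' - {c}"
      then have "fst d \<noteq> fst c" using weight[of d] weight[of c] c(1) by (auto simp: prod_eq_iff)
      then have "fst c + 1 \<le> fst d" using c(2)[of d] d by auto
      moreover have "v d \<in> F\<^sub>o (fst d)" using vJ[of d] weight[of d] d unfolding A'_def
        by (auto simp: mem_J)
      ultimately show "v d \<in> F\<^sub>o (fst c + 1)" using Fo_mono by blast
    qed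
    ultimately have "v c \<in> F\<^sub>o (fst c + 1)" using vec.subspace_neg[OF subspace_Fo] by metis
    moreover have "vec_cnj (v c) \<in> F\<^sub>o (int n - (fst c + 1) + 1)"
    proof -
      have "snd c = int n - (fst c + 1) + 1" using weight[OF c(1)] by simp
      moreover have "vec_cnj (v c) \<in> F\<^sub>o (snd c)"
        using vJ[of c] weight[OF c(1)] c(1) unfolding A'_def by (auto simp: mem_J)
      ultimately show ?thesis by metis
    qed
    ultimately have "v c = 0" using Fo_Int[of "fst c + 1"] unfolding vec_cnj_image_iff[symmetric]
      by blast
    then show False using c(1) unfolding A'_def by blast
  qed
  then show "v a = 0" using * unfolding A'_def by blast
qed (rule subspace_J)

sublocale hodge: bigraded J
  by unfold_locales (rule bigrading_J)

lemma types_J: "(p, q) \<in> hodge.types \<Longrightarrow> p + q = int n"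
  unfolding hodge.types_def J_def by (auto split: if_splits)

lemma cp_J_Fo: "hodge.cp p q v \<in> F\<^sub>o p"
  using hodge.cp_in[of p q v] vec.subspace_0[OF subspace_Fo] unfolding mem_J
    by (auto split: if_splits)

lemma Fo_eq: "F\<^sub>o p = hodge.gs (\<lambda>r s. r \<ge> p)"
proof
  show "hodge.gs (\<lambda>r s. r \<ge> p) \<subseteq> F\<^sub>o p"
  proof
    fix v assume v: "v \<in> hodge.gs (\<lambda>r s. r \<ge> p)"
    have "(\<Sum>a\<in>hodge.types. hodge.cp (fst a) (snd a) v) \<in> F\<^sub>o p"
    proof (rule vec.subspace_sum[OF subspace_Fo])
      fix a
      show "hodge.cp (fst a) (snd a) v \<in> F\<^sub>o p"
      proof (cases "hodge.cp (fst a) (snd a) v = 0")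
        case False
        then show ?thesis using v Fo_mono cp_J_Fo unfolding hodge.mem_gs by blast
      qed (simp add: vec.subspace_0[OF subspace_Fo])
    qed
    then show "v \<in> F\<^sub>o p" by (simp add: hodge.cp_sum_types)
  qed
  have "F\<^sub>o (int n + 1 - int k) \<subseteq> hodge.gs (\<lambda>r s. r \<ge> int n + 1 - int k)" for k
  proof (induction k)
    case 0
    then show ?case using vec.subspace_0[OF hodge.subspace_gs] by (simp add: Fo_0)
  next
    case (Suc k)
    show ?case
    proof
      fix v assume "v \<in> F\<^sub>o (int n + 1 - int (Suc k))"
      then obtain f g where fg: "v = f + g" "f \<in> F\<^sub>o (int n + 1 - int (Suc k) + 1)"
        "g \<in> J (int n + 1 - int (Suc k)) (int n - (int n + 1 - int (Suc k)))" by (rule Fo_step)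
      have "f \<in> hodge.gs (\<lambda>r s. r \<ge> int n + 1 - int k)" using Suc fg(2)
        by (auto simp: algebra_simps)
      then have "f \<in> hodge.gs (\<lambda>r s. r \<ge> int n + 1 - int (Suc k))"
        by (rule rev_subsetD) (rule hodge.gs_mono, simp)
      moreover have "g \<in> hodge.gs (\<lambda>r s. r \<ge> int n + 1 - int (Suc k))"
        using fg(3) by (rule rev_subsetD) (rule hodge.I_subset_gs, simp)
      ultimately show "v \<in> hodge.gs (\<lambda>r s. r \<ge> int n + 1 - int (Suc k))"
        using fg(1) vec.subspace_add[OF hodge.subspace_gs] by blast
    qed
  qed
  from this[of "nat (int n + 1 - p)"] show "F\<^sub>o p \<subseteq> hodge.gs (\<lambda>r s. r \<ge> p)"
  proof (cases "p \<le> int n + 1")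
    case False
    then show ?thesis using Fo_0[of p] vec.subspace_0[OF hodge.subspace_gs] by simp
  qed simp
qed

text \<open>For n = 2 m the Weil operator acts on V^{p,q} by i^{2(p-m)} = (-1)^{p-m}. On a sum of
  pieces of one parity it is therefore the scalar \<open>s\<close>, and positivity of the
  polarization becomes definiteness of the Hermitian form.\<close>

lemma J_definite:
  assumes "v \<noteq> 0" "n = 2 * m" "s = 1 \<or> s = -1"
    and v: "v \<in> hodge.gs (\<lambda>p q. (even (p - int m) \<longleftrightarrow> s = (1::real)))"
  shows "0 < s * Re (B v (vec_cnj v))"
proof -
  from phs have "\<exists>C. (\<forall>p q. p + q = int n \<longrightarrow>
        (\<forall>v\<in>hodge_component F\<^sub>o p q. C *v v = (\<i> powi (p - q)) *s v)) \<and>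
      (\<forall>v. v \<noteq> 0 \<longrightarrow> B (C *v v) (vec_cnj v) \<in> \<real> \<and> 0 < Re (B (C *v v) (vec_cnj v)))"
    unfolding polarized_hodge_structure_def by (elim conjE)
  then obtain C where C:
      "\<And>p q v. p + q = int n \<Longrightarrow> v \<in> hodge_component F\<^sub>o p q \<Longrightarrow> C *v v = (\<i> powi (p - q)) *s v"
      "\<And>v. v \<noteq> 0 \<Longrightarrow> 0 < Re (B (C *v v) (vec_cnj v))"
    by metis
  have "C *v v = complex_of_real s *s v"
  proof -
    have "C *v v = (\<Sum>a\<in>hodge.types. C *v hodge.cp (fst a) (snd a) v)"
      by (subst hodge.cp_sum_types[of v, symmetric]) (rule vec.sum)
    also have "\<dots> = (\<Sum>a\<in>hodge.types. complex_of_real s *s hodge.cp (fst a) (snd a) v)"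
    proof (rule sum.cong[OF refl])
      fix a assume a: "a \<in> hodge.types"
      obtain p q where pq: "a = (p, q)" by force
      show "C *v hodge.cp (fst a) (snd a) v = complex_of_real s *s hodge.cp (fst a) (snd a) v"
      proof (cases "hodge.cp p q v = 0")
        case False
        then have par: "even (p - int m) \<longleftrightarrow> s = 1" using v unfolding hodge.mem_gs by blast
        have w: "p + q = int n" using types_J a pq by blast
        have "hodge.cp p q v \<in> hodge_component F\<^sub>o p q" using hodge.cp_in[of p q v] w
          unfolding J_def by simp
        then have "C *v hodge.cp p q v = (\<i> powi (p - q)) *s hodge.cp p q v" by (rule C(1)[OF w])
        moreover have "\<i> powi (p - q) = complex_of_real s"
        proof -
          have pq2: "p - q = 2 * (p - int m)" using w assms(2) by simp
          have "\<i> powi (p - q) = (\<i> ^ 2) powi (p - int m)"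
            unfolding pq2 by (simp only: power_int_mult power_int_numeral)
          also have "\<dots> = (if even (p - int m) then 1 else -1)" by (simp add: power_int_minus_left)
          also have "\<dots> = complex_of_real s" using par assms(3) by auto
          finally show ?thesis .
        qed
        ultimately show ?thesis using pq by simp
      qed (simp add: pq)
    qed
    also have "\<dots> = complex_of_real s *s v"
      by (simp add: hodge.cp_sum_types flip: vec.scale_sum_right)
    finally show ?thesis .
  qed
  then show ?thesis using C(2)[OF assms(1)] by simp
qed

end

section \<open>The weight filtration and the polarization\<close>

locale polarized_lmhs = polarized_hodge Q n F\<^sub>o + limiting_mhs N n W F I
  for Q :: "real^'n \<Rightarrow> real^'n \<Rightarrow> real" and n :: nat and F\<^sub>o :: "'n filtration"
    and N :: "real^'n^'n" and W F I +
  assumes N_skew: "N \<in> real_lie_algebra Q"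
begin

lemma B_T: "B (T x) y = - B x (T y)"
proof -
  have N: "Q (N *v u) v = - Q u (N *v v)" for u v
    using N_skew unfolding real_lie_algebra_def by (simp add: eq_neg_iff_add_eq_0)
  show ?thesis by (simp add: complex_form_def complex_eq_iff N)
qed

lemma B_T_pow: "B ((T ^^ k) x) y = (-1) ^ k * B x ((T ^^ k) y)"
proof (induction k arbitrary: y)
  case (Suc k)
  have "B ((T ^^ Suc k) x) y = - B ((T ^^ k) x) (T y)" by (simp add: B_T)
  also have "\<dots> = (-1) ^ Suc k * B x ((T ^^ Suc k) y)"
    by (simp add: Suc.IH funpow_swap1)
  finally show ?case .
qed simp

text \<open>N is skew, so pairing N^j v with N^{j'} v' amounts up to sign to pairing v with N^{j+j'}
  v'. The bound on the total weight says k + k' < 2 (j + j'), hence j + j' exceeds k or k' and one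
  of the primitive vectors is annihilated.\<close>

lemma B_strings:
  assumes "x \<in> strings p q" "y \<in> strings p' q'" "p + q + p' + q' < 2 * int n"
  shows "B x y = 0"
proof -
  obtain j k v where x: "x = (T ^^ j) v" "int k = p + q + 2 * int j - int n" "(T ^^ Suc k) v = 0"
    using assms(1) unfolding strings_def by blast
  obtain j' k' v' where y: "y = (T ^^ j') v'" "int k' = p' + q' + 2 * int j' - int n" "(T ^^ Suc k') v' = 0"
    using assms(2) unfolding strings_def by blast
  have "Suc k \<le> j' + j \<or> Suc k' \<le> j + j'" using x(2) y(2) assms(3) by linarith
  then show ?thesis
  proof
    assume "Suc k \<le> j' + j"
    then have "(T ^^ j') x = 0" using T_pow_vanish[OF x(3)] x(1) T_pow_T_pow by simp
    then have "B ((T ^^ j') v') x = 0" using B_T_pow[of j' v' x] by simp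
    then show ?thesis using y(1) B_sym_0 by blast
  next
    assume "Suc k' \<le> j + j'"
    then have "(T ^^ j) y = 0" using T_pow_vanish[OF y(3)] y(1) T_pow_T_pow by simp
    then show ?thesis using B_T_pow[of j v y] x(1) by simp
  qed
qed

lemma B_I:
  assumes "x \<in> I p q" "y \<in> I p' q'" "p + q + p' + q' < 2 * int n"
  shows "B x y = 0"
proof -
  have "B u y = 0" if u: "u \<in> strings p q" for u
    using primitive_decomposition[OF assms(2)]
    by (induction rule: vec.span_induct_alt) (simp_all add: B_strings[OF u] assms(3))
  with primitive_decomposition[OF assms(1)] show ?thesis
    by (induction rule: vec.span_induct_alt) simp_all
qed

lemma B_W:
  assumes "x \<in> complexify (W k)" "y \<in> complexify (W l)" "k + l < 2 * int n"
  shows "B x y = 0"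
proof -
  have "B x y = (\<Sum>a\<in>types. \<Sum>c\<in>types. B (cp (fst a) (snd a) x) (cp (fst c) (snd c) y))"
    by (subst (1 2) cp_sum_types[symmetric]) (simp only: B_sum_left B_sum_right, rule sum.swap)
  also have "\<dots> = 0"
  proof (intro sum.neutral ballI)
    fix a c
    show "B (cp (fst a) (snd a) x) (cp (fst c) (snd c) y) = 0"
    proof (cases "cp (fst a) (snd a) x = 0 \<or> cp (fst c) (snd c) y = 0")
      case False
      then have "fst a + snd a \<le> k" "fst c + snd c \<le> l" using assms unfolding Wc_eq mem_gs by auto
      then show ?thesis by (intro B_I[OF cp_in cp_in]) (use assms(3) in linarith)
    qed auto
  qed
  finally show ?thesis .
qed

end

section \<open>Isometry groups and the compact dual\<close>

lemma continuous_on_matrix_mult [continuous_intros]: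
  fixes f g :: "'a::topological_space \<Rightarrow> 'b::real_normed_algebra_1^'n^'n"
  assumes "continuous_on S f" "continuous_on S g"
  shows "continuous_on S (\<lambda>x. f x ** g x)"
  unfolding matrix_matrix_mult_def using assms by (intro continuous_intros) auto

lemma continuous_on_matrix_vector_mult [continuous_intros]:
  fixes f :: "'a::topological_space \<Rightarrow> 'b::real_normed_algebra_1^'n^'n"
  assumes "continuous_on S f" "continuous_on S g"
  shows "continuous_on S (\<lambda>x. f x *v g x)"
  unfolding matrix_vector_mult_def using assms by (intro continuous_intros) auto

text \<open>The left translate of the identity component by a is connected and contains a, so it
  stays in the component of a, which is the identity component.\<close>

lemma component_matrix_mult:
  fixes S :: "('a::real_normed_algebra_1^'n^'n) set"
  assumes S: "mat 1 \<in> S" "\<And>a b. a \<in> S \<Longrightarrow> b \<in> S \<Longrightarrow> a ** b \<in> S"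
    and ab: "a \<in> connected_component_set S (mat 1)" "b \<in> connected_component_set S (mat 1)"
  shows "a ** b \<in> connected_component_set S (mat 1)"
proof -
  let ?C = "connected_component_set S (mat 1)"
  have a: "a \<in> S" using ab(1) connected_component_subset by blast
  have "connected ((\<lambda>x. a ** x) ` ?C)"
    by (intro connected_continuous_image continuous_intros connected_connected_component)
  moreover have "a \<in> (\<lambda>x. a ** x) ` ?C"
    using S(1) by (intro image_eqI[of _ _ "mat 1"]) simp_all
  moreover have "(\<lambda>x. a ** x) ` ?C \<subseteq> S" using S(2) a connected_component_subset by blast
  ultimately have "(\<lambda>x. a ** x) ` ?C \<subseteq> connected_component_set S a"
    by (intro connected_component_maximal)
  also have "connected_component_set S a = ?C" using connected_component_eq[OF ab(1)] by simp
  finally show ?thesis using ab(2) by (rule subsetD[OF _ imageI])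
qed

text \<open>The translate of the identity component by a' contains both a' and a' a = 1.\<close>

lemma component_matrix_inverse:
  fixes S :: "('a::real_normed_algebra_1^'n^'n) set"
  assumes S: "mat 1 \<in> S" "\<And>a b. a \<in> S \<Longrightarrow> b \<in> S \<Longrightarrow> a ** b \<in> S"
    and a: "a \<in> connected_component_set S (mat 1)" "a' \<in> S" "a' ** a = mat 1"
  shows "a' \<in> connected_component_set S (mat 1)"
proof -
  let ?C = "connected_component_set S (mat 1)"
  have "connected ((\<lambda>x. a' ** x) ` ?C)"
    by (intro connected_continuous_image continuous_intros connected_connected_component)
  moreover have 1: "a' \<in> (\<lambda>x. a' ** x) ` ?C"
    using S(1) by (intro image_eqI[of _ _ "mat 1"]) simp_all
  moreover have "mat 1 \<in> (\<lambda>x. a' ** x) ` ?C" using a by (metis image_eqI)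
  moreover have "(\<lambda>x. a' ** x) ` ?C \<subseteq> S" using S(2) a connected_component_subset by blast
  ultimately have "(\<lambda>x. a' ** x) ` ?C \<subseteq> ?C" by (intro connected_component_maximal)
  then show ?thesis using 1 by (rule subsetD)
qed

lemma act_mult: "act (a ** b) M = act a (act b M)"
  unfolding act_def by (simp add: image_image matrix_vector_mul_assoc)

lemma act_mat_1 [simp]: "act (mat 1) M = M"
  unfolding act_def by simp

lemma mem_act: "x \<in> act g M p \<longleftrightarrow> (\<exists>y\<in>M p. x = g *v y)"
  unfolding act_def by blast

section \<open>Real and complex isometries and their orbits\<close>

context polarization
begin

definition isometries :: "(complex^'n^'n) set" where
  "isometries = {g. \<forall>u v. B (g *v u) (g *v v) = B u v}"

definition real_isometries :: "(real^'n^'n) set" where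
  "real_isometries = {g. \<forall>u v. Q (g *v u) (g *v v) = Q u v}"

lemma complex_group_eq: "complex_group Q = connected_component_set isometries (mat 1)"
  and real_group_eq: "real_group Q = connected_component_set real_isometries (mat 1)"
  unfolding complex_group_def isometries_def real_group_def real_isometries_def by simp_all

lemma isometries_1: "mat 1 \<in> isometries"
  and isometries_mult: "a \<in> isometries \<Longrightarrow> b \<in> isometries \<Longrightarrow> a ** b \<in> isometries"
  and real_isometries_1: "mat 1 \<in> real_isometries"
  and real_isometries_mult:
    "a' \<in> real_isometries \<Longrightarrow> b' \<in> real_isometries \<Longrightarrow> a' ** b' \<in> real_isometries"
  unfolding isometries_def real_isometries_def by (simp_all flip: matrix_vector_mul_assoc)

lemma isometry_inverse:
  assumes "g \<in> isometries"
  obtains g' where "g' \<in> isometries" "g' ** g = mat 1" "g ** g' = mat 1"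
proof -
  have g: "B (g *v u) (g *v v) = B u v" for u v using assms unfolding isometries_def by blast
  have "inj ((*v) g)"
  proof (rule injI)
    fix x y assume "g *v x = g *v y"
    then have "B (x - y) v = 0" for v
      using g[of "x - y" v] by (simp add: vec.diff)
    then show "x = y" using B_nondeg[of "x - y"] by simp
  qed
  then obtain g' where g': "g' ** g = mat 1" using matrix_left_invertible_injective by blast
  then have g'': "g ** g' = mat 1" using matrix_left_right_inverse by blast
  have "B (g' *v u) (g' *v v) = B u v" for u v
    using g[of "g' *v u" "g' *v v"] by (simp add: matrix_vector_mul_assoc g'')
  then show ?thesis using that g' g'' unfolding isometries_def by blast
qed

lemma real_isometry_inverse:
  assumes "g \<in> real_isometries"
  obtains g' where "g' \<in> real_isometries" "g' ** g = mat 1" "g ** g' = mat 1"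
proof -
  have g: "Q (g *v u) (g *v v) = Q u v" for u v using assms unfolding real_isometries_def by blast
  have "inj ((*v) g)"
  proof (rule injI)
    fix x y assume "g *v x = g *v y"
    then have "Q (x - y) v = 0" for v
      using g[of "x - y" v] by (simp add: vec.diff Q_simps)
    then show "x = y" using Q_nondeg[of "x - y"] by simp
  qed
  then obtain g' where g': "g' ** g = mat 1" using matrix_left_invertible_injective by blast
  then have g'': "g ** g' = mat 1" using matrix_left_right_inverse by blast
  have "Q (g' *v u) (g' *v v) = Q u v" for u v
    using g[of "g' *v u" "g' *v v"] by (simp add: matrix_vector_mul_assoc g'')
  then show ?thesis using that g' g'' unfolding real_isometries_def by blast
qed

lemma complex_group_isometries: "complex_group Q \<subseteq> isometries"
  unfolding complex_group_eq by (rule connected_component_subset)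

lemma complex_group_mult: "a \<in> complex_group Q \<Longrightarrow> b \<in> complex_group Q \<Longrightarrow> a ** b \<in> complex_group Q"
  unfolding complex_group_eq by (rule component_matrix_mult[OF isometries_1 isometries_mult])

lemma complex_group_inverse:
  assumes "g \<in> complex_group Q"
  obtains g' where "g' \<in> complex_group Q" "g' ** g = mat 1" "g ** g' = mat 1"
proof -
  obtain g' where g': "g' \<in> isometries" "g' ** g = mat 1" "g ** g' = mat 1"
    using isometry_inverse assms complex_group_isometries by blast
  then have "g' \<in> complex_group Q"
    using component_matrix_inverse[OF isometries_1 isometries_mult] assms unfolding complex_group_eq
      by blast
  then show ?thesis using that g' by blast
qed

lemma real_group_isometries: "real_group Q \<subseteq> real_isometries"
  unfolding real_group_eq by (rule connected_component_subset)

lemma real_group_mult: "a \<in> real_group Q \<Longrightarrow> b \<in> real_group Q \<Longrightarrow> a ** b \<in> real_group Q"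
  unfolding real_group_eq by (rule component_matrix_mult[OF real_isometries_1 real_isometries_mult])

lemma real_group_inverse:
  assumes "g \<in> real_group Q"
  obtains g' where "g' \<in> real_group Q" "g' ** g = mat 1" "g ** g' = mat 1"
proof -
  obtain g' where g': "g' \<in> real_isometries" "g' ** g = mat 1" "g ** g' = mat 1"
    using real_isometry_inverse assms real_group_isometries by blast
  then have "g' \<in> real_group Q"
    using component_matrix_inverse[OF real_isometries_1 real_isometries_mult] assms
      unfolding real_group_eq by blast
  then show ?thesis using that g' by blast
qed

lemma real_orbit_closed:
  assumes "g \<in> real_group Q" "M \<in> real_orbit Q L"
  shows "act (complex_matrix g) M \<in> real_orbit Q L"
  using assms real_group_mult unfolding real_orbit_def
  by (auto simp: act_mult[symmetric] complex_matrix_matrix_mult[symmetric])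

lemma real_orbit_connect:
  assumes "M \<in> real_orbit Q L" "M' \<in> real_orbit Q L"
  obtains g where "g \<in> real_group Q" "M' = act (complex_matrix g) M"
proof -
  obtain a b where ab: "a \<in> real_group Q" "b \<in> real_group Q"
    "M = act (complex_matrix a) L" "M' = act (complex_matrix b) L"
    using assms unfolding real_orbit_def by blast
  obtain a' where a': "a' \<in> real_group Q" "a' ** a = mat 1"
    using real_group_inverse[OF ab(1)] by blast
  have "M' = act (complex_matrix (b ** a')) M"
    unfolding ab(3,4) act_mult[symmetric] complex_matrix_matrix_mult[symmetric]
    by (simp add: a'(2) flip: matrix_mul_assoc)
  then show ?thesis using that real_group_mult ab a' by blast
qed

end

section \<open>Flags and topology of the compact dual\<close>

context polarized_hodge
begin

abbreviation dual_top :: "'n filtration topology" where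
  "dual_top \<equiv> compact_dual_topology Q F\<^sub>o"

lemma dual_subspace: "M \<in> compact_dual Q F\<^sub>o \<Longrightarrow> vec.subspace (M p)"
  unfolding compact_dual_def act_def using vec.subspace_image[OF subspace_Fo] by auto

lemma dual_antimono: "M \<in> compact_dual Q F\<^sub>o \<Longrightarrow> p \<le> q \<Longrightarrow> M q \<subseteq> M p"
  unfolding compact_dual_def act_def using Fo_mono by auto

text \<open>Isometries carry the relation over from \<open>F\<^sub>o\<close>. It makes membership in
  M^p a system of equations, which is what survives in limits.\<close>

lemma dual_perp:
  assumes "M \<in> compact_dual Q F\<^sub>o"
  shows "x \<in> M p \<longleftrightarrow> (\<forall>y\<in>M (int n - p + 1). B x y = 0)"
proof -
  obtain h where h: "h \<in> complex_group Q" "M = act h F\<^sub>o" using assms unfolding compact_dual_def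
    by blast
  obtain h' where h': "h' ** h = mat 1" "h ** h' = mat 1" using complex_group_inverse[OF h(1)]
    by metis
  have iso: "B (h *v u) (h *v v) = B u v" for u v
    using h(1) complex_group_isometries unfolding isometries_def by blast
  have x: "x = h *v (h' *v x)" by (simp add: matrix_vector_mul_assoc h')
  have "x \<in> M p \<longleftrightarrow> h' *v x \<in> F\<^sub>o p"
    unfolding h(2) mem_act using x h'(1) by (metis matrix_vector_mul_assoc matrix_vector_mul_lid)
  also have "\<dots> \<longleftrightarrow> (\<forall>y\<in>F\<^sub>o (int n - p + 1). B (h *v (h' *v x)) (h *v y) = 0)"
    unfolding Fo_perp[of "h' *v x" p] iso by simp
  also have "\<dots> \<longleftrightarrow> (\<forall>y\<in>M (int n - p + 1). B x y = 0)"
    unfolding h(2) act_def using x by simp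
  finally show ?thesis .
qed

lemma dim_act:
  assumes "g \<in> isometries"
  shows "vec.dim (act g M p) = vec.dim (M p)"
proof -
  obtain g' where "g' ** g = mat 1" using isometry_inverse[OF assms] by metis
  then have "inj ((*v) g)" using matrix_left_invertible_injective by blast
  then have "inj_on ((*v) g) (vec.span (M p))" using inj_on_subset by blast
  then show ?thesis unfolding act_def by (rule vec.dim_image_eq[OF vec.linear_axioms])
qed

lemma dual_dim:
  assumes "M \<in> compact_dual Q F\<^sub>o"
  shows "vec.dim (M p) = vec.dim (F\<^sub>o p)"
  using assms dim_act complex_group_isometries unfolding compact_dual_def by blast

lemma dual_act: "g \<in> complex_group Q \<Longrightarrow> M \<in> compact_dual Q F\<^sub>o \<Longrightarrow> act g M \<in> compact_dual Q F\<^sub>o"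
  unfolding compact_dual_def using complex_group_mult by (auto simp: act_mult[symmetric])

text \<open>The orbit map of the complex group is open, hence convergence can be lifted.\<close>

lemma limitin_lift:
  assumes lim: "limitin dual_top f (act h F\<^sub>o) net" and h: "h \<in> complex_group Q" and e: "e > 0"
  shows "eventually (\<lambda>z. \<exists>g\<in>complex_group Q. dist g h < e \<and> f z = act g F\<^sub>o) net"
proof -
  let ?G = "complex_group Q"
  define U where "U = {act g F\<^sub>o |g. g \<in> ?G \<and> dist g h < e}"
  \<comment> \<open>The preimage of \<open>U\<close> under the orbit map is a union, over the
    stabilizer of \<open>F\<^sub>o\<close>, of preimages of a ball under right translation, hence
    open.\<close>
  have eq: "{g \<in> ?G. act g F\<^sub>o \<in> U} =
      (\<Union>s\<in>{s\<in>?G. act s F\<^sub>o = F\<^sub>o}. {g \<in> ?G. g ** s \<in> ball h e})" (is "?L = ?R")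
  proof
    show "?L \<subseteq> ?R"
    proof
      fix g assume "g \<in> ?L"
      then obtain g1 where g: "g \<in> ?G" "g1 \<in> ?G" "act g F\<^sub>o = act g1 F\<^sub>o" "dist g1 h < e"
        unfolding U_def by auto
      obtain g' where g': "g' \<in> ?G" "g' ** g = mat 1" "g ** g' = mat 1"
        using complex_group_inverse[OF g(1)] by blast
      have "act (g' ** g1) F\<^sub>o = F\<^sub>o"
        by (simp add: act_mult g(3)[symmetric]) (simp add: g' flip: act_mult)
      moreover have "g ** (g' ** g1) = g1" by (simp add: matrix_mul_assoc g')
      ultimately have "g' ** g1 \<in> {s \<in> ?G. act s F\<^sub>o = F\<^sub>o}" "g \<in> {g \<in> ?G. g ** (g' ** g1) \<in> ball h e}"
        using g g' complex_group_mult by (auto simp: dist_commute)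
      then show "g \<in> ?R" by (rule UN_I)
    qed
    show "?R \<subseteq> ?L"
    proof
      fix g assume "g \<in> ?R"
      then obtain s where s: "s \<in> ?G" "act s F\<^sub>o = F\<^sub>o" "g \<in> ?G" "g ** s \<in> ball h e" by blast
      then have "act g F\<^sub>o = act (g ** s) F\<^sub>o" by (simp add: act_mult)
      then show "g \<in> ?L" using s complex_group_mult unfolding U_def by (auto simp: dist_commute)
    qed
  qed
  have "openin (top_of_set ?G) {g \<in> ?G. g ** s \<in> ball h e}" for s
  proof -
    have "{g \<in> ?G. g ** s \<in> ball h e} = ?G \<inter> (\<lambda>g. g ** s) -` ball h e" by blast
    then show ?thesis
      by (simp add: continuous_openin_preimage_gen continuous_intros)
  qed
  then have "openin (top_of_set ?G) {g \<in> ?G. act g F\<^sub>o \<in> U}"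
    unfolding eq by blast
  moreover have "U \<subseteq> compact_dual Q F\<^sub>o" unfolding U_def compact_dual_def by blast
  ultimately have "openin dual_top U" unfolding openin_compact_dual_topology by blast
  moreover have "act h F\<^sub>o \<in> U" unfolding U_def using h e by force
  ultimately have "eventually (\<lambda>z. f z \<in> U) net" using lim unfolding limitin_def by blast
  then show ?thesis by (rule eventually_mono) (auto simp: U_def)
qed

text \<open>In the quotient topology the complement of Z pulls back to a relatively open subset of
  the group, so closedness can be tested along convergent group elements.\<close>

lemma closedin_dual_limit:
  assumes Z: "closedin dual_top Z"
    and g: "\<And>k. g k \<in> complex_group Q" "\<And>k. act (g k) F\<^sub>o \<in> Z" "g \<longlonglongrightarrow> h" "h \<in> complex_group Q"
  shows "act h F\<^sub>o \<in> Z"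
proof (rule ccontr)
  assume neg: "act h F\<^sub>o \<notin> Z"
  let ?G = "complex_group Q" and ?A = "{g \<in> complex_group Q. act g F\<^sub>o \<in> topspace dual_top - Z}"
  have top: "topspace dual_top = compact_dual Q F\<^sub>o"
  proof
    show "topspace dual_top \<subseteq> compact_dual Q F\<^sub>o"
      using openin_topspace[of dual_top] unfolding openin_compact_dual_topology by blast
    have "openin dual_top (compact_dual Q F\<^sub>o)"
    proof -
      have "{g \<in> ?G. act g F\<^sub>o \<in> compact_dual Q F\<^sub>o} = ?G" unfolding compact_dual_def by blast
      then show ?thesis unfolding openin_compact_dual_topology by simp
    qed
    then show "compact_dual Q F\<^sub>o \<subseteq> topspace dual_top" by (rule openin_subset)
  qed
  have "openin (top_of_set ?G) ?A"
    using Z unfolding closedin_def openin_compact_dual_topology by blast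
  then obtain V where V: "open V" "?A = ?G \<inter> V" unfolding openin_open by blast
  have "h \<in> ?A" using g(4) neg top by (auto simp: compact_dual_def)
  then have "eventually (\<lambda>k. g k \<in> V) sequentially" using V g(3) topological_tendstoD by blast
  then obtain k where "g k \<in> V" using eventually_happens by fastforce
  then have "g k \<in> ?A" using V(2) g(1) by blast
  then show False using g(2) by blast
qed

text \<open>A vector belongs to L^p as soon as it annihilates L^{n-p+1}. Along points z chosen with
  error below 1/(k+1), the flags lift to group elements converging to h; the annihilation holds at
  each of these points and passes to the limit by continuity of the form.\<close>

lemma mem_limit:
  assumes lim: "limitin dual_top f L net" and L: "L \<in> compact_dual Q F\<^sub>o" and net: "net \<noteq> bot"
    and y: "(y \<longlongrightarrow> x) net" "eventually (\<lambda>z. y z \<in> f z p) net"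
  shows "x \<in> L p"
proof -
  obtain h where h: "h \<in> complex_group Q" "L = act h F\<^sub>o" using L unfolding compact_dual_def
    by blast
  have "\<exists>z g. g \<in> complex_group Q \<and> dist g h < inverse (real (Suc k)) \<and> f z = act g F\<^sub>o \<and>
      y z \<in> f z p \<and> dist (y z) x < inverse (real (Suc k))" for k
  proof -
    have e: "inverse (real (Suc k)) > 0" by simp
    from limitin_lift[OF lim[unfolded h(2)] h(1) e] y(2) tendstoD[OF y(1) e]
    have "eventually (\<lambda>z. (\<exists>g\<in>complex_group Q. dist g h < inverse (real (Suc k)) \<and> f z = act g F\<^sub>o) \<and>
        y z \<in> f z p \<and> dist (y z) x < inverse (real (Suc k))) net" by eventually_elim blast
    then show ?thesis using eventually_happens'[OF net] by blast
  qed
  then obtain z g where zg: "\<And>k. g k \<in> complex_group Q" "\<And>k. dist (g k) h < inverse (real (Suc k))"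
    "\<And>k. f (z k) = act (g k) F\<^sub>o" "\<And>k. y (z k) \<in> f (z k) p"
    "\<And>k. dist (y (z k)) x < inverse (real (Suc k))" by metis
  have conv: "(\<lambda>k. u k) \<longlonglongrightarrow> v" if "\<And>k. dist (u k) v < inverse (real (Suc k))"
    for u :: "nat \<Rightarrow> 'z::metric_space" and v
  proof (subst tendsto_dist_iff, rule tendsto_sandwich[OF _ _ tendsto_const LIMSEQ_inverse_real_of_nat])
    show "eventually (\<lambda>k. dist (u k) v \<le> inverse (real (Suc k))) sequentially"
      using that less_imp_le by (intro always_eventually) blast
  qed auto
  show ?thesis unfolding dual_perp[OF L, of x p]
  proof
    fix w assume "w \<in> L (int n - p + 1)"
    then obtain v where v: "v \<in> F\<^sub>o (int n - p + 1)" "w = h *v v" unfolding h(2) mem_act by blast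
    have "B (y (z k)) (g k *v v) = 0" for k
    proof -
      obtain a where "a \<in> F\<^sub>o p" "y (z k) = g k *v a" using zg(4)[of k] unfolding zg(3) mem_act
        by blast
      moreover have "B (g k *v a) (g k *v v) = B a v" for a
        using zg(1)[of k] complex_group_isometries unfolding isometries_def by blast
      ultimately show ?thesis using B_Fo[OF _ v(1)] by simp
    qed
    moreover have "(\<lambda>k. g k *v v) \<longlonglongrightarrow> h *v v"
    proof -
      have "isCont (\<lambda>g. g *v v) h"
        by (rule continuous_on_interior[of UNIV]) (auto intro!: continuous_intros)
      then show ?thesis using conv[of g h] zg(2) isCont_tendsto_compose by blast
    qed
    then have "(\<lambda>k. B (y (z k)) (g k *v v)) \<longlonglongrightarrow> B x (h *v v)"
      using conv[of "\<lambda>k. y (z k)" x] zg(5) by (intro tendsto_B) auto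
    ultimately show "B x w = 0" using v(2) by (simp add: LIMSEQ_const_iff)
  qed
qed

end

section \<open>The reduced limit period mapping\<close>

lemma matrix_vector_mult_sum_left:
  fixes f :: "'i \<Rightarrow> 'a::semiring_1^'n^'m"
  shows "(\<Sum>i\<in>A. f i) *v x = (\<Sum>i\<in>A. f i *v x)"
  by (induction A rule: infinite_finite_induct) (simp_all add: matrix_vector_mult_add_rdistrib)

lemma matrix_exp_nilpotent:
  fixes N :: "real^'n^'n"
  assumes "matrix_power N K = 0"
  shows "matrix_exp (map_matrix (\<lambda>x. z * complex_of_real x) N) *v v =
    (\<Sum>i<K. (z ^ i / fact i) *s ((*v) (complex_matrix N) ^^ i) v)"
proof -
  define A where "A = map_matrix (\<lambda>x. z * complex_of_real x) N"
  have A: "A *v x = z *s (complex_matrix N *v x)" for x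
    by (simp add: A_def vec_eq_iff matrix_vector_mult_def map_matrix_def sum_distrib_left mult.assoc)
  have A_pow: "matrix_power A i *v x = z ^ i *s ((*v) (complex_matrix N) ^^ i) x" for i x
    unfolding matrix_power_mult_vec by (induction i) (simp_all add: A vec.scale)
  have "matrix_power A i = 0" if "i \<ge> K" for i
  proof -
    have "((*v) (complex_matrix N) ^^ K) x = 0" for x
      using assms by (simp add: vec_eq_iff_Re_Im)
    then have "((*v) (complex_matrix N) ^^ (i - K + K)) x = ((*v) (complex_matrix N) ^^ (i - K)) 0"
      for x
      unfolding funpow_add by simp
    moreover have "((*v) (complex_matrix N) ^^ j) 0 = 0" for j by (induction j) simp_all
    ultimately have "matrix_power A i *v x = 0 *v x" for x using that by (simp add: A_pow)
    then show ?thesis by (simp add: matrix_eq)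
  qed
  then have "matrix_exp A = (\<Sum>i<K. (1 / fact i) *\<^sub>R matrix_power A i)"
    unfolding matrix_exp_def by (intro suminf_finite) auto
  moreover have "((1 / fact i) *\<^sub>R matrix_power A i) *v v = (z ^ i / fact i) *s ((*v) (complex_matrix N) ^^ i) v" for i
    by (simp add: scaleR_matrix_mult_vec A_pow)
  ultimately show ?thesis unfolding A_def[symmetric] by (simp add: matrix_vector_mult_sum_left)
qed

lemma pcompose_monom:
  "pcompose (monom c i) q = smult c (q ^ i)" for q :: "'a::comm_semiring_1 poly"
  by (induction i) (simp_all add: monom_0 monom_Suc pcompose_pCons)

lemma pcompose_power:
  "pcompose (p ^ i) q = pcompose p q ^ i" for q :: "'a::comm_semiring_1 poly"
  by (induction i) (simp_all add: pcompose_1 pcompose_mult)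

lemma coeff_linear_pow:
  fixes a b :: "'a::comm_semiring_1"
  shows "coeff ([:a, b:] ^ n) i = of_nat (n choose i) * b ^ i * a ^ (n - i)"
proof (cases "i \<le> n")
  case False
  have "degree ([:a, b:] ^ n) \<le> degree [:a, b:] * n" by (rule degree_power_le)
  also have "\<dots> \<le> 1 * n" by (rule mult_right_mono) simp_all
  finally have "coeff ([:a, b:] ^ n) i = 0" using False by (intro coeff_eq_0) simp
  then show ?thesis using False by (simp add: binomial_eq_0)
qed (rule coeff_linear_poly_power)

lemma filtercomap_Im_at_top_neq_bot: "filtercomap Im at_top \<noteq> bot"
proof (rule filtercomap_neq_bot_surj)
  show "surj Im" by (rule surjI[of _ "\<lambda>y. Complex 0 y"]) simp
qed simp

lemma inverse_tendsto_0_Im_at_top: "((\<lambda>z. 1 / z) \<longlongrightarrow> (0::complex)) (filtercomap Im at_top)"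
proof -
  have "filterlim (\<lambda>z::complex. norm z) at_top (filtercomap Im at_top)"
  proof (rule filterlim_at_top_mono[OF filterlim_filtercomap])
    show "eventually (\<lambda>z. Im z \<le> norm z) (filtercomap Im at_top)"
      using abs_Im_le_cmod by (intro always_eventually allI) (metis abs_le_D1)
  qed
  then have "filterlim (\<lambda>z::complex. z) at_infinity (filtercomap Im at_top)"
    by (rule filterlim_norm_at_top_imp_at_infinity)
  from filterlim_compose[OF tendsto_inverse_0 this] show ?thesis by (simp add: inverse_eq_divide)
qed

lemma eventually_nonzero_Im_at_top: "eventually (\<lambda>z. z \<noteq> 0) (filtercomap Im at_top)"
  using eventually_filtercomapI[OF eventually_gt_at_top[of 0], of Im]
  by (rule eventually_mono) auto

context limiting_mhs
begin

text \<open>On a string generated by the primitive vector \<open>v\<close>, \<open>N\<close> acts like differentiation of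
  polynomials of degree at most \<open>k\<close>, so that \<open>e\<^sup>z\<^sup>N\<close> acts like translation by \<open>z\<close>.\<close>

definition string_map :: "complex^'n \<Rightarrow> nat \<Rightarrow> complex poly \<Rightarrow> complex^'n" where
  "string_map v k f = (\<Sum>i\<le>k. (coeff f i * fact i / fact k) *s (T ^^ (k - i)) v)"

lemma string_map_sum: "string_map v k (\<Sum>a\<in>A. f a) = (\<Sum>a\<in>A. string_map v k (f a))"
  unfolding string_map_def coeff_sum sum_distrib_right sum_divide_distrib vec.scale_sum_left
  by (rule sum.swap)

lemma string_map_smult: "string_map v k (smult c f) = c *s string_map v k f"
  unfolding string_map_def by (simp add: vec.scale_sum_right mult.assoc)

lemma string_map_monom:
  assumes "i \<le> k"
  shows "string_map v k (monom 1 i) = (fact i / fact k) *s (T ^^ (k - i)) v"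
proof -
  have "string_map v k (monom 1 i) =
      (\<Sum>a\<le>k. if a = i then (fact i / fact k) *s (T ^^ (k - i)) v else 0)"
    unfolding string_map_def by (intro sum.cong refl) simp
  then show ?thesis using assms by simp
qed

text \<open>By linearity it is enough to take monomials, where this is the binomial expansion of (X
  + z)^i; the factor i!/k! in \<open>string_map\<close> makes N act as d/dX. Terms of the
  exponential beyond degree i vanish since N^{k+1} v = 0.\<close>

lemma exp_string_map:
  assumes v: "(T ^^ Suc k) v = 0" and K: "K > k" and f: "degree f \<le> k"
  shows "(\<Sum>l<K. (z ^ l / fact l) *s (T ^^ l) (string_map v k f)) = string_map v k (pcompose f [:z, 1:])"
proof -
  let ?E = "\<lambda>x. \<Sum>l<K. (z ^ l / fact l) *s (T ^^ l) x"
  have monom: "?E (string_map v k (monom 1 i)) = string_map v k ([:z, 1:] ^ i)" if i: "i \<le> k" for i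
  proof -
    have "?E (string_map v k (monom 1 i)) =
        (\<Sum>l<K. (z ^ l / fact l * (fact i / fact k)) *s (T ^^ (l + (k - i))) v)"
      by (simp add: string_map_monom[OF i] T_pow_T_pow)
    also have "\<dots> = (\<Sum>l\<le>i. (z ^ l / fact l * (fact i / fact k)) *s (T ^^ (l + (k - i))) v)"
    proof (rule sum.mono_neutral_right)
      show "\<forall>l\<in>{..<K} - {..i}. (z ^ l / fact l * (fact i / fact k)) *s (T ^^ (l + (k - i))) v = 0"
      proof
        fix l assume "l \<in> {..<K} - {..i}"
        then have "Suc k \<le> l + (k - i)" using i by auto
        then have "(T ^^ (l + (k - i))) v = 0" by (rule T_pow_vanish[OF v])
        then show "(z ^ l / fact l * (fact i / fact k)) *s (T ^^ (l + (k - i))) v = 0" by simp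
      qed
    qed (use i K in auto)
    also have "\<dots> = (\<Sum>a\<le>i. (of_nat (i choose a) * z ^ (i - a) * fact a / fact k) *s (T ^^ (k - a)) v)"
    proof (rule sum.reindex_bij_witness[of _ "\<lambda>a. i - a" "\<lambda>a. i - a"])
      fix l assume l: "l \<in> {..i}"
      have "z ^ l / fact l * (fact i / fact k) =
          of_nat (i choose (i - l)) * z ^ (i - (i - l)) * fact (i - l) / (fact k :: complex)"
        using l by (simp add: binomial_fact[of "i - l" i])
      moreover have "l + (k - i) = k - (i - l)" using l i by auto
      ultimately show "(of_nat (i choose (i - l)) * z ^ (i - (i - l)) * fact (i - l) / fact k) *s
          (T ^^ (k - (i - l))) v = (z ^ l / fact l * (fact i / fact k)) *s (T ^^ (l + (k - i))) v" by metis
    qed auto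
    also have "\<dots> = string_map v k ([:z, 1:] ^ i)"
      unfolding string_map_def coeff_linear_pow
      by (rule sum.mono_neutral_cong_left) (use i in auto)
    finally show ?thesis .
  qed
  have E_sum: "?E (\<Sum>i\<in>A. c i *s x i) = (\<Sum>i\<in>A. c i *s ?E (x i))" for A :: "nat set" and c x
    unfolding T_pow_sum T_pow_scale vec.scale_sum_right vec.scale_scale
    by (subst sum.swap) (simp add: mult.commute)
  have f_eq: "f = (\<Sum>i\<le>k. smult (coeff f i) (monom 1 i))"
    using poly_as_sum_of_monoms'[OF f] by (simp add: smult_monom)
  have "?E (string_map v k f) = ?E (\<Sum>i\<le>k. coeff f i *s string_map v k (monom 1 i))"
    by (subst f_eq) (simp only: string_map_sum string_map_smult)
  also have "\<dots> = (\<Sum>i\<le>k. coeff f i *s string_map v k ([:z, 1:] ^ i))"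
    unfolding E_sum using monom by simp
  also have "\<dots> = string_map v k (\<Sum>i\<le>k. smult (coeff f i) ([:z, 1:] ^ i))"
    by (simp only: string_map_sum string_map_smult)
  also have "(\<Sum>i\<le>k. smult (coeff f i) ([:z, 1:] ^ i)) = pcompose f [:z, 1:]"
    by (subst (2) f_eq) (simp add: pcompose_sum pcompose_smult pcompose_monom)
  finally show ?thesis .
qed

text \<open>In the polynomial model x is a multiple of X^{k-j}. The task is to find polynomials
  divisible by X^j, which represent vectors of F^p, whose translates by z converge to
  X^{k-j}.\<close>

lemma string_approximation:
  assumes nil: "matrix_power N K = 0" and x: "x \<in> strings r s" and s: "s \<le> int n - p"
  shows "\<exists>y. (y \<longlongrightarrow> x) (filtercomap Im at_top) \<and>
    eventually (\<lambda>z. y z \<in> act (matrix_exp (map_matrix (\<lambda>x. z * complex_of_real x) N)) F p)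
      (filtercomap Im at_top)"
proof -
  let ?net = "filtercomap Im at_top"
  let ?E = "\<lambda>z. matrix_exp (map_matrix (\<lambda>x. z * complex_of_real x) N)"
  obtain j k v where v: "x = (T ^^ j) v" "v \<in> I (r + int j) (s + int j)"
    "int k = r + s + 2 * int j - int n" "(T ^^ Suc k) v = 0"
    using x unfolding strings_def by blast
  have zero: "0 \<in> F p" unfolding F_eq by (rule vec.subspace_0[OF subspace_gs])
  show ?thesis
  proof (cases "j \<le> k")
    case False
    then have "x = 0" using T_pow_vanish[OF v(4), of j] v(1) by simp
    moreover have "0 \<in> act (?E z) F p" for z using zero unfolding mem_act
      by (intro bexI[of _ 0]) simp_all
    ultimately show ?thesis by (intro exI[of _ "\<lambda>z. 0"]) auto
  next
    case j: True
    define K' where "K' = max K (Suc k)"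
    have nil': "matrix_power N K' = 0"
    proof -
      have "matrix_power N (K' - K + K) *v w = 0 *v w" for w
        unfolding matrix_power_mult_vec funpow_add comp_def
        unfolding matrix_power_mult_vec[symmetric] using nil by simp
      then have "matrix_power N (K' - K + K) = 0" by (simp add: matrix_eq)
      then show ?thesis by (simp add: K'_def)
    qed
    \<comment> \<open>Translation by z turns X^j (X - z)^{k-j} / z^j into (1 + X/z)^j X^{k-j}, which
      tends to X^{k-j}. The constant \<open>a\<close> below undoes the factor (k-j)!/k! that
      \<open>string_map\<close> attaches to this monomial.\<close>
    define g where "g = (\<lambda>z::complex. smult ((1 / z) ^ j) (monom 1 j * [:- z, 1:] ^ (k - j)))"
    define a where "a = fact k / (fact (k - j) :: complex)"
    define y where "y = (\<lambda>z. a *s string_map v k (pcompose (g z) [:z, 1:]))"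
    have deg: "degree (g z) \<le> k" for z
    proof -
      have "degree (monom (1::complex) j * [:- z, 1:] ^ (k - j)) \<le> degree (monom (1::complex) j) + degree ([:- z, 1:] ^ (k - j))"
        by (rule degree_mult_le)
      also have "\<dots> \<le> j + (k - j)"
        by (intro add_mono degree_monom_le order_trans[OF degree_power_le]) simp
      finally show ?thesis unfolding g_def using j order_trans[OF degree_smult_le] by fastforce
    qed
    have "y z \<in> act (?E z) F p" for z
    proof -
      have "?E z *v (a *s string_map v k (g z)) = y z"
        unfolding y_def vec.scale matrix_exp_nilpotent[OF nil']
        by (subst exp_string_map[OF v(4) _ deg]) (simp_all add: K'_def)
      moreover have "string_map v k (g z) \<in> F p" unfolding string_map_def F_eq
      proof (rule vec.subspace_sum[OF subspace_gs])
        fix i assume i: "i \<in> {..k}"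
        show "(coeff (g z) i * fact i / fact k) *s (T ^^ (k - i)) v \<in> gs (\<lambda>r s. p \<le> r)"
        proof (cases "i < j")
          case True
          then have "coeff (g z) i = 0" unfolding g_def by (simp add: coeff_monom_mult)
          then show ?thesis using vec.subspace_0[OF subspace_gs] by simp
        next
          case False
          have "(T ^^ (k - i)) v \<in> I (r + int j - int (k - i)) (s + int j - int (k - i))"
            by (rule T_pow_I[OF v(2)])
          \<comment> \<open>For i \<ge> j the first index is at least r + 2 j - k = n - s, using the
            value of k.\<close>
          moreover have "p \<le> r + int j - int (k - i)" using False i v(3) s by auto
          ultimately have "(T ^^ (k - i)) v \<in> gs (\<lambda>r s. p \<le> r)"
            using I_subset_gs[of "\<lambda>r s. p \<le> r"] by blast
          then show ?thesis by (rule vec.subspace_scale[OF subspace_gs])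
        qed
      qed
      then have "a *s string_map v k (g z) \<in> F p"
        unfolding F_eq by (rule vec.subspace_scale[OF subspace_gs])
      ultimately show ?thesis unfolding mem_act by metis
    qed
    moreover have "(y \<longlongrightarrow> x) ?net"
    proof -
      define c where "c = (\<lambda>z i. coeff ([:1, 1 / z:] ^ j * monom (1::complex) (k - j)) i)"
      have comp: "pcompose (g z) [:z, 1:] = [:1, 1 / z:] ^ j * monom 1 (k - j)" if "z \<noteq> 0" for z
      proof -
        have lin: "pcompose ([:- z, 1:] ^ i) [:z, 1:] = monom 1 i" for i
          by (simp add: pcompose_power pcompose_pCons monom_altdef)
        have "pcompose (g z) [:z, 1:] = smult ((1 / z) ^ j) ([:z, 1:] ^ j * monom 1 (k - j))"
          unfolding g_def pcompose_smult pcompose_mult pcompose_monom lin by simp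
        also have "\<dots> = (smult (1 / z) [:z, 1:]) ^ j * monom 1 (k - j)"
          by (simp only: smult_power mult_smult_left)
        finally show ?thesis using that by simp
      qed
      have c_eq: "c z i = (if i < k - j then 0 else of_nat (j choose (i - (k - j))) * (1 / z) ^ (i - (k - j)))" for z i
        unfolding c_def
          by (simp add: mult.commute[of _ "monom _ _"] coeff_monom_mult coeff_linear_pow)
      have c_lim: "((\<lambda>z. c z i) \<longlongrightarrow> (if i = k - j then 1 else 0)) ?net" for i
      proof (cases "i < k - j")
        case False
        have "((\<lambda>z. of_nat (j choose (i - (k - j))) * (1 / z) ^ (i - (k - j))) \<longlongrightarrow>
            (of_nat (j choose (i - (k - j))) * 0 ^ (i - (k - j)) :: complex)) ?net"
          by (intro tendsto_intros inverse_tendsto_0_Im_at_top)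
        then show ?thesis using False by (simp add: c_eq power_0_left split: if_splits)
      qed (simp add: c_eq)
      have "((\<lambda>z. a *s (\<Sum>i\<le>k. (c z i * fact i / fact k) *s (T ^^ (k - i)) v)) \<longlongrightarrow>
          a *s (\<Sum>i\<le>k. ((if i = k - j then 1 else 0) * fact i / fact k) *s (T ^^ (k - i)) v)) ?net"
      proof -
        have scale: "((\<lambda>z. u z *s w z) \<longlongrightarrow> u' *s w') ?net" if "(u \<longlongrightarrow> u') ?net" "(w \<longlongrightarrow> w') ?net"
          for u u' and w :: "complex \<Rightarrow> complex^'n" and w'
          using that unfolding vector_scalar_mult_def by (intro tendsto_intros) auto
        show ?thesis by (intro scale tendsto_intros c_lim) auto
      qed
      moreover have "a *s (\<Sum>i\<le>k. ((if i = k - j then 1 else 0) * fact i / fact k) *s (T ^^ (k - i)) v) = x"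
      proof -
        have "(\<Sum>i\<le>k. ((if i = k - j then 1 else 0) * fact i / fact k) *s (T ^^ (k - i)) v) =
            (\<Sum>i\<le>k. if i = k - j then (fact (k - j) / fact k) *s (T ^^ j) v else 0)"
          using j by (intro sum.cong refl) auto
        then show ?thesis using j by (simp add: a_def v(1))
      qed
      ultimately have "((\<lambda>z. a *s (\<Sum>i\<le>k. (c z i * fact i / fact k) *s (T ^^ (k - i)) v)) \<longlongrightarrow> x) ?net"
        by simp
      moreover have "eventually (\<lambda>z. a *s (\<Sum>i\<le>k. (c z i * fact i / fact k) *s (T ^^ (k - i)) v) = y z) ?net"
        using eventually_nonzero_Im_at_top
        by eventually_elim (simp add: y_def comp string_map_def c_def)
      ultimately show ?thesis by (rule Lim_transform_eventually)
    qed
    ultimately show ?thesis by (intro exI[of _ y]) (simp add: always_eventually)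
  qed
qed

text \<open>The reflection (r, s) to (n - s, n - r) preserves dimensions and exchanges s \<le> n - p
  with r \<ge> p.\<close>

lemma dim_gs_snd_le: "vec.dim (gs (\<lambda>r s. s \<le> int n - p)) = vec.dim (F p)"
proof -
  have "(\<Sum>a\<in>{a \<in> types. snd a \<le> int n - p}. vec.dim (I (fst a) (snd a))) =
      (\<Sum>a\<in>{a \<in> types. p \<le> fst a}. vec.dim (I (fst a) (snd a)))"
    by (rule sum.reindex_bij_witness[of _ "\<lambda>a. (int n - snd a, int n - fst a)" "\<lambda>a. (int n - snd a, int n - fst a)"])
      (auto simp: types_reflect dim_I_reflect)
  then show ?thesis unfolding F_eq dim_gs .
qed

end

context polarized_lmhs
begin

text \<open>The approximation of strings gives one inclusion, and equality follows by dimension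
  because all flags of the compact dual have the same dimensions.\<close>

lemma limit_filtration:
  assumes nil: "matrix_power N K = 0" and F: "F \<in> compact_dual Q F\<^sub>o" and L: "L \<in> compact_dual Q F\<^sub>o"
    and lim: "limitin dual_top (\<lambda>z. act (matrix_exp (map_matrix (\<lambda>x. z * complex_of_real x) N)) F) L
        (filtercomap Im at_top)"
  shows "L p = gs (\<lambda>r s. s \<le> int n - p)"
proof -
  have str: "strings r s \<subseteq> L p" if "s \<le> int n - p" for r s
  proof
    fix x assume "x \<in> strings r s"
    from string_approximation[OF nil this that] show "x \<in> L p"
      using mem_limit[OF lim L filtercomap_Im_at_top_neq_bot] by blast
  qed
  have "I r s \<subseteq> L p" if "s \<le> int n - p" for r s
    using primitive_decomposition vec.span_minimal[OF str[OF that] dual_subspace[OF L]] by blast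
  then have "gs (\<lambda>r s. s \<le> int n - p) \<subseteq> L p"
    unfolding graded_sum_def by (intro vec.span_minimal dual_subspace[OF L]) blast
  moreover have "vec.dim (L p) = vec.dim (gs (\<lambda>r s. s \<le> int n - p))"
    unfolding dim_gs_snd_le dual_dim[OF L] dual_dim[OF F] ..
  ultimately show ?thesis
    by (intro vec.subspace_dim_equal[symmetric] subspace_gs dual_subspace[OF L]) auto
qed

end

section \<open>Hyperbolic pairs and the closed orbit\<close>

context polarized_hodge
begin

text \<open>If a real hyperbolic pair \<open>(v, w)\<close> is orthogonal to \<open>R = L\<^sup>p \<inter> cnj L\<^sup>p\<close> but \<open>w\<close> is not orthogonal
  to \<open>L\<^sup>p\<close>, then the real one-parameter group \<open>v \<mapsto> t v, w \<mapsto> t\<^sup>-\<^sup>1 w\<close> moves \<open>L\<close> to a limit \<open>M\<close> for which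
  \<open>M\<^sup>p \<inter> cnj M\<^sup>p\<close> contains \<open>v\<close> in addition to \<open>R\<close>; so the orbit of \<open>L\<close> is not closed.\<close>

lemma closed_orbit_no_hyperbolic_pair:
  assumes Z: "closed_orbit Q F\<^sub>o Z" "L \<in> Z" "L \<in> compact_dual Q F\<^sub>o"
    and p: "2 * p > int n"
    and vw: "Q v v = 0" "Q w w = 0" "Q v w = 1"
    and x: "x \<in> L p" "B x (cvec w) = 1"
    and R: "\<And>y. y \<in> L p \<Longrightarrow> vec_cnj y \<in> L p \<Longrightarrow> B y (cvec v) = 0 \<and> B y (cvec w) = 0"
    and step: "\<And>y. y \<in> L (p + 1) \<Longrightarrow> vec_cnj y \<in> L p"
  shows False
proof -
  define cv cw where "cv = cvec v" and "cw = cvec w"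
  define s where "s = (-1 :: complex) ^ n"
  have ss: "s * s = 1" unfolding s_def by (simp flip: power_mult_distrib)
  have sym: "B y z = s * B z y" for y z unfolding s_def by (rule B_sym)
  have Bvv: "B cv cv = 0" and Bww: "B cw cw = 0" and Bvw: "B cv cw = 1"
    unfolding cv_def cw_def using vw by simp_all
  have Bwv: "B cw cv = s" using sym[of cw cv] Bvw by simp
  \<comment> \<open>Decomposes x = v + e + c w with e orthogonal to the hyperbolic plane; the
    coefficient of v is 1 by normalization of x. Isotropy of x becomes the relation
    \<open>ee\<close>, valid for both parities through the sign \<open>s\<close>.\<close>
  define c where "c = B cv x"
  define e where "e = x - cv - c *s cw"
  have xw: "B x cw = 1" using x(2) by (simp add: cw_def)
  have ew: "B e cw = 0" by (simp add: e_def xw Bvw Bww)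
  have we: "B cw e = 0" using ew B_sym_0 by blast
  have ve: "B cv e = 0" by (simp add: e_def Bvv Bvw c_def)
  have ev: "B e cv = 0" using ve B_sym_0 by blast
  have x_eq: "x = cv + e + c *s cw" by (simp add: e_def)
  have Lp_iso: "B y z = 0" if "y \<in> L p" "z \<in> L p" for y z
  proof -
    have "L p \<subseteq> L (int n - p + 1)" using p by (intro dual_antimono[OF Z(3)]) simp
    then show ?thesis using that dual_perp[OF Z(3), of y p] by blast
  qed
  have ee: "B e e + c + s * c = 0"
    using Lp_iso[OF x(1) x(1)]
      by (subst (asm) (1 2) x_eq) (simp add: Bvv Bww Bvw Bwv ew we ve ev algebra_simps)
  \<comment> \<open>\<open>U\<close> is a unipotent path of Eichler transvections: it fixes w, sends
    v to v + t e + t^2 c w, and is isometric exactly because of \<open>ee\<close>. At t = 1 it sends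
    v to x.\<close>
  define A1 where "A1 = matrix (\<lambda>y. B y cw *s e - (s * B y e) *s cw)"
  define A2 where "A2 = matrix (\<lambda>y. (c * B y cw) *s cw)"
  define U where "U = (\<lambda>t::real. mat 1 + t *\<^sub>R A1 + t\<^sup>2 *\<^sub>R A2)"
  have A1: "A1 *v y = B y cw *s e - (s * B y e) *s cw" for y unfolding A1_def
    by (rule matrix_complex_linear) (simp_all add: vec_eq_iff algebra_simps)
  have A2: "A2 *v y = (c * B y cw) *s cw" for y unfolding A2_def
    by (rule matrix_complex_linear) (simp_all add: vec_eq_iff algebra_simps)
  have U: "U t *v y = y + (of_real t * B y cw) *s e + (of_real t ^ 2 * c * B y cw - s * of_real t * B y e) *s cw" for t y
    unfolding U_def matrix_vector_mult_add_rdistrib scaleR_matrix_mult_vec A1 A2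
    by (simp add: vec_eq_iff algebra_simps)
  have U_iso: "U t \<in> isometries" for t
  proof -
    have "B (U t *v y) (U t *v z) = B y z + of_real t ^ 2 * B y cw * B z cw * (B e e + c + s * c)"
      for y z
    proof -
      have 1: "B e z = s * B z e" "B cw z = s * B z cw" by (rule sym)+
      have "B (U t *v y) (U t *v z) - (B y z + of_real t ^ 2 * B y cw * B z cw * (B e e + c + s * c)) =
          (1 - s * s) * (of_real t * B y e * B z cw)"
        unfolding U B_add_left B_add_right B_scale_left B_scale_right ew we Bww 1
        by (simp add: algebra_simps power2_eq_square)
      then show ?thesis by (simp add: ss)
    qed
    then show ?thesis unfolding isometries_def by (simp add: ee)
  qed
  have U_cont: "continuous_on S U" for S unfolding U_def by (intro continuous_intros)
  have U_0: "U 0 = mat 1" unfolding U_def by simp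
  have U_group: "U t \<in> complex_group Q" for t
  proof -
    have "range U \<subseteq> connected_component_set isometries (mat 1)"
    proof (rule connected_component_maximal)
      show "mat 1 \<in> range U" using U_0 by (metis rangeI)
      show "connected (range U)" by (intro connected_continuous_image U_cont connected_UNIV)
    qed (use U_iso in blast)
    then show ?thesis unfolding complex_group_eq by blast
  qed
  \<comment> \<open>\<open>G t\<close> is the real dilation with v scaled by t, w by 1/t, and the
    orthogonal complement of the plane fixed; the values t > 0 connect it to the identity.\<close>
  define P1 where "P1 = matrix (\<lambda>y. Q y w *\<^sub>R v)"
  define P2 where "P2 = matrix (\<lambda>y. Q v y *\<^sub>R w)"
  define G where "G = (\<lambda>t::real. mat 1 + (t - 1) *\<^sub>R P1 + (1 / t - 1) *\<^sub>R P2)"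
  have lin: "linear (\<lambda>y. Q y w *\<^sub>R v)" "linear (\<lambda>y. Q v y *\<^sub>R w)"
    by (auto intro!: linearI simp: Q_simps algebra_simps)
  have P1: "P1 *v y = Q y w *\<^sub>R v" and P2: "P2 *v y = Q v y *\<^sub>R w" for y
    unfolding P1_def P2_def
      by (rule fun_cong[OF matrix_vector_mul(2)[OF lin(1)]] fun_cong[OF matrix_vector_mul(2)[OF lin(2)]])+
  have G: "G t *v y = y + ((t - 1) * Q y w) *\<^sub>R v + ((1 / t - 1) * Q v y) *\<^sub>R w" for t y
    unfolding G_def matrix_vector_mult_add_rdistrib
      by (simp add: P1 P2 flip: scaleR_matrix_vector_assoc)
  have G_iso: "G t \<in> real_isometries" if t: "t > 0" for t
  proof -
    define r where "r = (-1 :: real) ^ n"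
    have "Q (G t *v y) (G t *v z) = Q y z" for y z
    proof -
      have 1: "Q y v = r * Q v y" "Q w z = r * Q z w" "Q w v = r"
        unfolding r_def using Q_sym[of y v] Q_sym[of w z] Q_sym[of w v] vw(3) by simp_all
      define d where "d = 1 / t - 1"
      have "Q (G t *v y) (G t *v z) - Q y z =
          (Q y w * Q v z + r * Q z w * Q v y) * ((t - 1) + d + (t - 1) * d)"
        unfolding G d_def[symmetric] by (simp add: Q_simps 1 vw algebra_simps)
      also have "(t - 1) + d + (t - 1) * d = 0" unfolding d_def using t by (simp add: field_simps)
      finally show ?thesis by simp
    qed
    then show ?thesis unfolding real_isometries_def by blast
  qed
  have G_group: "G t \<in> real_group Q" if t: "t > 0" for t
  proof -
    have "G ` {0<..} \<subseteq> connected_component_set real_isometries (mat 1)"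
    proof (rule connected_component_maximal)
      show "mat 1 \<in> G ` {0<..}" by (rule image_eqI[of _ _ 1]) (simp_all add: G_def)
      have "continuous_on {0<..} G" unfolding G_def by (intro continuous_intros) auto
      then show "connected (G ` {0<..})" by (intro connected_continuous_image convex_connected) auto
    qed (use G_iso in auto)
    then show ?thesis unfolding real_group_eq using t by auto
  qed
  have Gc: "complex_matrix (G t) *v y = y + ((of_real t - 1) * B y cw) *s cv + ((1 / of_real t - 1) * B cv y) *s cw" for t y
  proof -
    have *: "complex_of_real t - 1 = of_real (t - 1)" "1 / complex_of_real t - 1 = of_real (1 / t - 1)" by simp_all
    have 1: "Re (B y cw) = Q (vec_Re y) w" "Im (B y cw) = Q (vec_Im y) w"
      "Re (B cv y) = Q v (vec_Re y)" "Im (B cv y) = Q v (vec_Im y)"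
      unfolding cv_def cw_def by (simp_all add: complex_form_def Q_simps)
    show ?thesis unfolding * vec_eq_iff_Re_Im complex_matrix_mult_Re complex_matrix_mult_Im G
      by (simp add: vec_Re_scale vec_Im_scale 1 cv_def cw_def del: of_real_diff of_real_divide)
        (simp add: 1[unfolded cv_def cw_def] del: of_real_diff of_real_divide)
  qed
  \<comment> \<open>Conjugation by the dilation rescales the unipotent parameter: \<open>U 1\<close>
    becomes \<open>U (1 / t)\<close>.\<close>
  have GU: "complex_matrix (G t) ** U 1 = U (1 / t) ** complex_matrix (G t)" if t: "t > 0" for t
  proof -
    have "complex_matrix (G t) *v (U 1 *v y) = U (1 / t) *v (complex_matrix (G t) *v y)" for y
    proof -
      define a b d where "a = B y cw" and "b = B cv y" and "d = B y e"
      have t0: "complex_of_real t \<noteq> 0" using t by simp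
      have 1: "B (U 1 *v y) cw = a" unfolding U by (simp add: ew Bww a_def)
      have 2: "B cv (U 1 *v y) = b + (c * a - s * d)" unfolding U
        by (simp add: ve Bvw a_def b_def d_def)
      have 3: "B (complex_matrix (G t) *v y) cw = of_real t * a"
        unfolding Gc by (simp add: Bvw Bww a_def algebra_simps)
      have 4: "B (complex_matrix (G t) *v y) e = d" unfolding Gc by (simp add: ve we d_def)
      show ?thesis
        unfolding Gc[of t "U 1 *v y"] U[of "1 / t" "complex_matrix (G t) *v y"] 1 2 3 4
        unfolding U[of 1 y] Gc[of t y] a_def[symmetric] b_def[symmetric] d_def[symmetric]
        using t0 by (simp add: vec_eq_iff) (simp add: field_simps power2_eq_square)
    qed
    then show ?thesis by (simp add: matrix_eq flip: matrix_vector_mul_assoc)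
  qed
  have G_inv: "complex_matrix (G t) *v (complex_matrix (G (1 / t)) *v y) = y" if t: "t > 0" for t y
  proof -
    define a b where "a = B y cw" and "b = B cv y"
    have t0: "complex_of_real t \<noteq> 0" using t by simp
    have 1: "B (complex_matrix (G (1 / t)) *v y) cw = a / of_real t"
      unfolding Gc using t0 by (simp add: Bvw Bww a_def field_simps)
    have 2: "B cv (complex_matrix (G (1 / t)) *v y) = of_real t * b"
      unfolding Gc using t0 by (simp add: Bvw Bvv b_def field_simps)
    show ?thesis unfolding Gc[of t] 1 2 unfolding Gc[of "1 / t"] a_def[symmetric] b_def[symmetric]
      using t0 by (simp add: vec_eq_iff) (simp add: field_simps)
  qed
  obtain V where V: "V \<in> complex_group Q" "V ** U 1 = mat 1" "U 1 ** V = mat 1"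
    using complex_group_inverse[OF U_group] by blast
  \<comment> \<open>Undoing \<open>U 1\<close> replaces x in L^p by the real vector v in M^p. This
    is the candidate limit, provided the dilation fixes it.\<close>
  define M where "M = act V L"
  have M_dual: "M \<in> compact_dual Q F\<^sub>o" unfolding M_def using dual_act V(1) Z(3) by blast
  have L_eq: "L = act (U 1) M" unfolding M_def act_mult[symmetric] V(3) by simp
  have mem_M: "y \<in> M q \<longleftrightarrow> U 1 *v y \<in> L q" for y q
  proof -
    have "V *v (U 1 *v y) = y" "\<And>y. U 1 *v (V *v y) = y"
      by (simp_all add: matrix_vector_mul_assoc V)
    then show ?thesis unfolding M_def mem_act by metis
  qed
  have U_inj: "y = z" if "U 1 *v y = U 1 *v z" for y z
    using that by (metis V(2) matrix_vector_mul_assoc matrix_vector_mul_lid)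
  have U_fix: "U 1 *v y = y" if y: "y \<in> L p" "vec_cnj y \<in> L p" for y
  proof -
    have "B y cw = 0" "B y cv = 0" using R[OF y] unfolding cv_def cw_def by auto
    moreover from this have "B y e = 0" using Lp_iso[OF y(1) x(1)] unfolding e_def by simp
    ultimately show ?thesis unfolding U by simp
  qed
  \<comment> \<open>By \<open>step\<close>, L^{p+1} lies in R, and \<open>U 1\<close> fixes R
    pointwise; so the part of M above p is orthogonal to both v and w.\<close>
  have M_high: "y \<in> L p \<and> vec_cnj y \<in> L p" if "q > p" "y \<in> M q" for q y
  proof -
    have "U 1 *v y \<in> L (p + 1)"
      using that(2) dual_antimono[OF Z(3), of "p + 1" q] that(1) unfolding mem_M by auto
    then have *: "U 1 *v y \<in> L p" "vec_cnj (U 1 *v y) \<in> L p"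
      using step dual_antimono[OF Z(3), of p "p + 1"] by auto
    then have "U 1 *v (U 1 *v y) = U 1 *v y" by (rule U_fix)
    then have "U 1 *v y = y" by (rule U_inj)
    then show ?thesis using * by simp
  qed
  have cv_M: "cv \<in> M p"
  proof -
    have "U 1 *v cv = x" unfolding U by (simp add: Bvw ve x_eq)
    then show ?thesis using x(1) unfolding mem_M by simp
  qed
  \<comment> \<open>The dilation adds multiples of v and w, with coefficients the pairings of y with
    w and v. Each coefficient vanishes or the vector it multiplies already lies in M^q, by the
    inclusion above p and orthogonality of M^q and M^{n-q+1}.\<close>
  have G_M: "complex_matrix (G t) *v y \<in> M q" if y: "y \<in> M q" and t: "t > 0" for t y q
  proof -
    have *: "a *s cv \<in> M q" if "a = 0 \<or> cv \<in> M q" for a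
      using that vec.subspace_scale[OF dual_subspace[OF M_dual]] vec.subspace_0[OF dual_subspace[OF M_dual]] by auto
    have **: "a *s cw \<in> M q" if "a = 0 \<or> cw \<in> M q" for a
      using that vec.subspace_scale[OF dual_subspace[OF M_dual]] vec.subspace_0[OF dual_subspace[OF M_dual]] by auto
    have "B y cw = 0 \<or> cv \<in> M q"
    proof (cases "q > p")
      case True
      then show ?thesis using R M_high y unfolding cw_def by blast
    next
      case False
      then show ?thesis using cv_M dual_antimono[OF M_dual, of q p] by auto
    qed
    moreover have "B cv y = 0 \<or> cw \<in> M q"
    proof (cases "q > int n - p")
      case True
      show ?thesis
      proof (cases "q > p")
        case True
        then show ?thesis using R M_high y B_sym_0 unfolding cv_def by blast
      next
        case False
        have "cv \<in> M (int n - q + 1)"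
          using cv_M dual_antimono[OF M_dual, of "int n - q + 1" p] \<open>q > int n - p\<close> by auto
        then show ?thesis using dual_perp[OF M_dual, of y q] y B_sym_0 by blast
      qed
    next
      case False
      have "B cw z = 0" if "z \<in> M (int n - q + 1)" for z
      proof -
        have "B z cw = 0" using R M_high[of "int n - q + 1" z] False that unfolding cw_def by auto
        then show ?thesis using B_sym_0 by blast
      qed
      then show ?thesis unfolding dual_perp[OF M_dual, of cw q] by blast
    qed
    ultimately show ?thesis unfolding Gc
      by (intro vec.subspace_add[OF dual_subspace[OF M_dual]] y * **) auto
  qed
  have act_G_M: "act (complex_matrix (G t)) M = M" if t: "t > 0" for t
  proof
    fix q
    show "act (complex_matrix (G t)) M q = M q"
    proof
      show "act (complex_matrix (G t)) M q \<subseteq> M q" using G_M t unfolding act_def by blast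
      show "M q \<subseteq> act (complex_matrix (G t)) M q"
      proof
        fix y assume "y \<in> M q"
        then have "complex_matrix (G (1 / t)) *v y \<in> M q" using G_M t by simp
        then show "y \<in> act (complex_matrix (G t)) M q" unfolding mem_act using G_inv[OF t, of y]
          by metis
      qed
    qed
  qed
  obtain L0 where Z_eq: "Z = real_orbit Q L0" using Z(1) unfolding closed_orbit_def by blast
  have GL: "act (complex_matrix (G t)) L = act (U (1 / t)) M" if t: "t > 0" for t
    unfolding L_eq act_mult[symmetric] GU[OF t] by (simp add: act_mult act_G_M[OF t])
  obtain h where h: "h \<in> complex_group Q" "L = act h F\<^sub>o" using Z(3) unfolding compact_dual_def
    by blast
  \<comment> \<open>Since the dilation fixes M, \<open>G t\<close> sends L to
    \<open>act (U (1 / t)) M\<close>, which stays in the orbit of L and tends to M as t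
    grows.\<close>
  have M_Z: "M \<in> Z"
  proof -
    have "act (V ** h) F\<^sub>o \<in> Z"
    proof (rule closedin_dual_limit)
      show "closedin dual_top Z" using Z(1) unfolding closed_orbit_def by blast
      show "U (1 / real (Suc k)) ** (V ** h) \<in> complex_group Q" for k
        by (intro complex_group_mult U_group V h)
      show "act (U (1 / real (Suc k)) ** (V ** h)) F\<^sub>o \<in> Z" for k
      proof -
        have "act (U (1 / real (Suc k)) ** (V ** h)) F\<^sub>o = act (complex_matrix (G (real (Suc k)))) L"
          using GL[of "real (Suc k)"] by (simp add: act_mult M_def h(2))
        then show ?thesis using real_orbit_closed[OF G_group[of "real (Suc k)"]] Z(2) Z_eq by simp
      qed
      have "isCont (\<lambda>t. U t ** (V ** h)) 0"
        by (rule continuous_on_interior[of UNIV]) (auto intro!: continuous_intros U_cont)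
      moreover have "(\<lambda>k. 1 / real (Suc k)) \<longlonglongrightarrow> 0"
        using LIMSEQ_inverse_real_of_nat by (simp add: inverse_eq_divide)
      ultimately show "(\<lambda>k. U (1 / real (Suc k)) ** (V ** h)) \<longlonglongrightarrow> V ** h"
        using isCont_tendsto_compose[of 0 "\<lambda>t. U t ** (V ** h)"] by (fastforce simp: U_0)
    qed (intro complex_group_mult V h)
    then show ?thesis by (simp add: M_def h(2) act_mult)
  qed
  obtain g where g: "g \<in> real_group Q" "M = act (complex_matrix g) L"
    using real_orbit_connect[of L L0 M] Z(2) M_Z Z_eq by blast
  obtain g' where g': "g' ** g = mat 1" "g ** g' = mat 1" using real_group_inverse[OF g(1)] by metis
  have cg: "complex_matrix g' *v (complex_matrix g *v y) = y" "complex_matrix g *v (complex_matrix g' *v y) = y" for y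
    by (simp_all add: matrix_vector_mul_assoc g' complex_matrix_mat_1 flip: complex_matrix_matrix_mult)
  have mem_M': "y \<in> M p \<longleftrightarrow> complex_matrix g' *v y \<in> L p" for y
    unfolding g(2) mem_act using cg by metis
  \<comment> \<open>The dimension of the intersection of the p-th step with its conjugate is
    constant on a real orbit, yet it would have to grow by v in passing from L to M.\<close>
  define RL where "RL = {y \<in> L p. vec_cnj y \<in> L p}"
  define RM where "RM = {y \<in> M p. vec_cnj y \<in> M p}"
  have RM_eq: "RM = (*v) (complex_matrix g) ` RL"
  proof
    show "RM \<subseteq> (*v) (complex_matrix g) ` RL"
    proof
      fix y assume "y \<in> RM"
      then have "complex_matrix g' *v y \<in> RL"
        unfolding RM_def RL_def mem_M' by (simp add: complex_matrix_mult_cnj)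
      then show "y \<in> (*v) (complex_matrix g) ` RL" using cg(2)[of y] by (metis image_eqI)
    qed
    show "(*v) (complex_matrix g) ` RL \<subseteq> RM"
      unfolding RM_def RL_def mem_M'
        by (auto simp: cg complex_matrix_mult_cnj simp flip: complex_matrix_mult_cnj)
  qed
  have sub: "vec.subspace {y \<in> S. vec_cnj y \<in> S}" if "vec.subspace S" for S :: "(complex^'n) set"
    using that unfolding vec.subspace_def by auto
  have "inj_on ((*v) (complex_matrix g)) (vec.span RL)" by (rule inj_onI) (metis cg(1))
  then have "vec.dim RM = vec.dim RL" unfolding RM_eq
    by (rule vec.dim_image_eq[OF vec.linear_axioms])
  moreover have "RL \<subseteq> RM"
  proof
    fix y assume y: "y \<in> RL"
    then have "U 1 *v y = y" "U 1 *v vec_cnj y = vec_cnj y" unfolding RL_def by (auto intro: U_fix)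
    then show "y \<in> RM" using y unfolding RL_def RM_def mem_M by simp
  qed
  ultimately have "RL = RM"
    using sub[OF dual_subspace[OF Z(3)], of p] sub[OF dual_subspace[OF M_dual], of p]
    by (intro vec.subspace_dim_equal) (simp_all add: RL_def RM_def)
  moreover have "cv \<in> RM" using cv_M unfolding RM_def cv_def by simp
  ultimately have "B cv cw = 0" using R unfolding RL_def cw_def by blast
  then show False using Bvw by simp
qed

end

section \<open>Consequences of closedness\<close>

text \<open>By minimality of \<open>b\<close> every type with second index below \<open>b\<close> is
  diagonal, so L^{n-b+1} is contained in the conjugate of L^{n-b}. This is the inclusion needed for
  the degeneration to respect the higher steps of the flag.\<close>

locale extremal_lmhs = polarized_lmhs Q n F\<^sub>o N W F I
  for Q :: "real^'n \<Rightarrow> real^'n \<Rightarrow> real" and n :: nat and F\<^sub>o :: "'n filtration"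
    and N :: "real^'n^'n" and W F I +
  fixes L :: "'n filtration" and Z :: "'n filtration set" and a b :: int
  assumes closed: "closed_orbit Q F\<^sub>o Z" and L_Z: "L \<in> Z" and L_dual: "L \<in> compact_dual Q F\<^sub>o"
    and L_eq: "\<And>p. L p = gs (\<lambda>r s. s \<le> int n - p)"
    and ab: "(a, b) \<in> types" "a \<noteq> b"
    and b_min: "\<And>r s. (r, s) \<in> types \<Longrightarrow> r \<noteq> s \<Longrightarrow> b \<le> s"
begin

definition R :: "(complex^'n) set" where "R = gs (\<lambda>r s. r \<le> b \<and> s \<le> b)"

text \<open>Only the real points of the orthogonal complement of R are recorded; as R is stable
  under conjugation, they span it over the complex numbers.\<close>

definition perp :: "(real^'n) set" where "perp = {y. \<forall>z\<in>R. B z (cvec y) = 0}"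

lemma b_min_fst: "(r, s) \<in> types \<Longrightarrow> r \<noteq> s \<Longrightarrow> b \<le> r"
  using b_min types_cnj by blast

lemma a_gt_b: "b < a"
  using b_min_fst[OF ab] ab(2) by simp

text \<open>The reflected type (n - b, n - a) is also off the diagonal, so b \<le> n - a < n -
  b.\<close>

lemma two_b_less: "2 * b < int n"
  using b_min_fst[of "int n - b" "int n - a"] b_min[of "int n - b" "int n - a"] ab a_gt_b
  by (auto simp: types_reflect)

lemma L_top: "L (int n - b) = gs (\<lambda>r s. s \<le> b)"
  unfolding L_eq by simp

lemma mem_R: "y \<in> R \<longleftrightarrow> y \<in> L (int n - b) \<and> vec_cnj y \<in> L (int n - b)"
proof -
  have "R = gs (\<lambda>r s. r \<le> b) \<inter> gs (\<lambda>r s. s \<le> b)" unfolding R_def gs_Int ..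
  moreover have "y \<in> gs (\<lambda>r s. r \<le> b) \<longleftrightarrow> vec_cnj y \<in> gs (\<lambda>r s. s \<le> b)"
    using cnj_fst_le[of y b] cnj_snd_le[of "vec_cnj y" b] by auto
  ultimately show ?thesis unfolding L_top by blast
qed

lemma subspace_R: "vec.subspace R" and R_cnj: "y \<in> R \<Longrightarrow> vec_cnj y \<in> R"
  by (simp_all add: R_def[symmetric] mem_R) (simp add: R_def subspace_gs)

lemma L_isotropic: "y \<in> L (int n - b) \<Longrightarrow> z \<in> L (int n - b) \<Longrightarrow> B y z = 0"
proof -
  assume yz: "y \<in> L (int n - b)" "z \<in> L (int n - b)"
  have "L (int n - b) \<subseteq> L (int n - (int n - b) + 1)"
    using two_b_less by (intro dual_antimono[OF L_dual]) simp
  then show ?thesis using yz dual_perp[OF L_dual, of y "int n - b"] by blast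
qed

lemma perp_Re_Im:
  assumes "\<And>z. z \<in> R \<Longrightarrow> B z t = 0"
  shows "vec_Re t \<in> perp" "vec_Im t \<in> perp"
proof -
  have "B z (vec_cnj t) = 0" if "z \<in> R" for z
    using assms[OF R_cnj[OF that]] B_cnj[of "vec_cnj z" t] by simp
  then show "vec_Re t \<in> perp" "vec_Im t \<in> perp"
    using assms by (simp_all add: perp_def cvec_vec_Re cvec_vec_Im)
qed

lemma perp_scale: "x \<in> perp \<Longrightarrow> c *\<^sub>R x \<in> perp"
  unfolding perp_def by simp

lemma perp_add: "x \<in> perp \<Longrightarrow> y \<in> perp \<Longrightarrow> x + y \<in> perp"
  unfolding perp_def by simp

text \<open>R is the intersection of L^{n-b} and its conjugate, each of which is cut out by an
  orthogonal step of the flag. A vector outside R is detected by that step or its conjugate, hence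
  by a real or imaginary part.\<close>

lemma separate_R:
  assumes "u \<notin> R"
  obtains w where "w \<in> perp" "B u (cvec w) \<noteq> 0"
proof -
  have "\<exists>t\<in>L (int n - (int n - b) + 1). B u t \<noteq> 0 \<or> B u (vec_cnj t) \<noteq> 0"
  proof -
    consider "u \<notin> L (int n - b)" | "vec_cnj u \<notin> L (int n - b)" using assms mem_R by blast
    then show ?thesis
    proof cases
      case 1
      then show ?thesis unfolding dual_perp[OF L_dual, of u "int n - b"] by blast
    next
      case 2
      then obtain t where "t \<in> L (int n - (int n - b) + 1)" "B (vec_cnj u) t \<noteq> 0"
        unfolding dual_perp[OF L_dual, of "vec_cnj u" "int n - b"] by blast
      then show ?thesis using B_cnj[of u "vec_cnj t"] by (intro bexI[of _ t]) auto
    qed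
  qed
  then obtain t where t: "t \<in> L (int n - (int n - b) + 1)" "B u t \<noteq> 0 \<or> B u (vec_cnj t) \<noteq> 0"
    by blast
  have "B z t = 0" if "z \<in> R" for z
    using that t(1) dual_perp[OF L_dual, of z "int n - b"] unfolding mem_R by blast
  then have perp: "vec_Re t \<in> perp" "vec_Im t \<in> perp" using perp_Re_Im by blast+
  have t_eq: "t = cvec (vec_Re t) + \<i> *s cvec (vec_Im t)" by (rule vec_Re_Im)
  then have "vec_cnj t = vec_cnj (cvec (vec_Re t) + \<i> *s cvec (vec_Im t))" by (rule arg_cong)
  then have t_eq': "vec_cnj t = cvec (vec_Re t) - \<i> *s cvec (vec_Im t)"
    by (simp add: vec.scale_minus_left)
  have "B u (cvec (vec_Re t)) \<noteq> 0 \<or> B u (cvec (vec_Im t)) \<noteq> 0"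
    using t(2) arg_cong[OF t_eq, of "B u"] arg_cong[OF t_eq', of "B u"] by auto
  then show ?thesis using that perp by blast
qed

lemma B_cvec_right: "B x (cvec w) = Complex (Q (vec_Re x) w) (Q (vec_Im x) w)"
  by (simp add: complex_form_def Q_simps)

text \<open>An isotropic w pairing with x could be completed to a hyperbolic pair inside the
  orthogonal complement of R, using the real or imaginary part of x as second vector.\<close>

lemma no_isotropic:
  assumes w: "w \<in> perp" "Q w w = 0" and x: "x \<in> L (int n - b)"
  shows "B x (cvec w) = 0"
proof (rule ccontr)
  assume nz: "B x (cvec w) \<noteq> 0"
  have "B z x = 0" if "z \<in> R" for z using that x L_isotropic unfolding mem_R by blast
  then have "vec_Re x \<in> perp" "vec_Im x \<in> perp" using perp_Re_Im by blast+
  moreover have "Q (vec_Re x) w \<noteq> 0 \<or> Q (vec_Im x) w \<noteq> 0"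
    using nz unfolding B_cvec_right by (auto simp: complex_eq_iff)
  ultimately obtain v1 where v1: "v1 \<in> perp" "Q v1 w \<noteq> 0" by blast
  define v0 where "v0 = (1 / Q v1 w) *\<^sub>R v1"
  have v0: "v0 \<in> perp" "Q v0 w = 1" using v1 perp_scale unfolding v0_def by (auto simp: Q_simps)
  define v where "v = v0 + (- (Q v0 v0 / 2)) *\<^sub>R w"
  have v: "v \<in> perp" unfolding v_def using v0(1) w(1) perp_add perp_scale by blast
  have vv: "Q v v = 0"
  proof (cases "even n")
    case True
    then have "Q w v0 = 1" using Q_sym[of w v0] v0(2) by simp
    then show ?thesis unfolding v_def using v0 w by (simp add: Q_simps)
  next
    case False
    then show ?thesis using Q_sym[of v v] by simp
  qed
  have vw: "Q v w = 1" unfolding v_def using v0 w by (simp add: Q_simps)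
  show False
  proof (rule closed_orbit_no_hyperbolic_pair[OF closed L_Z L_dual _ vv w(2) vw])
    show "2 * (int n - b) > int n" using two_b_less by simp
    show "(1 / B x (cvec w)) *s x \<in> L (int n - b)"
      using x vec.subspace_scale[OF dual_subspace[OF L_dual]] by blast
    show "B ((1 / B x (cvec w)) *s x) (cvec w) = 1" using nz by simp
    show "B y (cvec v) = 0 \<and> B y (cvec w) = 0"
      if "y \<in> L (int n - b)" "vec_cnj y \<in> L (int n - b)" for y
    proof -
      have "y \<in> R" using that mem_R by blast
      then show ?thesis using v w(1) unfolding perp_def by blast
    qed
    show "vec_cnj y \<in> L (int n - b)" if y: "y \<in> L (int n - b + 1)" for y
    proof -
      have "y \<in> gs (\<lambda>r s. s \<le> b - 1)" using y unfolding L_eq by (simp add: algebra_simps)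
      then have "y \<in> gs (\<lambda>r s. r \<le> b)" unfolding mem_gs using b_min cp_types by fastforce
      then show ?thesis unfolding L_top by (rule cnj_fst_le)
    qed
  qed
qed

lemma exists_x:
  obtains x where "x \<in> L (int n - b)" "x \<notin> R"
proof -
  obtain x where x: "x \<in> I a b" "x \<noteq> 0" using ab(1) unfolding mem_types by blast
  have "x \<in> L (int n - b)" unfolding L_top using I_subset_gs[of "\<lambda>r s. s \<le> b" a b] x(1) by auto
  moreover have "x \<notin> R"
  proof
    assume "x \<in> R"
    moreover have "cp a b x \<noteq> 0" using x cp_of_I[OF x(1), of a b] by simp
    ultimately have "a \<le> b" unfolding R_def mem_gs by blast
    then show False using a_gt_b by simp
  qed
  ultimately show ?thesis using that by blast
qed

text \<open>For odd n every real vector is isotropic, so \<open>no_isotropic\<close> would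
  contradict separation of an off-diagonal x from R.\<close>

lemma even_n: "even n"
proof (rule ccontr)
  assume odd: "odd n"
  obtain x where x: "x \<in> L (int n - b)" "x \<notin> R" by (rule exists_x)
  obtain w where w: "w \<in> perp" "B x (cvec w) \<noteq> 0" using separate_R[OF x(2)] by blast
  have "Q w w = 0" using Q_sym[of w w] odd by simp
  then show False using no_isotropic[OF w(1) _ x(1)] w(2) by simp
qed

lemma Q_commute: "Q x y = Q y x"
  using Q_sym[of x y] even_n by simp

text \<open>The real and imaginary parts of x span a definite plane, and its sign e is the only one
  possible: a vector of the wrong sign or an isotropic one outside R would combine with the plane to
  an isotropic vector not orthogonal to x.\<close>

lemma definite_perp:
  "\<exists>e::real. (e = 1 \<or> e = -1) \<and> (\<forall>y\<in>perp. cvec y \<notin> R \<longrightarrow> e * Q y y > 0)"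
proof -
  obtain x where x: "x \<in> L (int n - b)" "x \<notin> R" by (rule exists_x)
  define x1 x2 where "x1 = vec_Re x" and "x2 = vec_Im x"
  have x_eq: "x = cvec x1 + \<i> *s cvec x2" unfolding x1_def x2_def by (rule vec_Re_Im)
  have "B z x = 0" if "z \<in> R" for z using that x L_isotropic unfolding mem_R by blast
  then have xp: "x1 \<in> perp" "x2 \<in> perp" unfolding x1_def x2_def using perp_Re_Im by blast+
  define c where "c = Q x1 x1"
  have "B x x = 0" using L_isotropic x(1) by blast
  then have c2: "Q x2 x2 = c" and x12: "Q x1 x2 = 0"
    using Q_commute[of x1 x2] unfolding complex_form_def x1_def[symmetric] x2_def[symmetric]
    by (auto simp: complex_eq_iff c_def)
  have x21: "Q x2 x1 = 0" using x12 Q_commute[of x1 x2] by simp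
  have no: "Q w w \<noteq> 0" if "w \<in> perp" "Q x1 w \<noteq> 0 \<or> Q x2 w \<noteq> 0" for w
  proof
    assume "Q w w = 0"
    then have "B x (cvec w) = 0" using no_isotropic that(1) x(1) by blast
    then show False using that(2) unfolding B_cvec_right x1_def x2_def
      by (auto simp: complex_eq_iff)
  qed
  have separate: "\<exists>z\<in>perp. Q y z = 1" if y: "cvec y \<notin> R" for y
  proof -
    obtain w where w: "w \<in> perp" "B (cvec y) (cvec w) \<noteq> 0" using separate_R[OF y] by blast
    then have "Q y ((1 / Q y w) *\<^sub>R w) = 1" by (simp add: Q_simps)
    then show ?thesis using w(1) perp_scale by blast
  qed
  have c0: "c \<noteq> 0"
  proof
    \<comment> \<open>Here one of \<open>x1\<close>, \<open>x2\<close> is isotropic and outside R. A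
      partner z with pairing 1, corrected by half its square, is then isotropic and pairs with it to
      1.\<close>
    assume c0: "c = 0"
    have "cvec x1 \<notin> R \<or> cvec x2 \<notin> R"
      using x(2) vec.subspace_add[OF subspace_R] vec.subspace_scale[OF subspace_R] unfolding x_eq
        by blast
    then obtain x3 where x3: "x3 = x1 \<or> x3 = x2" "cvec x3 \<notin> R" by blast
    then have q3: "Q x3 x3 = 0" "x3 \<in> perp" using c0 c2 xp by (auto simp: c_def)
    obtain z where z: "z \<in> perp" "Q x3 z = 1" using separate[OF x3(2)] by blast
    define w where "w = z + (- (Q z z / 2)) *\<^sub>R x3"
    have "w \<in> perp" unfolding w_def using z(1) q3(2) perp_add perp_scale by blast
    moreover have "Q w w = 0" unfolding w_def using q3 z Q_commute[of z x3] by (simp add: Q_simps)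
    moreover have "Q x3 w = 1" unfolding w_def using q3 z by (simp add: Q_simps)
    ultimately show False using no x3(1) by (metis zero_neq_one)
  qed
  define e where "e = sgn c"
  have ec: "e * c > 0" using c0 unfolding e_def by (simp add: sgn_if)
  have ee: "e = 1 \<or> e = -1" using c0 unfolding e_def by (auto simp: sgn_if)
  have "e * Q y y > 0" if y: "y \<in> perp" "cvec y \<notin> R" for y
  proof (rule ccontr)
    assume neg: "\<not> ?thesis"
    define p q where "p = Q x1 y / c" and "q = Q x2 y / c"
    have pq: "Q x1 y = p * c" "Q y x1 = p * c" "Q x2 y = q * c" "Q y x2 = q * c"
      using c0 Q_commute[of y] unfolding p_def q_def by simp_all
    \<comment> \<open>The component of y orthogonal to the plane of \<open>x1\<close> and
      \<open>x2\<close>.\<close>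
    define y0 where "y0 = y + (- p) *\<^sub>R x1 + (- q) *\<^sub>R x2"
    have y0: "y0 \<in> perp" unfolding y0_def using y(1) xp by (intro perp_add perp_scale)
    have q0: "Q y0 y0 = Q y y - (p\<^sup>2 + q\<^sup>2) * c"
      unfolding y0_def
        by (simp add: Q_simps pq x12 x21 c2 c_def[symmetric] algebra_simps power2_eq_square)
    have y01: "Q x1 y0 = 0" "Q y0 x1 = 0"
      unfolding y0_def by (simp_all add: Q_simps pq x12 x21 c_def[symmetric])
    have e0: "e * Q y0 y0 = e * Q y y - (p\<^sup>2 + q\<^sup>2) * (e * c)" unfolding q0
      by (simp add: algebra_simps)
    have pqe: "(p\<^sup>2 + q\<^sup>2) * (e * c) \<ge> 0" using ec by simp
    have "Q y0 y0 = 0"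
    proof (rule ccontr)
      assume nz: "Q y0 y0 \<noteq> 0"
      then have "e * Q y0 y0 < 0" using e0 neg pqe ee by auto
      then have pos: "- Q y0 y0 / c > 0" using ec ee by (auto simp: divide_neg_pos divide_pos_neg)
      \<comment> \<open>If \<open>y0\<close> has the sign opposite to c, this length makes the
        square of s \<open>x1\<close> cancel that of \<open>y0\<close>.\<close>
      define s where "s = sqrt (- Q y0 y0 / c)"
      have s: "s\<^sup>2 * c = - Q y0 y0" "s \<noteq> 0" using pos c0 nz unfolding s_def by simp_all
      define w where "w = y0 + s *\<^sub>R x1"
      have "w \<in> perp" unfolding w_def using y0 xp by (intro perp_add perp_scale)
      moreover have "Q x1 w \<noteq> 0" unfolding w_def using s c0
        by (simp add: Q_simps y01 c_def[symmetric])
      moreover have "Q w w = Q y0 y0 + s\<^sup>2 * c"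
        unfolding w_def by (simp add: Q_simps y01 c_def[symmetric] power2_eq_square)
      then have "Q w w = 0" using s by simp
      ultimately show False using no by blast
    qed
    then have "e * Q y y = (p\<^sup>2 + q\<^sup>2) * (e * c)" using e0 by simp
    then have "(p\<^sup>2 + q\<^sup>2) * (e * c) = 0" and Qyy: "Q y y = 0" using neg pqe ee by auto
    then have "p = 0" "q = 0" using ec by (auto simp: sum_power2_eq_zero_iff)
    then have x1y: "Q x1 y = 0" "Q y x1 = 0" using pq by simp_all
    obtain z where z: "z \<in> perp" "Q y z = 1" using separate[OF y(2)] by blast
    have zy: "Q z y = 1" using z(2) Q_commute[of z y] by simp
    \<comment> \<open>Now y is isotropic and orthogonal to the plane. The choice of d keeps the
      pairing of w with \<open>x1\<close> nonzero, and f then uses the pairing of z with y to make w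
      isotropic.\<close>
    define d where "d = (if Q x1 z = 0 then 1 else (0::real))"
    define f where "f = - (d\<^sup>2 * c + 2 * d * Q x1 z + Q z z) / 2"
    define w where "w = d *\<^sub>R x1 + z + f *\<^sub>R y"
    have "w \<in> perp" unfolding w_def using y z xp by (intro perp_add perp_scale)
    moreover have "Q x1 w \<noteq> 0" unfolding w_def d_def using c0
      by (simp add: Q_simps x1y c_def[symmetric])
    moreover have "Q w w = d\<^sup>2 * c + 2 * d * Q x1 z + Q z z + 2 * f"
      unfolding w_def using Q_commute[of z x1]
      by (simp add: Q_simps x1y z zy Qyy c_def[symmetric] power2_eq_square algebra_simps)
    moreover have "2 * f = - (d\<^sup>2 * c + 2 * d * Q x1 z + Q z z)" unfolding f_def by simp
    ultimately have "w \<in> perp" "Q x1 w \<noteq> 0" "Q w w = 0" by simp_all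
    then show False using no by blast
  qed
  then show ?thesis using ee by blast
qed

lemma R_subset: "R \<subseteq> complexify (W (2 * b))"
  unfolding R_def Wc_eq by (rule gs_mono) auto

lemma W_subset_perp: "W (int n) \<subseteq> perp"
proof
  fix y assume "y \<in> W (int n)"
  then have "cvec y \<in> complexify (W (int n))" using subspace_W by simp
  then show "y \<in> perp" unfolding perp_def using B_W R_subset two_b_less by force
qed

text \<open>W_{n-1} is totally isotropic, and it is orthogonal to R because R has weight at most 2 b
  < n. Definiteness outside R leaves no other place for it.\<close>

lemma W_lower: "complexify (W (int n - 1)) \<subseteq> R"
proof -
  obtain e :: real where e: "\<And>y. y \<in> perp \<Longrightarrow> cvec y \<notin> R \<Longrightarrow> e * Q y y > 0"
    using definite_perp by blast
  have "cvec y \<in> R" if y: "y \<in> W (int n - 1)" for y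
  proof (rule ccontr)
    assume "cvec y \<notin> R"
    moreover have "y \<in> perp" using y W_mono[of "int n - 1" "int n"] W_subset_perp by auto
    moreover have "Q y y = 0"
    proof -
      have "cvec y \<in> complexify (W (int n - 1))" using y subspace_W by simp
      then have "B (cvec y) (cvec y) = 0" by (intro B_W) auto
      then show ?thesis by simp
    qed
    ultimately show False using e[of y] by simp
  qed
  then have "v \<in> R" if "v \<in> complexify (W (int n - 1))" for v
    using that vec.subspace_add[OF subspace_R] vec.subspace_scale[OF subspace_R] vec_Re_Im[of v]
    unfolding complexify_def by (metis (mono_tags, lifting) mem_Collect_eq)
  then show ?thesis by blast
qed

text \<open>A type occurring in R has both indices at most b, whereas both indices of an
  off-diagonal type are at least b.\<close>

lemma types_lower:
  assumes "(r, s) \<in> types" "r + s < int n"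
  shows "r = s" "r \<le> b"
proof -
  obtain u where u: "u \<in> I r s" "u \<noteq> 0" using assms(1) unfolding mem_types by blast
  have "u \<in> complexify (W (int n - 1))"
    unfolding Wc_eq using I_subset_gs[of "\<lambda>p q. p + q \<le> int n - 1" r s] u(1) assms(2) by auto
  then have "u \<in> R" using W_lower by blast
  moreover have "cp r s u \<noteq> 0" using cp_of_I[OF u(1), of r s] u(2) by simp
  ultimately have "r \<le> b \<and> s \<le> b" unfolding R_def mem_gs by blast
  moreover from this show "r \<le> b" by simp
  ultimately show "r = s" using b_min[OF assms(1)] b_min_fst[OF assms(1)] by fastforce
qed

lemma types_off_diagonal: "(r, s) \<in> types \<Longrightarrow> r \<noteq> s \<Longrightarrow> r + s = int n"
  using types_lower(1)[of r s] types_lower(1)[of "int n - s" "int n - r"] types_reflect[of s r]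
    by fastforce

lemma definite_W:
  "\<exists>e::real. (e = 1 \<or> e = -1) \<and> (\<forall>y\<in>W (int n) - W (int n - 1). e * Q y y > 0)"
proof -
  obtain e :: real where e: "e = 1 \<or> e = -1" "\<And>y. y \<in> perp \<Longrightarrow> cvec y \<notin> R \<Longrightarrow> e * Q y y > 0"
    using definite_perp by blast
  have "e * Q y y > 0" if y: "y \<in> W (int n) - W (int n - 1)" for y
  proof (rule e(2))
    show "y \<in> perp" using y W_subset_perp by blast
    show "cvec y \<notin> R"
    proof
      assume "cvec y \<in> R"
      then have "y \<in> W (2 * b)" using R_subset subspace_W by auto
      then show False using y W_mono[of "2 * b" "int n - 1"] two_b_less by auto
    qed
  qed
  then show ?thesis using e(1) by blast
qed

end

section \<open>The signature of the polarization\<close>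

lemma (in bigraded) dim_gs_fst:
  assumes "finite A" "fst ` types \<subseteq> A"
  shows "vec.dim (gs (\<lambda>p q. P p)) = (\<Sum>r\<in>{r \<in> A. P r}. vec.dim (gs (\<lambda>p q. p = r)))"
proof -
  let ?S = "{a \<in> types. P (fst a)}"
  have "vec.dim (gs (\<lambda>p q. P p)) = (\<Sum>a\<in>?S. vec.dim (I (fst a) (snd a)))"
    unfolding dim_gs by simp
  also have "\<dots> = (\<Sum>r\<in>{r \<in> A. P r}. \<Sum>a\<in>{a \<in> ?S. fst a = r}. vec.dim (I (fst a) (snd a)))"
    by (rule sum.group[symmetric]) (use assms finite_types in auto)
  also have "\<dots> = (\<Sum>r\<in>{r \<in> A. P r}. vec.dim (gs (\<lambda>p q. p = r)))"
    unfolding dim_gs by (intro sum.cong) auto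
  finally show ?thesis .
qed

lemma (in bigraded) dim_gs_fst_step:
  "vec.dim (gs (\<lambda>p q. p \<ge> r)) = vec.dim (gs (\<lambda>p q. p = r)) + vec.dim (gs (\<lambda>p q. p \<ge> r + 1))"
proof -
  have "gs (\<lambda>p q. p \<ge> r) = gs (\<lambda>p q. p = r \<or> p \<ge> r + 1)" by (rule gs_cong) auto
  then show ?thesis using dim_gs_disj[of "\<lambda>p q. p = r" "\<lambda>p q. p \<ge> r + 1"] by simp
qed

lemma (in bigraded) dim_gs_0:
  assumes "vec.dim (gs P) = 0" "(p, q) \<in> types"
  shows "\<not> P p q"
proof
  assume "P p q"
  obtain u where u: "u \<in> I p q" "u \<noteq> 0" using assms(2) unfolding mem_types by blast
  then have "u \<in> gs P" using I_subset_gs[of P, OF \<open>P p q\<close>] by blast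
  then show False using assms(1) u(2) unfolding vec.dim_eq_0 by blast
qed

text \<open>Equal flag dimensions of \<open>F\<close> and \<open>F\<^sub>o\<close> give equal graded
  dimensions. This transfers the signature of the polarization at \<open>F\<^sub>o\<close> to a
  count in the Deligne splitting.\<close>

lemma (in polarized_lmhs) dim_gs_hodge:
  assumes "F \<in> compact_dual Q F\<^sub>o"
  shows "vec.dim (hodge.gs (\<lambda>p q. P p)) = vec.dim (gs (\<lambda>p q. P p))"
proof -
  have ge: "vec.dim (hodge.gs (\<lambda>p q. p \<ge> r)) = vec.dim (gs (\<lambda>p q. p \<ge> r))" for r
    using dual_dim[OF assms, of r] unfolding Fo_eq[of r] F_eq[of r] by simp
  have eq: "vec.dim (hodge.gs (\<lambda>p q. p = r)) = vec.dim (gs (\<lambda>p q. p = r))" for r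
    using hodge.dim_gs_fst_step[of r] dim_gs_fst_step[of r] ge[of r] ge[of "r + 1"] by simp
  define A where "A = fst ` types \<union> fst ` hodge.types"
  have "finite A" unfolding A_def using finite_types hodge.finite_types by simp
  then show ?thesis
    using hodge.dim_gs_fst[of A P] dim_gs_fst[of A P] eq unfolding A_def by simp
qed

context extremal_lmhs
begin

text \<open>The subspace on which the polarization has the sign opposite to its sign on the middle
  graded piece meets \<open>W\<^sub>n\<close> trivially.\<close>

lemma signature_bound:
  assumes F: "F \<in> compact_dual Q F\<^sub>o" and m: "n = 2 * m"
    and e: "e = 1 \<or> e = (-1::real)" "\<And>y. y \<in> W (int n) - W (int n - 1) \<Longrightarrow> e * Q y y > 0"
  shows "vec.dim (gs (\<lambda>r s. even (r - int m) \<longleftrightarrow> e = -1)) \<le> vec.dim (gs (\<lambda>r s. r + s > int n))"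
proof -
  let ?S = "hodge.gs (\<lambda>p q. even (p - int m) \<longleftrightarrow> - e = 1)" and ?T = "complexify (W (int n))"
  have sub: "vec.subspace ?T" using subspace_complexify subspace_W by blast
  have nonneg: "e * Q y y \<ge> 0" if "y \<in> W (int n)" for y
  proof (cases "y \<in> W (int n - 1)")
    case True
    then have "cvec y \<in> complexify (W (int n - 1))" using subspace_W by simp
    then have "B (cvec y) (cvec y) = 0" by (intro B_W) auto
    then show ?thesis by simp
  next
    case False
    then show ?thesis using e(2)[of y] that by simp
  qed
  have "?S \<inter> ?T = {0}"
  proof -
    have "v = 0" if v: "v \<in> ?S" "v \<in> ?T" for v
    proof (rule ccontr)
      assume "v \<noteq> 0"
      then have "0 < - e * Re (B v (vec_cnj v))"
        by (rule J_definite[OF _ m _ v(1)]) (use e(1) in auto)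
      moreover have "Re (B v (vec_cnj v)) = Q (vec_Re v) (vec_Re v) + Q (vec_Im v) (vec_Im v)"
        by (simp add: complex_form_def Q_simps)
      moreover have "e * Q (vec_Re v) (vec_Re v) \<ge> 0" "e * Q (vec_Im v) (vec_Im v) \<ge> 0"
        using v(2) nonneg unfolding complexify_def by auto
      ultimately show False by (simp add: algebra_simps)
    qed
    then show ?thesis using vec.subspace_0[OF sub] vec.subspace_0[OF hodge.subspace_gs] by blast
  qed
  then have "vec.dim {x + y |x y. x \<in> ?S \<and> y \<in> ?T} = vec.dim ?S + vec.dim ?T"
    using vec.dim_sums_Int[OF hodge.subspace_gs sub, of "\<lambda>p q. even (p - int m) \<longleftrightarrow> - e = 1"] by simp
  moreover have "vec.dim {x + y |x y. x \<in> ?S \<and> y \<in> ?T} \<le> vec.dim (gs (\<lambda>p q. True))"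
    unfolding gs_UNIV by (rule vec.dim_subset) simp
  moreover have "vec.dim (gs (\<lambda>p q. True)) = vec.dim ?T + vec.dim (gs (\<lambda>r s. r + s > int n))"
  proof -
    have "gs (\<lambda>p q. True) = gs (\<lambda>r s. r + s \<le> int n \<or> r + s > int n)" by (rule gs_cong) auto
    then show ?thesis unfolding Wc_eq by (simp add: dim_gs_disj)
  qed
  moreover have "vec.dim ?S = vec.dim (gs (\<lambda>r s. even (r - int m) \<longleftrightarrow> e = -1))"
    unfolding dim_gs_hodge[OF F] by (intro arg_cong[where f = vec.dim] gs_cong) auto
  ultimately show ?thesis by simp
qed

end

section \<open>Period domains of pure parity\<close>

context polarized_hodge
begin

lemma cnj_J: "x \<in> J p q \<longleftrightarrow> vec_cnj x \<in> J q p"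
  unfolding mem_J by (auto simp: add.commute)

lemma B_J:
  assumes "u \<in> J p q" "z \<in> J r s" "p + r \<noteq> int n"
  shows "B u z = 0"
proof (cases "u = 0 \<or> z = 0")
  case False
  then have w: "p + q = int n" "r + s = int n" using assms unfolding mem_J
    by (auto split: if_splits)
  then have m: "u \<in> F\<^sub>o p" "vec_cnj u \<in> F\<^sub>o q" "z \<in> F\<^sub>o r" "vec_cnj z \<in> F\<^sub>o s"
    using assms unfolding mem_J by auto
  show ?thesis
  proof (cases "p + r > int n")
    case True
    then have "z \<in> F\<^sub>o (int n - p + 1)" using m(3) Fo_mono[of "int n - p + 1" r] by auto
    then show ?thesis using B_Fo m(1) by blast
  next
    case False
    then have "vec_cnj z \<in> F\<^sub>o (int n - q + 1)" using m(4) Fo_mono[of "int n - q + 1" s] w assms(3)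
      by auto
    then have "B (vec_cnj u) (vec_cnj z) = 0" using B_Fo m(2) by blast
    then show ?thesis by (simp add: B_cnj)
  qed
qed auto

lemma types_J_bounds:
  assumes "(p, q) \<in> hodge.types"
  shows "0 \<le> p" "p \<le> int n"
proof -
  obtain u where u: "u \<in> J p q" "u \<noteq> 0" using assms unfolding hodge.mem_types by blast
  have w: "p + q = int n" using types_J assms by blast
  then have m: "u \<in> F\<^sub>o p" "vec_cnj u \<in> F\<^sub>o q" using u unfolding mem_J by auto
  show "p \<le> int n" using m(1) u(2) Fo_0[of p] by fastforce
  show "0 \<le> p" using m(2) u(2) Fo_0[of q] w by fastforce
qed

section \<open>Graded pieces of the Lie algebra and bracket generation\<close>

lemma lie_component_outside_types:
  assumes X: "X \<in> lie_component Q n F\<^sub>o d"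
    and out: "\<And>p q. (p, q) \<in> hodge.types \<Longrightarrow> (p + d, q - d) \<notin> hodge.types"
  shows "X = 0"
proof -
  have "X *v z = 0" for z
  proof -
    have "X *v hodge.cp p q z = 0" for p q
    proof (cases "(p, q) \<in> hodge.types")
      case True
      then have w: "p + q = int n" by (rule types_J)
      then have "hodge.cp p q z \<in> hodge_component F\<^sub>o p q" using hodge.cp_in[of p q z]
        unfolding J_def by simp
      then have "X *v hodge.cp p q z \<in> J (p + d) (q - d)"
        using X w unfolding lie_component_def J_def by auto
      then show ?thesis using out[OF True] unfolding hodge.mem_types by blast
    next
      case False
      then have "hodge.cp p q z = 0" using hodge.cp_types by blast
      then show ?thesis by simp
    qed
    then have "(\<Sum>a\<in>hodge.types. X *v hodge.cp (fst a) (snd a) z) = 0" by simp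
    then show ?thesis by (simp add: hodge.cp_sum_types flip: vec.sum)
  qed
  then show ?thesis by (simp add: matrix_eq)
qed

lemma zero_in_lie_component: "0 \<in> lie_component Q n F\<^sub>o d"
proof -
  have "0 \<in> hodge_component F\<^sub>o p q" for p q
    unfolding hodge_component_def using vec.subspace_0[OF subspace_Fo]
      by (auto simp: vec_cnj_image_iff)
  then show ?thesis unfolding lie_component_def complex_lie_algebra_def by auto
qed

text \<open>The algebra generated by zero is zero, and X is among the sums it must exhaust, with all
  other summands zero.\<close>

lemma bracket_generating_trivial:
  assumes bg: "bracket_generating Q n F\<^sub>o" and triv: "lie_component Q n F\<^sub>o (-1) = {0}"
    and X: "X \<in> lie_component Q n F\<^sub>o (- p)" "1 \<le> p" "p \<le> int n"
  shows "X = 0"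
proof -
  have "complex_lie_subalgebra {0 :: complex^'n^'n}"
    unfolding complex_lie_subalgebra_def by (auto simp: bracket_def map_matrix_def vec_eq_iff)
  then have hull: "complex_lie_subalgebra hull {0 :: complex^'n^'n} \<subseteq> {0}"
    by (rule hull_minimal[OF order_refl])
  define Y where "Y = (\<lambda>q. if q = p then X else 0)"
  have "(\<Sum>q=1..int n. Y q) = X" using X(2,3) by (simp add: Y_def)
  moreover have "\<forall>q\<in>{1..int n}. Y q \<in> lie_component Q n F\<^sub>o (- q)"
    using X(1) zero_in_lie_component by (simp add: Y_def)
  ultimately have "X \<in> {\<Sum>p=1..int n. X p |X. \<forall>p\<in>{1..int n}. X p \<in> lie_component Q n F\<^sub>o (- p)}"
    by blast
  then show ?thesis using bg triv hull unfolding bracket_generating_def by auto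
qed

text \<open>If the Hodge structure has only types of one parity, then the infinitesimal period relation
  vanishes; bracket generation leaves only the two-dimensional \<open>V\<close>, whose Lie algebra is abelian.\<close>

lemma not_pure_parity:
  assumes m: "n = 2 * m" and ss: "semisimple_lie (real_lie_algebra Q)" and bg: "bracket_generating Q n F\<^sub>o"
    and par: "\<And>p q p' q'. (p, q) \<in> hodge.types \<Longrightarrow> (p', q') \<in> hodge.types \<Longrightarrow> even (p - p')"
    and ex: "(p1, q1) \<in> hodge.types" "p1 \<noteq> q1"
  shows False
proof -
  have sym: "B u z = B z u" for u z using B_sym[of u z] m by simp
  have types_sym: "(q, p) \<in> hodge.types" if "(p, q) \<in> hodge.types" for p q
    using that cnj_J[of _ p q] unfolding hodge.mem_types by (metis vec_cnj_eq_0_iff)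
  \<comment> \<open>A map of degree -1 would change the parity of p.\<close>
  have triv: "lie_component Q n F\<^sub>o (-1) = {0}"
    using lie_component_outside_types[of _ "-1"] zero_in_lie_component par by fastforce
  define p0 where "p0 = Max (fst ` hodge.types)"
  define q0 where "q0 = int n - p0"
  have "p0 \<in> fst ` hodge.types"
    unfolding p0_def using hodge.finite_types ex(1) by (intro Max_in) auto
  then obtain q where q: "(p0, q) \<in> hodge.types" by force
  have "q = q0" using types_J[OF q] unfolding q0_def by simp
  then have p0: "(p0, q0) \<in> hodge.types" using q by simp
  have p0_max: "p \<le> p0" if "(p, q) \<in> hodge.types" for p q
    unfolding p0_def using that hodge.finite_types by (intro Max_ge) force+
  have pq0: "q0 < p0" using p0_max[OF ex(1)] p0_max[OF types_sym[OF ex(1)]] types_J[OF ex(1)] ex(2)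
    unfolding q0_def by linarith
  obtain x where x: "x \<in> J p0 q0" "x \<noteq> 0" using p0 unfolding hodge.mem_types by blast
  define x' where "x' = vec_cnj x"
  have x': "x' \<in> J q0 p0" "x' \<noteq> 0" using x cnj_J unfolding x'_def by auto
  have low: "\<exists>c. y = c *s x'" if y: "y \<in> J t u" "t < p0" for y t u
  proof (cases "y = 0")
    case True
    then show ?thesis by (intro exI[of _ 0]) simp
  next
    case False
    then have tu: "(t, u) \<in> hodge.types" using y(1) unfolding hodge.mem_types by blast
    have w: "t + u = int n" using types_J tu by blast
    \<comment> \<open>The rank-two infinitesimal isometry attached to x' and y. It is nonzero only
      on first indices p0 and n - t, and there lowers them by p0 - t \<ge> 1; so bracket generation
      kills it, forcing y to be proportional to x'.\<close>
    define X where "X = matrix (\<lambda>z. B x' z *s y - B y z *s x')"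
    have X: "X *v z = B x' z *s y - B y z *s x'" for z unfolding X_def
      by (rule matrix_complex_linear) (simp_all add: vec_eq_iff algebra_simps)
    have "X \<in> lie_component Q n F\<^sub>o (- (p0 - t))"
      unfolding lie_component_def mem_Collect_eq
    proof (intro conjI allI impI)
      show "X \<in> complex_lie_algebra Q"
        unfolding complex_lie_algebra_def by (simp add: X sym[of _ y] sym[of _ x'])
      fix r s assume rs: "r + s = int n"
      show "(*v) X ` hodge_component F\<^sub>o r s \<subseteq> hodge_component F\<^sub>o (r + - (p0 - t)) (s - - (p0 - t))"
      proof
        fix v assume "v \<in> (*v) X ` hodge_component F\<^sub>o r s"
        then obtain z where z: "z \<in> J r s" "v = X *v z" unfolding J_def using rs by auto
        have "B x' z *s y \<in> J (r - (p0 - t)) (s + (p0 - t))"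
        proof (cases "q0 + r = int n")
          case True
          then have "r - (p0 - t) = t" "s + (p0 - t) = u" using rs w unfolding q0_def by linarith+
          then show ?thesis using y(1) vec.subspace_scale[OF subspace_J] by simp
        next
          case False
          then have "B x' z = 0" using B_J[OF x'(1) z(1)] by blast
          then show ?thesis by (simp add: vec.subspace_0[OF subspace_J])
        qed
        moreover have "B y z *s x' \<in> J (r - (p0 - t)) (s + (p0 - t))"
        proof (cases "t + r = int n")
          case True
          then have "r - (p0 - t) = q0" "s + (p0 - t) = p0" using rs w unfolding q0_def by linarith+
          then show ?thesis using x'(1) vec.subspace_scale[OF subspace_J] by simp
        next
          case False
          then have "B y z = 0" using B_J[OF y(1) z(1)] by blast
          then show ?thesis by (simp add: vec.subspace_0[OF subspace_J])
        qed
        ultimately have "v \<in> J (r - (p0 - t)) (s + (p0 - t))"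
          unfolding z(2) X by (rule vec.subspace_diff[OF subspace_J])
        then show "v \<in> hodge_component F\<^sub>o (r + - (p0 - t)) (s - - (p0 - t))"
        proof -
          have "r - (p0 - t) + (s + (p0 - t)) = int n" using rs by simp
          then show ?thesis
            using \<open>v \<in> J (r - (p0 - t)) (s + (p0 - t))\<close> unfolding J_def
            by (simp only: if_True diff_conv_add_uminus minus_minus simp_thms)
        qed
      qed
    qed
    then have "X = 0"
    proof (rule bracket_generating_trivial[OF bg triv])
      show "1 \<le> p0 - t" using y(2) by simp
      show "p0 - t \<le> int n" using types_J_bounds[OF tu] types_J_bounds[OF p0] by simp
    qed
    then have X0: "B x' z *s y = B y z *s x'" for z using X[of z] by simp
    obtain z where z: "B x' z \<noteq> 0" using B_nondeg[of x'] x'(2) by blast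
    have "y = (B y z / B x' z) *s x'"
    proof -
      have "y = (1 / B x' z) *s (B x' z *s y)" using z by simp
      then show ?thesis unfolding X0 by simp
    qed
    then show ?thesis by blast
  qed
  have high: "\<exists>c. y = c *s x" if y: "y \<in> J p0 u" for y u
  proof -
    have "vec_cnj y \<in> J u p0" using y cnj_J by blast
    moreover have "u < p0 \<or> y = 0"
      using y pq0 unfolding mem_J q0_def by (auto split: if_splits)
    ultimately obtain c where "vec_cnj y = c *s x' \<or> y = 0" using low by blast
    then have "vec_cnj (vec_cnj y) = vec_cnj (c *s x') \<or> y = 0" by metis
    then show ?thesis unfolding x'_def by (auto intro: exI[of _ 0])
  qed
  have span: "\<exists>c d. z = c *s x + d *s x'" for z
  proof -
    have "z \<in> vec.span {x, x'}"
    proof -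
      have "hodge.cp p q z \<in> vec.span {x, x'}" for p q
      proof (cases "hodge.cp p q z = 0")
        case False
        then have pq: "(p, q) \<in> hodge.types" by (rule hodge.cp_types)
        then have "p < p0 \<or> p = p0" using p0_max by force
        then show ?thesis
        proof
          assume "p < p0"
          then obtain c where "hodge.cp p q z = c *s x'" using low hodge.cp_in by blast
          then show ?thesis by (simp add: vec.span_scale vec.span_base)
        next
          assume "p = p0"
          then obtain c where "hodge.cp p q z = c *s x" using high hodge.cp_in by blast
          then show ?thesis by (simp add: vec.span_scale vec.span_base)
        qed
      qed (simp add: vec.span_zero)
      then have "(\<Sum>a\<in>hodge.types. hodge.cp (fst a) (snd a) z) \<in> vec.span {x, x'}"
        by (intro vec.span_sum) auto
      then show ?thesis by (simp add: hodge.cp_sum_types)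
    qed
    then obtain c where "z - c *s x \<in> vec.span {x'}" unfolding vec.span_insert[of x "{x'}"] by auto
    then obtain d where "z - c *s x = d *s x'" unfolding vec.span_insert[of x' "{}"] by auto
    then show ?thesis by (metis diff_add_cancel add.commute)
  qed
  have Bxx: "B x x = 0" using B_J[OF x(1) x(1)] pq0 unfolding q0_def by auto
  have Bxx': "B x x' \<noteq> 0"
  proof
    assume "B x x' = 0"
    then have "B x z = 0" for z using span[of z] Bxx by auto
    then show False using B_nondeg x(2) by blast
  qed
  \<comment> \<open>Skewness makes Y x orthogonal to x. In the plane spanned by x and x', with x
    isotropic and not orthogonal to x', this leaves only multiples of x.\<close>
  have eigen: "\<exists>c. complex_matrix Y *v x = c *s x \<and> complex_matrix Y *v x' = cnj c *s x'"
    if Y: "Y \<in> real_lie_algebra Q" for Y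
  proof -
    have skew: "Q (Y *v u) v = - Q u (Y *v v)" for u v
      using Y unfolding real_lie_algebra_def by (simp add: eq_neg_iff_add_eq_0)
    have "B (complex_matrix Y *v x) x = - B x (complex_matrix Y *v x)"
      by (simp add: complex_form_def complex_eq_iff skew)
    then have 0: "B x (complex_matrix Y *v x) = 0" using sym[of x "complex_matrix Y *v x"] by simp
    obtain c d where cd: "complex_matrix Y *v x = c *s x + d *s x'" using span by blast
    then have "d = 0" using 0 Bxx Bxx' by simp
    then have c: "complex_matrix Y *v x = c *s x" using cd by simp
    have "complex_matrix Y *v x' = vec_cnj (c *s x)" unfolding x'_def complex_matrix_mult_cnj c ..
    then show ?thesis using c unfolding x'_def by auto
  qed
  have comm: "bracket Y Y' = 0" if Y: "Y \<in> real_lie_algebra Q" "Y' \<in> real_lie_algebra Q" for Y Y'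
  proof -
    obtain c c' where c: "complex_matrix Y *v x = c *s x" "complex_matrix Y *v x' = cnj c *s x'"
      "complex_matrix Y' *v x = c' *s x" "complex_matrix Y' *v x' = cnj c' *s x'"
      using eigen[OF Y(1)] eigen[OF Y(2)] by blast
    have "complex_matrix Y *v (complex_matrix Y' *v z) = complex_matrix Y' *v (complex_matrix Y *v z)" for z
    proof -
      obtain a b where "z = a *s x + b *s x'" using span by blast
      then show ?thesis by (simp add: vec.add vec.scale c mult.commute mult.left_commute)
    qed
    from this[of "cvec v" for v] have "Y *v (Y' *v v) = Y' *v (Y *v v)" for v
      by (simp add: complex_matrix_mult_cvec)
    then have "(Y ** Y') = Y' ** Y" unfolding matrix_eq by (simp flip: matrix_vector_mul_assoc)
    then show ?thesis unfolding bracket_def by simp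
  qed
  \<comment> \<open>The Lie algebra is abelian, hence a solvable ideal of itself; semisimplicity
    makes it zero. The contradiction is the nonzero infinitesimal rotation of the real plane
    constructed at the end.\<close>
  let ?g = "real_lie_algebra Q"
  have g0: "0 \<in> ?g" unfolding real_lie_algebra_def by (simp add: Q_simps)
  have "subspace ?g" unfolding subspace_def
  proof (intro conjI ballI allI)
    show "A + A' \<in> ?g" if "A \<in> ?g" "A' \<in> ?g" for A A'
    proof -
      have "Q (A *v u) v + Q u (A *v v) = 0" "Q (A' *v u) v + Q u (A' *v v) = 0" for u v
        using that unfolding real_lie_algebra_def by auto
      then show ?thesis unfolding real_lie_algebra_def
        by (simp add: matrix_vector_mult_add_rdistrib Q_simps) (metis add.assoc add.left_commute add_0)
    qed
    show "c *\<^sub>R A \<in> ?g" if "A \<in> ?g" for A and c :: real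
      using that unfolding real_lie_algebra_def
      by (simp add: Q_simps flip: scaleR_matrix_vector_assoc distrib_left)
  qed (rule g0)
  then have "lie_ideal ?g ?g" unfolding lie_ideal_def using comm g0 by simp
  moreover have "solvable_lie ?g"
  proof -
    have "{bracket X Y |X Y. X \<in> ?g \<and> Y \<in> ?g} = {0}"
      using comm g0 by (auto intro!: exI[of _ 0])
    then have "(derived_algebra ^^ 1) ?g = {0}" unfolding derived_algebra_def by simp
    then show ?thesis unfolding solvable_lie_def by blast
  qed
  ultimately have g_triv: "?g = {0}" using ss unfolding semisimple_lie_def by blast
  define v w where "v = vec_Re x" and "w = vec_Im x"
  define Y where "Y = matrix (\<lambda>z. Q v z *\<^sub>R w - Q w z *\<^sub>R v)"
  have "linear (\<lambda>z. Q v z *\<^sub>R w - Q w z *\<^sub>R v)"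
    by (auto intro!: linearI simp: Q_simps algebra_simps)
  then have Y: "Y *v z = Q v z *\<^sub>R w - Q w z *\<^sub>R v" for z
    unfolding Y_def by (rule fun_cong[OF matrix_vector_mul(2)])
  have Qsym: "Q a b = Q b a" for a b using Q_sym[of a b] m by simp
  have "Y \<in> ?g" unfolding real_lie_algebra_def by (simp add: Y Q_simps Qsym[of _ v] Qsym[of _ w])
  then have "Y *v v = 0" using g_triv by simp
  moreover have "Q v v = Q w w" "Q v w = 0"
    using Bxx Qsym[of w v] unfolding complex_form_def v_def w_def by (auto simp: complex_eq_iff)
  moreover have "Q v v + Q w w \<noteq> 0"
    using Bxx' Qsym[of v w] unfolding x'_def v_def w_def
      by (auto simp: complex_form_def complex_eq_iff Q_simps)
  ultimately have "Q v v *\<^sub>R w = 0" "Q v v \<noteq> 0" "Q w w \<noteq> 0" using Qsym[of w v] by (auto simp: Y)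
  then show False by (simp add: Q_simps)
qed

end

section \<open>Extremal degenerations\<close>

lemma (in bigraded) dim_gs_diagonal:
  assumes "finite A" "\<And>r s. (r, s) \<in> types \<Longrightarrow> P r s \<longleftrightarrow> (\<exists>j\<in>A. r = d + int j \<and> s = d + int j)"
  shows "vec.dim (gs P) = (\<Sum>j\<in>A. vec.dim (I (d + int j) (d + int j)))"
proof -
  let ?f = "\<lambda>j. (d + int j, d + int j)"
  have "gs P = gs (\<lambda>r s. (r, s) \<in> ?f ` A)" by (rule gs_cong) (use assms(2) in auto)
  then have "vec.dim (gs P) = (\<Sum>a\<in>?f ` A. vec.dim (I (fst a) (snd a)))"
    using dim_gs_finite[of "?f ` A"] assms(1) by simp
  also have "\<dots> = (\<Sum>j\<in>A. vec.dim (I (d + int j) (d + int j)))"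
    by (subst sum.reindex) (auto simp: inj_on_def)
  finally show ?thesis .
qed

text \<open>Shifting the even-indexed sum by one step absorbs c 0, so the hypothesis bounds the sum
  of c (2 i) by that of c (2 i + 1). Monotonicity gives the reverse inequality term by term.\<close>

lemma paired_sums_eq:
  fixes c :: "nat \<Rightarrow> nat"
  assumes anti: "\<And>j. c (Suc j) \<le> c j" and le: "c 0 + (\<Sum>i<K. c (2 * i + 2)) \<le> (\<Sum>i<K. c (2 * i + 1))"
    and i: "i < K"
  shows "c (2 * i + 1) = c (2 * i)"
proof -
  have shift: "c 0 + (\<Sum>i<k. c (2 * i + 2)) = (\<Sum>i<k. c (2 * i)) + c (2 * k)" for k
    by (induction k) simp_all
  have le': "c (2 * i + 1) \<le> c (2 * i)" for i using anti[of "2 * i"] by simp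
  show ?thesis
  proof (rule ccontr)
    assume "c (2 * i + 1) \<noteq> c (2 * i)"
    then have "c (2 * i + 1) < c (2 * i)" using le'[of i] by simp
    then have "(\<Sum>i<K. c (2 * i + 1)) < (\<Sum>i<K. c (2 * i))"
      using i le' by (intro sum_strict_mono_ex1) auto
    then show False using le shift[of K] by simp
  qed
qed

locale extremal_degeneration = extremal_lmhs +
  assumes F_dual: "F \<in> compact_dual Q F\<^sub>o"
    and ss: "semisimple_lie (real_lie_algebra Q)" and bg: "bracket_generating Q n F\<^sub>o"
begin

definition m :: nat where "m = n div 2"

lemma n_eq: "n = 2 * m"
  using even_n unfolding m_def by simp

text \<open>The difference of \<open>c j\<close> and \<open>c (Suc j)\<close> is the dimension of
  the primitive part of type (m + j, m + j).\<close>

definition c :: "nat \<Rightarrow> nat" where "c j = vec.dim (I (int m + int j) (int m + int j))"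

lemma c_antimono: "c (Suc j) \<le> c j"
  using dim_I_T_le[of "int m + int (Suc j)" "int m + int (Suc j)"] n_eq unfolding c_def by simp

lemma types_above: "(r, s) \<in> types \<Longrightarrow> r + s > int n \<Longrightarrow> \<exists>j\<ge>1. r = int m + int j \<and> s = int m + int j"
proof -
  assume rs: "(r, s) \<in> types" "r + s > int n"
  then have "r = s" using types_off_diagonal by fastforce
  then have "r > int m" using rs(2) n_eq by simp
  then have "r = int m + int (nat (r - int m))" "nat (r - int m) \<ge> 1" by auto
  then show ?thesis using \<open>r = s\<close> by metis
qed

lemma c_pos: "c j \<noteq> 0 \<longleftrightarrow> (int m + int j, int m + int j) \<in> types"
  unfolding c_def using dim_I_0 by simp

lemma c_eventually_0: "\<exists>K. \<forall>j\<ge>K. c j = 0"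
proof -
  have "finite {j. c j \<noteq> 0}"
  proof (rule finite_imageD)
    show "finite ((\<lambda>j. (int m + int j, int m + int j)) ` {j. c j \<noteq> 0})"
      by (rule finite_subset[OF _ finite_types]) (use c_pos in blast)
  qed (auto simp: inj_on_def)
  then obtain K where "\<forall>j\<in>{j. c j \<noteq> 0}. j < K" using finite_nat_set_iff_bounded by blast
  then have "\<forall>j\<ge>K. c j = 0" by (auto simp: not_less[symmetric])
  then show ?thesis ..
qed

text \<open>Otherwise nothing lies above weight n, so the opposite-sign part of the polarized
  structure is zero. All its Hodge types then have one parity, and they include an off-diagonal
  one.\<close>

lemma not_pure: "c 1 \<noteq> 0"
proof
  assume c1: "c 1 = 0"
  have c0: "c j = 0" if "j \<ge> 1" for j
    using that
  proof (induction j rule: dec_induct)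
    case (step j)
    then show ?case using c_antimono[of j] by simp
  qed (rule c1)
  have "gs (\<lambda>r s. r + s > int n) \<subseteq> {0}"
  proof
    fix v assume v: "v \<in> gs (\<lambda>r s. r + s > int n)"
    have "cp p q v = 0" for p q
    proof (rule ccontr)
      assume nz: "cp p q v \<noteq> 0"
      then have pq: "(p, q) \<in> types" by (rule cp_types)
      moreover have "p + q > int n" using v nz unfolding mem_gs by blast
      ultimately obtain j where "j \<ge> 1" "p = int m + int j" "q = int m + int j"
        using types_above by blast
      then show False using c0[of j] c_pos[of j] pq by simp
    qed
    then show "v \<in> {0}" using cp_eq_0I by blast
  qed
  then have 0: "vec.dim (gs (\<lambda>r s. r + s > int n)) = 0" by (simp add: vec.dim_eq_0)
  obtain e :: real where e: "e = 1 \<or> e = -1" "\<And>y. y \<in> W (int n) - W (int n - 1) \<Longrightarrow> e * Q y y > 0"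
    using definite_W by blast
  have "vec.dim (hodge.gs (\<lambda>r s. even (r - int m) \<longleftrightarrow> e = -1)) = 0"
    using signature_bound[OF F_dual n_eq e] 0 dim_gs_hodge[OF F_dual, of "\<lambda>r. even (r - int m) \<longleftrightarrow> e = -1"] by simp
  then have par: "\<not> (even (p - int m) \<longleftrightarrow> e = -1)" if "(p, q) \<in> hodge.types" for p q
    using hodge.dim_gs_0 that by blast
  \<comment> \<open>The first index a occurs at \<open>F\<^sub>o\<close> since graded dimensions
    agree; its partner is n - a = b.\<close>
  have "\<exists>q. (a, q) \<in> hodge.types"
  proof (rule ccontr)
    assume none: "\<not> ?thesis"
    have "hodge.gs (\<lambda>p q. p = a) \<subseteq> {0}"
    proof
      fix v assume v: "v \<in> hodge.gs (\<lambda>p q. p = a)"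
      have "hodge.cp p q v = 0" for p q
      proof (rule ccontr)
        assume nz: "hodge.cp p q v \<noteq> 0"
        then have "(p, q) \<in> hodge.types" by (rule hodge.cp_types)
        moreover have "p = a" using v nz unfolding hodge.mem_gs by blast
        ultimately show False using none by blast
      qed
      then show "v \<in> {0}" using hodge.cp_eq_0I by blast
    qed
    then have "vec.dim (hodge.gs (\<lambda>p q. p = a)) = 0" by (simp add: vec.dim_eq_0)
    then have "vec.dim (gs (\<lambda>p q. p = a)) = 0"
      using dim_gs_hodge[OF F_dual, of "\<lambda>p. p = a"] by metis
    then show False using dim_gs_0 ab(1) by blast
  qed
  then obtain q where q: "(a, q) \<in> hodge.types" ..
  have "a + b = int n" using types_off_diagonal ab by blast
  then have "a \<noteq> q" using types_J[OF q] a_gt_b by linarith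
  show False
  proof (rule not_pure_parity[OF n_eq ss bg _ q \<open>a \<noteq> q\<close>])
    fix p q p' q' assume "(p, q) \<in> hodge.types" "(p', q') \<in> hodge.types"
    then have "even (p - int m) = even (p' - int m)" using par by blast
    then show "even (p - p')" by simp blast
  qed
qed

text \<open>Reflecting the type (m + 1, m + 1) gives (m - 1, m - 1), of weight below n and hence
  bounded by b, while 2 b < 2 m.\<close>

lemma b_eq: "b = int m - 1"
proof -
  have "(int m + 1, int m + 1) \<in> types" using not_pure c_pos[of 1] by simp
  then have "(int n - (int m + 1), int n - (int m + 1)) \<in> types" by (simp add: types_reflect)
  moreover have "int n - (int m + 1) = int m - 1" using n_eq by simp
  ultimately have "(int m - 1, int m - 1) \<in> types" by metis
  then have "int m - 1 \<le> b" using types_lower(2) n_eq by simp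
  then show ?thesis using two_b_less n_eq by simp
qed

lemma types_off_diagonal_cases:
  "(r, s) \<in> types \<Longrightarrow> r \<noteq> s \<Longrightarrow> (r, s) = (int m + 1, int m - 1) \<or> (r, s) = (int m - 1, int m + 1)"
  using types_off_diagonal[of r s] b_min[of r s] b_min_fst[of r s] b_eq n_eq by auto

lemma types_extremal: "(int m + 1, int m - 1) \<in> types" "(int m - 1, int m + 1) \<in> types"
proof -
  have "(a, b) = (int m + 1, int m - 1)" using types_off_diagonal_cases[OF ab] a_gt_b by auto
  then show "(int m + 1, int m - 1) \<in> types" using ab(1) by simp
  then show "(int m - 1, int m + 1) \<in> types" using types_cnj by blast
qed

lemma types_weight: "(r, s) \<in> types \<Longrightarrow> r + s \<noteq> int n \<Longrightarrow> r = s"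
  using types_off_diagonal by blast

text \<open>Outside weight n all types are diagonal, so the reflection sends r - m to m - r.\<close>

lemma dim_below:
  "vec.dim (gs (\<lambda>r s. r + s < int n \<and> P (r - int m))) =
   vec.dim (gs (\<lambda>r s. r + s > int n \<and> P (int m - r)))"
proof -
  have "(\<Sum>x\<in>{x \<in> types. fst x + snd x < int n \<and> P (fst x - int m)}. vec.dim (I (fst x) (snd x))) =
      (\<Sum>x\<in>{x \<in> types. fst x + snd x > int n \<and> P (int m - fst x)}. vec.dim (I (fst x) (snd x)))"
  proof (rule sum.reindex_bij_witness[of _ "\<lambda>x. (int n - snd x, int n - fst x)"
      "\<lambda>x. (int n - snd x, int n - fst x)"])
    fix x assume x: "x \<in> {x \<in> types. fst x + snd x < int n \<and> P (fst x - int m)}"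
    then have "fst x = snd x" using types_weight[of "fst x" "snd x"] by auto
    then have eq: "int m - (int n - snd x) = fst x - int m" using n_eq by simp
    have "P (int m - (int n - snd x))" unfolding eq using x by blast
    then show "(int n - snd x, int n - fst x) \<in> {x \<in> types. fst x + snd x > int n \<and> P (int m - fst x)}"
      using x types_reflect[of "snd x" "fst x"] by simp
  next
    fix x assume x: "x \<in> {x \<in> types. fst x + snd x > int n \<and> P (int m - fst x)}"
    then have "fst x = snd x" using types_weight[of "fst x" "snd x"] by auto
    then have eq: "int n - snd x - int m = int m - fst x" using n_eq by simp
    have "P (int n - snd x - int m)" unfolding eq using x by blast
    then show "(int n - snd x, int n - fst x) \<in> {x \<in> types. fst x + snd x < int n \<and> P (fst x - int m)}"
      using x types_reflect[of "snd x" "fst x"] by simp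
  qed (auto simp: dim_I_reflect)
  then show ?thesis unfolding dim_gs .
qed

lemma dim_split:
  "vec.dim (gs (\<lambda>r s. P (r - int m))) =
   vec.dim (gs (\<lambda>r s. r + s > int n \<and> P (int m - r))) + vec.dim (gs (\<lambda>r s. r + s > int n \<and> P (r - int m)))
   + vec.dim (gs (\<lambda>r s. r + s = int n \<and> P (r - int m)))"
proof -
  let ?l = "\<lambda>r s. r + s < int n \<and> P (r - int m)" and ?g = "\<lambda>r s. r + s > int n \<and> P (r - int m)"
    and ?e = "\<lambda>r s. r + s = int n \<and> P (r - int m)"
  have 1: "gs (\<lambda>r s. P (r - int m)) = gs (\<lambda>r s. (?l r s \<or> ?g r s) \<or> ?e r s)"
    by (rule gs_cong) auto
  have 2: "vec.dim (gs (\<lambda>r s. (?l r s \<or> ?g r s) \<or> ?e r s)) =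
      vec.dim (gs (\<lambda>r s. ?l r s \<or> ?g r s)) + vec.dim (gs ?e)"
    by (rule dim_gs_disj[of "\<lambda>r s. ?l r s \<or> ?g r s" ?e]) auto
  have 3: "vec.dim (gs (\<lambda>r s. ?l r s \<or> ?g r s)) = vec.dim (gs ?l) + vec.dim (gs ?g)"
    by (rule dim_gs_disj[of ?l ?g]) auto
  show ?thesis unfolding 1 2 3 by (simp only: dim_below[of P])
qed

text \<open>The signature of the polarization forces consecutive diagonal dimensions to agree in pairs,
  which is the vanishing of every second primitive space.\<close>

lemma c_pairs: "c (2 * i + 1) = c (2 * i)"
proof -
  obtain K where K: "\<And>j. j \<ge> K \<Longrightarrow> c j = 0" using c_eventually_0 by blast
  have above: "(r, s) \<in> types \<Longrightarrow> r + s > int n \<Longrightarrow> \<exists>j. 1 \<le> j \<and> j < K \<and> r = int m + int j \<and> s = int m + int j" for r s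
  proof -
    assume rs: "(r, s) \<in> types" "r + s > int n"
    then obtain j where j: "j \<ge> 1" "r = int m + int j" "s = int m + int j" using types_above
      by blast
    then have "c j \<noteq> 0" using rs(1) c_pos by simp
    then have "j < K" using K[of j] by (meson not_le)
    then show ?thesis using j by blast
  qed
  have odd_dim: "vec.dim (gs (\<lambda>r s. r + s > int n \<and> odd (r - int m))) = (\<Sum>i<K. c (2 * i + 1))"
  proof -
    have "vec.dim (gs (\<lambda>r s. r + s > int n \<and> odd (r - int m))) = (\<Sum>j\<in>(\<lambda>i. 2 * i + 1) ` {..<K}. c j)"
      unfolding c_def
    proof (rule dim_gs_diagonal)
      fix r s assume rs: "(r, s) \<in> types"
      show "(r + s > int n \<and> odd (r - int m)) \<longleftrightarrow>
          (\<exists>j\<in>(\<lambda>i. 2 * i + 1) ` {..<K}. r = int m + int j \<and> s = int m + int j)" (is "?l \<longleftrightarrow> ?r")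
      proof
        assume ?l
        then obtain j where j: "1 \<le> j" "j < K" "r = int m + int j" "s = int m + int j"
          using above rs by blast
        then have "odd j" using \<open>?l\<close> by simp
        then obtain i where "j = 2 * i + 1" by (rule oddE)
        then have "j \<in> (\<lambda>i. 2 * i + 1) ` {..<K}" using j(2) by auto
        then show ?r using j by blast
      qed (use n_eq in auto)
    qed simp
    also have "\<dots> = (\<Sum>i<K. c (2 * i + 1))" by (subst sum.reindex) (auto simp: inj_on_def)
    finally show ?thesis .
  qed
  have even_dim: "vec.dim (gs (\<lambda>r s. r + s > int n \<and> even (r - int m))) = (\<Sum>i<K. c (2 * i + 2))"
  proof -
    have "vec.dim (gs (\<lambda>r s. r + s > int n \<and> even (r - int m))) = (\<Sum>j\<in>(\<lambda>i. 2 * i + 2) ` {..<K}. c j)"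
      unfolding c_def
    proof (rule dim_gs_diagonal)
      fix r s assume rs: "(r, s) \<in> types"
      show "(r + s > int n \<and> even (r - int m)) \<longleftrightarrow>
          (\<exists>j\<in>(\<lambda>i. 2 * i + 2) ` {..<K}. r = int m + int j \<and> s = int m + int j)" (is "?l \<longleftrightarrow> ?r")
      proof
        assume ?l
        then obtain j where j: "1 \<le> j" "j < K" "r = int m + int j" "s = int m + int j"
          using above rs by blast
        then have "even j" using \<open>?l\<close> by simp
        then obtain i' where i': "j = 2 * i'" by (rule evenE)
        then have "j = 2 * (i' - 1) + 2" "i' - 1 < K" using j(1,2) by auto
        then have "j \<in> (\<lambda>i. 2 * i + 2) ` {..<K}" by blast
        then show ?r using j by blast
      qed (use n_eq in auto)
    qed simp
    also have "\<dots> = (\<Sum>i<K. c (2 * i + 2))" by (subst sum.reindex) (auto simp: inj_on_def)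
    finally show ?thesis .
  qed
  have total: "vec.dim (gs (\<lambda>r s. r + s > int n)) = (\<Sum>i<K. c (2 * i + 1)) + (\<Sum>i<K. c (2 * i + 2))"
  proof -
    let ?o = "\<lambda>r s. r + s > int n \<and> odd (r - int m)" and ?e = "\<lambda>r s. r + s > int n \<and> even (r - int m)"
    have "gs (\<lambda>r s. r + s > int n) = gs (\<lambda>r s. ?o r s \<or> ?e r s)" by (rule gs_cong) auto
    moreover have "vec.dim (gs (\<lambda>r s. ?o r s \<or> ?e r s)) = vec.dim (gs ?o) + vec.dim (gs ?e)"
      by (rule dim_gs_disj[of ?o ?e]) auto
    ultimately show ?thesis by (simp only: odd_dim even_dim)
  qed
  have flip: "odd (int m - r) = odd (r - int m)" "even (int m - r) = even (r - int m)" for r by auto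
  obtain e :: real where e: "e = 1 \<or> e = -1" "\<And>y. y \<in> W (int n) - W (int n - 1) \<Longrightarrow> e * Q y y > 0"
    using definite_W by blast
  note bound = signature_bound[OF F_dual n_eq e]
  show ?thesis
  proof (cases "e = 1")
    case True
    \<comment> \<open>For e = 1 the opposite-sign types are the odd ones. They occur equally often
      above and below weight n, and the off-diagonal middle types add more, so the even types above
      would strictly outnumber the odd ones, against monotonicity of c.\<close>
    have "vec.dim (gs (\<lambda>r s. r + s = int n \<and> odd (r - int m))) \<noteq> 0"
      using dim_gs_0[OF _ types_extremal(1), of "\<lambda>r s. r + s = int n \<and> odd (r - int m)"] n_eq
        by auto
    moreover have "vec.dim (gs (\<lambda>r s. odd (r - int m))) \<le> vec.dim (gs (\<lambda>r s. r + s > int n))"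
      using bound True by simp
    then have "(\<Sum>i<K. c (2 * i + 1)) + (\<Sum>i<K. c (2 * i + 1)) +
        vec.dim (gs (\<lambda>r s. r + s = int n \<and> odd (r - int m))) \<le>
        (\<Sum>i<K. c (2 * i + 1)) + (\<Sum>i<K. c (2 * i + 2))"
      unfolding dim_split[of odd] total flip odd_dim .
    ultimately have "(\<Sum>i<K. c (2 * i + 1)) < (\<Sum>i<K. c (2 * i + 2))" by linarith
    moreover have "(\<Sum>i<K. c (2 * i + 2)) \<le> (\<Sum>i<K. c (2 * i + 1))"
      using c_antimono[of "2 * i + 1" for i] by (intro sum_mono) simp
    ultimately show ?thesis by simp
  next
    case False
    then have "e = -1" using e(1) by simp
    then have "vec.dim (gs (\<lambda>r s. even (r - int m))) \<le> vec.dim (gs (\<lambda>r s. r + s > int n))"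
      using bound by simp
    then have "(\<Sum>i<K. c (2 * i + 2)) + (\<Sum>i<K. c (2 * i + 2)) +
        vec.dim (gs (\<lambda>r s. r + s = int n \<and> even (r - int m))) \<le>
        (\<Sum>i<K. c (2 * i + 1)) + (\<Sum>i<K. c (2 * i + 2))"
      unfolding dim_split[of even] total flip even_dim .
    \<comment> \<open>For e = -1 the even types are counted, and in weight n only (m, m) is even.
      This is the origin of the term c 0.\<close>
    moreover have "vec.dim (gs (\<lambda>r s. r + s = int n \<and> even (r - int m))) = c 0"
    proof -
      have "vec.dim (gs (\<lambda>r s. r + s = int n \<and> even (r - int m))) = (\<Sum>j\<in>{0}. c j)"
        unfolding c_def
      proof (rule dim_gs_diagonal)
        fix r s assume "(r, s) \<in> types"
        then show "(r + s = int n \<and> even (r - int m)) \<longleftrightarrow> (\<exists>j\<in>{0}. r = int m + int j \<and> s = int m + int j)"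
          using types_off_diagonal_cases[of r s] n_eq by (cases "r = s") auto
      qed simp
      then show ?thesis by simp
    qed
    ultimately have "c 0 + (\<Sum>i<K. c (2 * i + 2)) \<le> (\<Sum>i<K. c (2 * i + 1))"
      by linarith
    then show ?thesis
    proof (cases "i < K")
      case False
      then show ?thesis using K[of "2 * i"] K[of "2 * i + 1"] by simp
    qed (rule paired_sums_eq[where c = c, OF c_antimono])
  qed
qed

text \<open>Equality of the two dimensions makes N surjective onto this piece, so u = N u'.
  Primitivity of u then reads N^{2j+2} u' = 0, which injectivity in weight n + 2 j + 2 excludes for
  nonzero u'.\<close>

lemma no_primitive:
  assumes u: "u \<in> I (int m + int j) (int m + int j)" "even j" "(T ^^ (2 * j + 1)) u = 0"
  shows "u = 0"
proof -
  obtain i where i: "j = 2 * i" using assms(2) by (rule evenE)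
  let ?p = "int m + int j + 1"
  have "vec.dim (I ?p ?p) = vec.dim (I (?p - 1) (?p - 1))"
    using c_pairs[of i] unfolding c_def i by (simp add: algebra_simps)
  moreover have "u \<in> I (?p - 1) (?p - 1)" using u(1) by simp
  ultimately obtain u' where u': "u' \<in> I ?p ?p" "T u' = u"
    using T_surj_dim[of ?p ?p u] n_eq by auto
  have "(T ^^ (2 * j + 2)) u' = (T ^^ (2 * j + 1)) (T u')"
    using T_pow_T_pow[of "2 * j + 1" 1 u'] by simp
  then have "(T ^^ (2 * j + 2)) u' = 0" using u'(2) u(3) by simp
  then have "u' = 0" by (rule T_pow_inj[OF u'(1), rotated]) (use n_eq in simp)
  then show ?thesis using u'(2) by simp
qed

section \<open>Primitive spaces and their Hodge components\<close>

lemma gr_filtration_eq: "gr_filtration W F l p = gs (\<lambda>r s. r + s \<le> l \<and> (p \<le> r \<or> r + s \<le> l - 1))"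
  (is "_ = gs ?P")
proof
  show "gr_filtration W F l p \<subseteq> gs ?P" unfolding gr_filtration_def
  proof (rule vec.span_minimal[OF _ subspace_gs])
    show "F p \<inter> complexify (W l) \<union> complexify (W (l - 1)) \<subseteq> gs ?P"
      unfolding F_eq[of p] Wc_eq[of l] Wc_eq[of "l - 1"] gs_Int
      by (intro Un_least gs_mono) auto
  qed
  show "gs ?P \<subseteq> gr_filtration W F l p"
  proof -
    have "I r s \<subseteq> gr_filtration W F l p" if "?P r s" for r s
    proof -
      have "I r s \<subseteq> F p \<inter> complexify (W l) \<union> complexify (W (l - 1))"
      proof (cases "p \<le> r")
        case True
        then have "I r s \<subseteq> gs (\<lambda>r s. p \<le> r \<and> r + s \<le> l)" using that by (intro I_subset_gs) simp
        then show ?thesis unfolding F_eq[of p] Wc_eq[of l] gs_Int by blast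
      next
        case False
        then have "I r s \<subseteq> gs (\<lambda>r s. r + s \<le> l - 1)" using that by (intro I_subset_gs) simp
        then show ?thesis unfolding Wc_eq[of "l - 1"] by blast
      qed
      then show ?thesis unfolding gr_filtration_def using vec.span_superset by blast
    qed
    then show ?thesis unfolding graded_sum_def[of I ?P]
      by (intro vec.span_minimal) (auto simp: gr_filtration_def)
  qed
qed

lemma mem_gr_prim: "v \<in> complexify (gr_prim N n W k) \<longleftrightarrow>
    v \<in> complexify (W (int n + int k)) \<and> (T ^^ (k + 1)) v \<in> complexify (W (int n - int k - 3))"
  by (auto simp: complexify_def gr_prim_def simp del: funpow.simps)

lemma W_subset_gr_prim: "complexify (W (int n + int k - 1)) \<subseteq> complexify (gr_prim N n W k)"
proof
  fix v assume v: "v \<in> complexify (W (int n + int k - 1))"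
  have "complexify (W (int n + int k - 1)) \<subseteq> complexify (W (int n + int k))"
    by (intro complexify_mono W_mono) simp
  moreover have "int n + int k - 1 - 2 * int (k + 1) = int n - int k - 3" by simp
  ultimately show "v \<in> complexify (gr_prim N n W k)"
    unfolding mem_gr_prim using v T_pow_W[OF v, of "k + 1"] by auto
qed

text \<open>Primitivity in the quotient holds only modulo lower weight; homogeneity of N makes it
  exact on each component of top weight.\<close>

lemma gr_prim_leading:
  assumes "v \<in> complexify (gr_prim N n W k)" "r + s = int n + int k"
  shows "(T ^^ (k + 1)) (cp r s v) = 0"
proof -
  have "(T ^^ (k + 1)) v \<in> complexify (W (int n - int k - 3))" using assms(1) mem_gr_prim by blast
  then have "cp (r - int (k + 1)) (s - int (k + 1)) ((T ^^ (k + 1)) v) = 0"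
    unfolding Wc_eq mem_gs using assms(2) by force
  then show ?thesis unfolding cp_T_pow by simp
qed

lemma gr_prim_trivial:
  assumes "k \<noteq> 0" "k mod 4 \<noteq> 2"
  shows "\<not> gr_prim_nonzero N n W k"
proof -
  have "complexify (gr_prim N n W k) \<subseteq> complexify (W (int n + int k - 1))"
  proof
    fix v assume v: "v \<in> complexify (gr_prim N n W k)"
    then have vW: "v \<in> gs (\<lambda>r s. r + s \<le> int n + int k)" unfolding mem_gr_prim Wc_eq by blast
    show "v \<in> complexify (W (int n + int k - 1))" unfolding Wc_eq mem_gs
    proof (intro allI impI)
      fix r s assume nz: "cp r s v \<noteq> 0"
      then have le: "r + s \<le> int n + int k" using vW unfolding mem_gs by blast
      have "r + s \<noteq> int n + int k"
      proof
        assume eq: "r + s = int n + int k"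
        then have rs: "r = s" using types_weight[OF cp_types[OF nz]] assms(1) by simp
        define j where "j = k div 2"
        \<comment> \<open>A diagonal type of weight 2 m + k forces k to be even, so odd k is
          excluded here as well.\<close>
        have k: "k = 2 * j" using eq rs n_eq unfolding j_def by presburger
        then have "even j" using assms(2) by presburger
        moreover have r: "r = int m + int j" using eq rs n_eq k by simp
        moreover have "(T ^^ (2 * j + 1)) (cp r s v) = 0"
          using gr_prim_leading[OF v eq] k by simp
        ultimately have "cp r s v = 0" using no_primitive[of "cp r s v" j] cp_in[of r s v] rs
          by simp
        then show False using nz by simp
      qed
      then show "r + s \<le> int n + int k - 1" using le by simp
    qed
  qed
  then have eq: "complexify (gr_prim N n W k) = complexify (W (int n + int k - 1))"
    using W_subset_gr_prim by blast
  have "subspace (gr_prim N n W k)"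
    using subspace_W[of "int n + int k"] subspace_W[of "int n - int k - 3"]
    unfolding subspace_def gr_prim_def by (simp add: vec.add matrix_vector_mult_scaleR)
  then show ?thesis using eq complexify_inject subspace_W unfolding gr_prim_nonzero_def by blast
qed

text \<open>Types of weight l = n + k are diagonal, so the induced filtration on that quotient is
  zero beyond l/2; one of two distinct indices with sum l lies there.\<close>

lemma gr_prim_hodge_tate: "k \<noteq> 0 \<Longrightarrow> gr_prim_hodge_tate N n W F k"
  unfolding gr_prim_hodge_tate_def
proof (intro allI impI)
  fix p q assume k: "k \<noteq> 0" and pq: "p + q = int n + int k \<and> p \<noteq> q"
  let ?l = "int n + int k"
  let ?G = "gr_filtration W F ?l"
  have lower: "complexify (W (?l - 1)) \<subseteq> ?G p'" for p'
    unfolding gr_filtration_def using vec.span_superset by blast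
  have small: "?G p' = complexify (W (?l - 1))" if "2 * p' > ?l" for p'
    unfolding gr_filtration_eq Wc_eq
  proof (rule gs_cong)
    fix r s assume "(r, s) \<in> types"
    then show "(r + s \<le> ?l \<and> (p' \<le> r \<or> r + s \<le> ?l - 1)) \<longleftrightarrow> r + s \<le> ?l - 1"
      using types_weight[of r s] that k by fastforce
  qed
  have cnj: "vec_cnj ` complexify (W (?l - 1)) = complexify (W (?l - 1))"
    using cnj_W unfolding set_eq_iff vec_cnj_image_iff by blast
  have "hodge_component ?G p q = complexify (W (?l - 1))"
  proof (cases "2 * p > ?l")
    case True
    have "complexify (W (?l - 1)) \<subseteq> vec_cnj ` ?G q" using image_mono[OF lower[of q], of vec_cnj] cnj
      by blast
    then show ?thesis unfolding hodge_component_def small[OF True] by blast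
  next
    case False
    then have "2 * q > ?l" using pq by linarith
    then have "vec_cnj ` ?G q = complexify (W (?l - 1))" using small cnj by simp
    then show ?thesis unfolding hodge_component_def using lower[of p] by blast
  qed
  then show "gr_prim_component N n W F k p q = complexify (W (?l - 1))"
    unfolding gr_prim_component_def using W_subset_gr_prim by blast
qed

text \<open>N would map into an off-diagonal piece of weight n - 2, and there is none.\<close>

lemma extremal_in_gr_prim:
  assumes "(r, s) = (int m + 1, int m - 1) \<or> (r, s) = (int m - 1, int m + 1)" "u \<in> I r s"
  shows "u \<in> complexify (gr_prim N n W 0)"
proof -
  have "(r - 1, s - 1) \<notin> types" using types_off_diagonal[of "r - 1" "s - 1"] assms(1) n_eq by auto
  then have "T u = 0" using T_I[OF assms(2)] unfolding mem_types by blast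
  moreover have "u \<in> complexify (W (int n))"
    unfolding Wc_eq using I_subset_gs[of "\<lambda>p q. p + q \<le> int n" r s] assms n_eq by auto
  ultimately show ?thesis unfolding mem_gr_prim
    using vec.subspace_0[OF subspace_complexify[OF subspace_W]] by simp
qed

lemma gr_prim_middle: "gr_prim_nonzero N n W 0"
proof -
  obtain u where u: "u \<in> I (int m + 1) (int m - 1)" "u \<noteq> 0" using types_extremal(1)
    unfolding mem_types by blast
  have "u \<in> complexify (gr_prim N n W 0)" using extremal_in_gr_prim u(1) by blast
  moreover have "u \<notin> complexify (W (int n - 1))"
  proof
    assume "u \<in> complexify (W (int n - 1))"
    moreover have "cp (int m + 1) (int m - 1) u \<noteq> 0" using cp_of_I[OF u(1)] u(2) by simp
    ultimately have "int m + 1 + (int m - 1) \<le> int n - 1" unfolding Wc_eq mem_gs by blast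
    then show False using n_eq by simp
  qed
  ultimately show ?thesis unfolding gr_prim_nonzero_def by auto
qed

text \<open>The extremal pieces are primitive because N kills them. The only other type of weight n
  is (m, m), where the pairing of dimensions at index 0 leaves no primitive vector.\<close>

lemma deligne_prim_middle:
  assumes pq: "p + q = int n"
  shows "deligne_prim N n W F I p q \<noteq> {0} \<longleftrightarrow>
    (p, q) = (int m + 1, int m - 1) \<or> (p, q) = (int m - 1, int m + 1)"
proof -
  have k: "nat (p + q - int n) = 0" using pq by simp
  have memD: "u \<in> deligne_prim N n W F I p q \<longleftrightarrow> u \<in> I p q \<and> u \<in> complexify (gr_prim N n W 0) \<and>
      u \<in> gr_filtration W F (int n) p \<and> vec_cnj u \<in> gr_filtration W F (int n) q" for u
    unfolding deligne_prim_def gr_prim_component_def hodge_component_def k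
      by (auto simp: vec_cnj_image_iff)
  show ?thesis
  proof (cases "(p, q) = (int m + 1, int m - 1) \<or> (p, q) = (int m - 1, int m + 1)")
    case True
    then have "(p, q) \<in> types" using types_extremal by auto
    then obtain u where u: "u \<in> I p q" "u \<noteq> 0" unfolding mem_types by blast
    have "u \<in> gr_filtration W F (int n) p" unfolding gr_filtration_eq
      by (rule subsetD[OF I_subset_gs u(1)]) (use pq in auto)
    moreover have "vec_cnj u \<in> gr_filtration W F (int n) q" unfolding gr_filtration_eq mem_gs
    proof (intro allI impI)
      fix r s assume "cp r s (vec_cnj u) \<noteq> 0"
      then have "(r, s) = (q, p) \<or> r < q \<and> s < p" by (rule cnj_I[OF u(1)])
      then show "r + s \<le> int n \<and> (q \<le> r \<or> r + s \<le> int n - 1)" using pq by auto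
    qed
    ultimately have "u \<in> deligne_prim N n W F I p q"
      using u(1) extremal_in_gr_prim[OF True] unfolding memD by blast
    then show ?thesis using u(2) True by blast
  next
    case False
    have "u = 0" if u: "u \<in> deligne_prim N n W F I p q" for u
    proof (rule ccontr)
      assume "u \<noteq> 0"
      have uI: "u \<in> I p q" and up: "u \<in> complexify (gr_prim N n W 0)" using u unfolding memD by auto
      have "(p, q) \<in> types" using uI \<open>u \<noteq> 0\<close> unfolding mem_types by blast
      then have "p = q" using types_off_diagonal_cases False by blast
      then have p: "p = int m + int 0" "q = int m + int 0" using pq n_eq by auto
      have "(T ^^ (0 + 1)) (cp p q u) = 0" by (rule gr_prim_leading[OF up]) (use pq in simp)
      then have "(T ^^ (2 * 0 + 1)) u = 0" using cp_of_I[OF uI, of p q] by simp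
      then have "u = 0" using no_primitive[of u 0] uI p by simp
      then show False using \<open>u \<noteq> 0\<close> by simp
    qed
    moreover have "0 \<in> deligne_prim N n W F I p q"
      unfolding memD using vec.subspace_0[OF subspace_complexify[OF subspace_W]] T_pow_zero
      by (simp add: mem_gr_prim gr_filtration_def vec.span_zero)
    ultimately show ?thesis using False by blast
  qed
qed

end

lemma (in limiting_mhs) minimal_off_diagonal:
  assumes "\<not> hodge_tate I"
  obtains a b where "(a, b) \<in> types" "a \<noteq> b" "\<And>r s. (r, s) \<in> types \<Longrightarrow> r \<noteq> s \<Longrightarrow> b \<le> s"
proof -
  define A where "A = {x \<in> types. fst x \<noteq> snd x}"
  have "finite A" unfolding A_def using finite_types by simp
  moreover have "A \<noteq> {}" using assms unfolding hodge_tate_def A_def types_def by force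
  ultimately obtain x where x: "x \<in> A" "\<And>y. y \<in> A \<Longrightarrow> snd x \<le> snd y"
    using Min_in[of "snd ` A"] Min_le[of "snd ` A"] by fastforce
  then show ?thesis using that[of "fst x" "snd x"] unfolding A_def by force
qed

theorem theorem1p12:
  fixes Q :: "real^'n \<Rightarrow> real^'n \<Rightarrow> real"
    and n :: nat
    and h :: "int \<Rightarrow> nat"
    and F\<^sub>o F :: "int \<Rightarrow> (complex^'n) set"
    and N :: "real^'n^'n"
    and W :: "int \<Rightarrow> (real^'n) set"
    and I :: "int \<Rightarrow> int \<Rightarrow> (complex^'n) set"
    and Z :: "(int \<Rightarrow> (complex^'n) set) set"
  assumes "polarization_form Q n"
    and "semisimple_lie (real_lie_algebra Q)"
    and "F\<^sub>o \<in> polarized_hodge_structures Q n h"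
    and "bracket_generating Q n F\<^sub>o"
    and "nilpotent_orbit Q F\<^sub>o F N"
    and "monodromy_weight_filtration N n W"
    and "deligne_splitting W F I"
    and "closed_orbit Q F\<^sub>o Z"
    and "maps_to_orbit Q F\<^sub>o F N Z"
    and "\<not> hodge_tate I"
  shows "\<exists>m::nat. n = 2 * m \<and>
    (\<forall>k::nat. k \<noteq> 0 \<longrightarrow> gr_prim_hodge_tate N n W F k \<and> (gr_prim_nonzero N n W k \<longrightarrow> even k)) \<and>
    (\<forall>k::nat. k \<noteq> 0 \<longrightarrow> gr_prim_nonzero N n W k \<longrightarrow> k mod 4 = 2) \<and>
    gr_prim_nonzero N n W 0 \<and>
    (\<forall>p q. p + q = int n \<longrightarrow>
       (deligne_prim N n W F I p q \<noteq> {0} \<longleftrightarrow>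
          (p, q) = (int m + 1, int m - 1) \<or> (p, q) = (int m - 1, int m + 1)))"
proof -
  interpret polarized_lmhs Q n F\<^sub>o N W F I
    using assms unfolding nilpotent_orbit_def polarized_hodge_structures_def
    by unfold_locales auto
  obtain K where K: "matrix_power N K = 0" using assms(5) unfolding nilpotent_orbit_def by blast
  have F: "F \<in> compact_dual Q F\<^sub>o" using assms(5) unfolding nilpotent_orbit_def by blast
  obtain L where L: "L \<in> Z" and lim: "limitin dual_top
      (\<lambda>z. act (matrix_exp (map_matrix (\<lambda>x. z * complex_of_real x) N)) F) L (filtercomap Im at_top)"
    using assms(9) unfolding maps_to_orbit_def by blast
  have L_dual: "L \<in> compact_dual Q F\<^sub>o"
    using limitin_topspace[OF lim] openin_topspace[of dual_top]
      unfolding openin_compact_dual_topology by blast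
  obtain a b where ab: "(a, b) \<in> types" "a \<noteq> b" "\<And>r s. (r, s) \<in> types \<Longrightarrow> r \<noteq> s \<Longrightarrow> b \<le> s"
    using minimal_off_diagonal[OF assms(10)] by blast
  interpret extremal_degeneration Q n F\<^sub>o N W F I L Z a b
    by unfold_locales
      (use assms(2,4,8) L L_dual ab F limit_filtration[OF K F L_dual lim] in auto)
  have mod: "k mod 4 = 2" if "k \<noteq> 0" "gr_prim_nonzero N n W k" for k
    using gr_prim_trivial that by blast
  moreover have "even k" if "k \<noteq> 0" "gr_prim_nonzero N n W k" for k
    using mod[OF that] by presburger
  ultimately show ?thesis
    using n_eq gr_prim_hodge_tate gr_prim_middle deligne_prim_middle by blast
qed

end
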